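(* There exist globally hyperbolic space-times which are null complete and timelike complete, and which are refocusing but not strongly refocusing at a point; and there exist globally hyperbolic space-times which are null complete and timelike complete, and which are refocusing but not strongly refocusing at all points of a hypersurface.
   Context: All manifolds are smooth ($C^\infty$). A space-time $(X,g)$ is a connected, time-oriented smooth Lorentz manifold (signature $(+,\dots,+,-)$) of dimension at least $2$; its points are called events. A nonzero tangent vector $v$ is timelike, null or nonspacelike if $g(v,v)<0$, $g(v,v)=0$ or $g(v,v)\le 0$, respectively. A nonspacelike curve is a piecewise-smooth curve whose velocity vectors are nonspacelike and all future-directed (or all past-directed). An open set $U\subset X$ is causally convex if no nonspacelike curve in $X$ intersects $U$ in a disconnected set. $(X,g)$ is strongly causal if for every event $p$ every open neighborhood of $p$ contains a causally convex open neighborhood of $p$. Write $p\le q$ if $p=q$ or there is a future-directed nonspacelike curve from $p$ to $q$, and let $J^+(p)=\{q: p\le q\}$, $J^-(p)=\{q:q\le p\}$. $(X,g)$ is globally hyperbolic if it is strongly causal and $J^+(p)\cap J^-(q)$ is compact for all $p,q\in X$. It is null complete (timelike complete) if every inextendible null (timelike) geodesic, affinely parametrized, is defined on all of $\mathbb{R}$. A hypersurface is a codimension-one submanifold (nonempty). Null-geodesics are taken to be inextendible; a null-geodesic enters a set $U$ if its image meets $U$. A strongly causal space-time is strongly refocusing at $x$ if there is an event $y\ne x$ such that all null-geodesics through $y$ pass through $x$. A strongly causal space-time $(X,g)$ is refocusing at $x\in X$ if one (equivalently, all) of the following conditions holds. (i) There is an open neighborhood $V$ of $x$ such that for all open $U$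 with $x\in U\subset V$ there is an event $y\notin U$ such that all null-geodesics through $y$ enter $U$. (ii) There is an open neighborhood $V$ of $x$ such that for all open $U$ with $x\in U\subset V$ there is an event $y\notin V$ such that all null-geodesics through $y$ enter $U$. (iii) There are an open neighborhood $V$ of $x$ and a sequence $\{y_n\}_{n=1}^\infty$ in $X\setminus V$ such that for all open $U$ with $x\in U\subset V$ there is $K\in\mathbb{N}$ such that for all $n\ge K$ all null-geodesics through $y_n$ enter $U$. *)

theory Defs
  imports "HOL-Analysis.Analysis"
begin

section \<open>Smooth functions on open subsets of \<open>Euclidean_space n\<close>\<close>

text \<open>
  The dimension of a manifold is a natural number that is quantified inside statements, so the
  model space is the library's \<open>Euclidean_space n\<close>: the sequences \<open>x :: nat \<Rightarrow> real\<close> with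
  \<open>x i = 0\<close> for \<open>i \<ge> n\<close>. Coordinates, and components of vectors and tensors, are numbered
  \<open>0, \<dots>, n - 1\<close>.
\<close>

definition partial :: "nat \<Rightarrow> ((nat \<Rightarrow> real) \<Rightarrow> real) \<Rightarrow> (nat \<Rightarrow> real) \<Rightarrow> real" where
  "partial i f x = deriv (\<lambda>t. f (x(i := t))) (x i)"

primrec C_k_on :: "nat \<Rightarrow> nat \<Rightarrow> (nat \<Rightarrow> real) set \<Rightarrow> ((nat \<Rightarrow> real) \<Rightarrow> real) \<Rightarrow> bool" where
  "C_k_on n 0 V f \<longleftrightarrow> continuous_map (subtopology (Euclidean_space n) V) euclideanreal f"
| "C_k_on n (Suc k) V f \<longleftrightarrow>
     continuous_map (subtopology (Euclidean_space n) V) euclideanreal f \<and>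
     (\<forall>i<n. (\<forall>x\<in>V. (\<lambda>t. f (x(i := t))) differentiable (at (x i))) \<and>
             C_k_on n k V (partial i f))"

text \<open>Used only for sets \<open>V\<close> that are open in \<open>Euclidean_space n\<close>.\<close>

definition smooth_on :: "nat \<Rightarrow> (nat \<Rightarrow> real) set \<Rightarrow> ((nat \<Rightarrow> real) \<Rightarrow> real) \<Rightarrow> bool" where
  "smooth_on n V f \<longleftrightarrow> (\<forall>k. C_k_on n k V f)"


section \<open>Charts and smooth manifolds\<close>

text \<open>
  A chart is a pair \<open>(U, \<phi>)\<close>; the values of \<open>\<phi>\<close> outside \<open>U\<close> are irrelevant.
\<close>

type_synonym 'a chart = "'a set \<times> ('a \<Rightarrow> nat \<Rightarrow> real)"

definition is_chart :: "'a topology \<Rightarrow> nat \<Rightarrow> 'a chart \<Rightarrow> bool" where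
  "is_chart X n c \<longleftrightarrow>
     openin X (fst c) \<and>
     openin (Euclidean_space n) (snd c ` fst c) \<and>
     homeomorphic_map (subtopology X (fst c))
       (subtopology (Euclidean_space n) (snd c ` fst c)) (snd c)"

definition chart_inv :: "'a chart \<Rightarrow> (nat \<Rightarrow> real) \<Rightarrow> 'a" where
  "chart_inv c = inv_into (fst c) (snd c)"

definition transition :: "'a chart \<Rightarrow> 'a chart \<Rightarrow> (nat \<Rightarrow> real) \<Rightarrow> nat \<Rightarrow> real" where
  "transition c d x = snd d (chart_inv c x)"

definition smooth_transition :: "nat \<Rightarrow> 'a chart \<Rightarrow> 'a chart \<Rightarrow> bool" where
  "smooth_transition n c d \<longleftrightarrow>
     (\<forall>k<n. smooth_on n (snd c ` (fst c \<inter> fst d)) (\<lambda>x. transition c d x k))"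

definition jacobian :: "'a chart \<Rightarrow> 'a chart \<Rightarrow> 'a \<Rightarrow> nat \<Rightarrow> nat \<Rightarrow> real" where
  "jacobian c d p k i = partial i (\<lambda>x. transition c d x k) (snd c p)"

text \<open>
  A smooth structure is given by a smooth atlas, not required to be maximal. The topology is
  Hausdorff and second countable, as is standard for manifolds.
\<close>

definition smooth_manifold :: "'a topology \<Rightarrow> nat \<Rightarrow> 'a chart set \<Rightarrow> bool" where
  "smooth_manifold X n A \<longleftrightarrow>
     Hausdorff_space X \<and> second_countable X \<and>
     (\<forall>c\<in>A. is_chart X n c) \<and>
     (\<Union>c\<in>A. fst c) = topspace X \<and>
     (\<forall>c\<in>A. \<forall>d\<in>A. smooth_transition n c d)"

text \<open>
  Charts of the maximal atlas determined by \<open>A\<close>, and (embedded, nonempty) submanifolds of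
  codimension one, described by slice charts.
\<close>

definition compatible_chart :: "'a topology \<Rightarrow> nat \<Rightarrow> 'a chart set \<Rightarrow> 'a chart \<Rightarrow> bool" where
  "compatible_chart X n A c \<longleftrightarrow>
     is_chart X n c \<and> (\<forall>d\<in>A. smooth_transition n c d \<and> smooth_transition n d c)"

definition hypersurface :: "'a topology \<Rightarrow> nat \<Rightarrow> 'a chart set \<Rightarrow> 'a set \<Rightarrow> bool" where
  "hypersurface X n A H \<longleftrightarrow>
     H \<noteq> {} \<and> H \<subseteq> topspace X \<and>
     (\<forall>p\<in>H. \<exists>c. compatible_chart X n A c \<and> p \<in> fst c \<and>
        snd c ` (fst c \<inter> H) = {x \<in> snd c ` fst c. x (n - 1) = 0})"


section \<open>Space-times\<close>

text \<open>
  Tensor fields are given by their components in each chart of the atlas, subject to the usual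
  transformation laws: \<open>metric M c p i j\<close> is \<open>g\<^sub>p(\<partial>\<^sub>i, \<partial>\<^sub>j)\<close> with respect to the chart \<open>c\<close>, and
  \<open>time_field M c p i\<close> is the \<open>i\<close>-th component at \<open>p\<close> of a continuous timelike vector field
  that determines the time orientation.
\<close>

record 'a lorentz =
  events :: "'a topology"
  ndim :: nat
  atlas :: "'a chart set"
  metric :: "'a chart \<Rightarrow> 'a \<Rightarrow> nat \<Rightarrow> nat \<Rightarrow> real"
  time_field :: "'a chart \<Rightarrow> 'a \<Rightarrow> nat \<Rightarrow> real"

definition g_at ::
  "'a lorentz \<Rightarrow> 'a chart \<Rightarrow> 'a \<Rightarrow> (nat \<Rightarrow> real) \<Rightarrow> (nat \<Rightarrow> real) \<Rightarrow> real" where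
  "g_at M c p v w = (\<Sum>i<ndim M. \<Sum>j<ndim M. metric M c p i j * v i * w j)"

text \<open>
  Signature \<open>(+, \<dots>, +, -)\<close> is expressed by an orthonormal basis \<open>e\<close> of each tangent space; the
  Gram matrix being nonsingular, linear independence of the \<open>n\<close> vectors is automatic.
\<close>

definition lorentz_metric :: "'a lorentz \<Rightarrow> bool" where
  "lorentz_metric M \<longleftrightarrow>
     (\<forall>c\<in>atlas M. \<forall>i<ndim M. \<forall>j<ndim M.
        smooth_on (ndim M) (snd c ` fst c) (\<lambda>x. metric M c (chart_inv c x) i j)) \<and>
     (\<forall>c\<in>atlas M. \<forall>p\<in>fst c. \<forall>i<ndim M. \<forall>j<ndim M. metric M c p i j = metric M c p j i) \<and>
     (\<forall>c\<in>atlas M. \<forall>d\<in>atlas M. \<forall>p\<in>fst c \<inter> fst d. \<forall>i<ndim M. \<forall>j<ndim M.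
        metric M c p i j =
          (\<Sum>k<ndim M. \<Sum>l<ndim M. jacobian c d p k i * jacobian c d p l j * metric M d p k l)) \<and>
     (\<forall>c\<in>atlas M. \<forall>p\<in>fst c. \<exists>e :: nat \<Rightarrow> nat \<Rightarrow> real. \<forall>i<ndim M. \<forall>j<ndim M.
        g_at M c p (e i) (e j) = (if i \<noteq> j then 0 else if i = ndim M - 1 then - 1 else 1))"

definition time_orientation :: "'a lorentz \<Rightarrow> bool" where
  "time_orientation M \<longleftrightarrow>
     (\<forall>c\<in>atlas M. \<forall>i<ndim M.
        continuous_map (subtopology (events M) (fst c)) euclideanreal
          (\<lambda>p. time_field M c p i)) \<and>
     (\<forall>c\<in>atlas M. \<forall>d\<in>atlas M. \<forall>p\<in>fst c \<inter> fst d. \<forall>k<ndim M.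
        time_field M d p k = (\<Sum>i<ndim M. jacobian c d p k i * time_field M c p i)) \<and>
     (\<forall>c\<in>atlas M. \<forall>p\<in>fst c. g_at M c p (time_field M c p) (time_field M c p) < 0)"

definition spacetime :: "'a lorentz \<Rightarrow> bool" where
  "spacetime M \<longleftrightarrow>
     smooth_manifold (events M) (ndim M) (atlas M) \<and>
     connected_space (events M) \<and>
     2 \<le> ndim M \<and>
     lorentz_metric M \<and>
     time_orientation M"


section \<open>Curves and the causal structure\<close>

definition open_interval :: "real set \<Rightarrow> bool" where
  "open_interval I \<longleftrightarrow> open I \<and> is_interval I \<and> I \<noteq> {}"

definition smooth_curve :: "'a lorentz \<Rightarrow> real set \<Rightarrow> (real \<Rightarrow> 'a) \<Rightarrow> bool" where
  "smooth_curve M I \<gamma> \<longleftrightarrow>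
     open_interval I \<and>
     continuous_map (top_of_set I) (events M) \<gamma> \<and>
     (\<forall>t\<in>I. \<forall>c\<in>atlas M. \<gamma> t \<in> fst c \<longrightarrow>
        (\<forall>i<ndim M. \<forall>k. (deriv ^^ k) (\<lambda>s. snd c (\<gamma> s) i) differentiable (at t)))"

definition velocity :: "'a chart \<Rightarrow> (real \<Rightarrow> 'a) \<Rightarrow> real \<Rightarrow> nat \<Rightarrow> real" where
  "velocity c \<gamma> t i = deriv (\<lambda>s. snd c (\<gamma> s) i) t"

text \<open>
  The following predicates concern the velocity vector of \<open>\<gamma>\<close> at the parameter \<open>t\<close>. They include
  that the velocity is nonzero, and by the transformation laws they do not depend on the chart.
\<close>

definition timelike_at :: "'a lorentz \<Rightarrow> (real \<Rightarrow> 'a) \<Rightarrow> real \<Rightarrow> bool" where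
  "timelike_at M \<gamma> t \<longleftrightarrow>
     (\<forall>c\<in>atlas M. \<gamma> t \<in> fst c \<longrightarrow>
        (\<exists>i<ndim M. velocity c \<gamma> t i \<noteq> 0) \<and>
        g_at M c (\<gamma> t) (velocity c \<gamma> t) (velocity c \<gamma> t) < 0)"

definition null_at :: "'a lorentz \<Rightarrow> (real \<Rightarrow> 'a) \<Rightarrow> real \<Rightarrow> bool" where
  "null_at M \<gamma> t \<longleftrightarrow>
     (\<forall>c\<in>atlas M. \<gamma> t \<in> fst c \<longrightarrow>
        (\<exists>i<ndim M. velocity c \<gamma> t i \<noteq> 0) \<and>
        g_at M c (\<gamma> t) (velocity c \<gamma> t) (velocity c \<gamma> t) = 0)"

definition nonspacelike_at :: "'a lorentz \<Rightarrow> (real \<Rightarrow> 'a) \<Rightarrow> real \<Rightarrow> bool" where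
  "nonspacelike_at M \<gamma> t \<longleftrightarrow>
     (\<forall>c\<in>atlas M. \<gamma> t \<in> fst c \<longrightarrow>
        (\<exists>i<ndim M. velocity c \<gamma> t i \<noteq> 0) \<and>
        g_at M c (\<gamma> t) (velocity c \<gamma> t) (velocity c \<gamma> t) \<le> 0)"

text \<open>
  In signature \<open>(+, \<dots>, +, -)\<close> a nonspacelike vector \<open>v\<close> lies in the same half of the cone as the
  timelike vector \<open>T\<close> precisely if \<open>g(T, v) < 0\<close>.
\<close>

definition future_directed_at :: "'a lorentz \<Rightarrow> (real \<Rightarrow> 'a) \<Rightarrow> real \<Rightarrow> bool" where
  "future_directed_at M \<gamma> t \<longleftrightarrow>
     (\<forall>c\<in>atlas M. \<gamma> t \<in> fst c \<longrightarrow>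
        g_at M c (\<gamma> t) (time_field M c (\<gamma> t)) (velocity c \<gamma> t) < 0)"

definition past_directed_at :: "'a lorentz \<Rightarrow> (real \<Rightarrow> 'a) \<Rightarrow> real \<Rightarrow> bool" where
  "past_directed_at M \<gamma> t \<longleftrightarrow>
     (\<forall>c\<in>atlas M. \<gamma> t \<in> fst c \<longrightarrow>
        g_at M c (\<gamma> t) (time_field M c (\<gamma> t)) (velocity c \<gamma> t) > 0)"

text \<open>
  A piecewise-smooth curve \<open>\<gamma>\<close> on \<open>[a, b]\<close> all of whose velocity vectors satisfy \<open>P\<close>. On each
  closed piece of a finite subdivision \<open>\<tau>\<close> the curve is smooth in the sense that it has a smooth
  extension \<open>\<sigma>\<close> to an open interval; at the break points both one-sided velocities have to
  satisfy \<open>P\<close>.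
\<close>

definition piecewise_smooth_with ::
  "'a lorentz \<Rightarrow> ((real \<Rightarrow> 'a) \<Rightarrow> real \<Rightarrow> bool) \<Rightarrow> real \<Rightarrow> real \<Rightarrow> (real \<Rightarrow> 'a) \<Rightarrow> bool" where
  "piecewise_smooth_with M P a b \<gamma> \<longleftrightarrow>
     a < b \<and>
     continuous_map (top_of_set {a..b}) (events M) \<gamma> \<and>
     (\<exists>(m::nat) (\<tau> :: nat \<Rightarrow> real).
        \<tau> 0 = a \<and> \<tau> m = b \<and> (\<forall>k<m. \<tau> k < \<tau> (Suc k)) \<and>
        (\<forall>k<m. \<exists>J \<sigma>. smooth_curve M J \<sigma> \<and> {\<tau> k..\<tau> (Suc k)} \<subseteq> J \<and>
           (\<forall>t\<in>{\<tau> k..\<tau> (Suc k)}. \<sigma> t = \<gamma> t \<and> P \<sigma> t)))"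

definition future_nonspacelike_curve ::
  "'a lorentz \<Rightarrow> real \<Rightarrow> real \<Rightarrow> (real \<Rightarrow> 'a) \<Rightarrow> bool" where
  "future_nonspacelike_curve M =
     piecewise_smooth_with M (\<lambda>\<sigma> t. nonspacelike_at M \<sigma> t \<and> future_directed_at M \<sigma> t)"

definition past_nonspacelike_curve ::
  "'a lorentz \<Rightarrow> real \<Rightarrow> real \<Rightarrow> (real \<Rightarrow> 'a) \<Rightarrow> bool" where
  "past_nonspacelike_curve M =
     piecewise_smooth_with M (\<lambda>\<sigma> t. nonspacelike_at M \<sigma> t \<and> past_directed_at M \<sigma> t)"

definition nonspacelike_curve :: "'a lorentz \<Rightarrow> real \<Rightarrow> real \<Rightarrow> (real \<Rightarrow> 'a) \<Rightarrow> bool" where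
  "nonspacelike_curve M a b \<gamma> \<longleftrightarrow>
     future_nonspacelike_curve M a b \<gamma> \<or> past_nonspacelike_curve M a b \<gamma>"

text \<open>
  Curves with compact domain suffice here: if a curve on another interval met \<open>U\<close> in a disconnected
  set, then so would its restriction to some compact interval.
\<close>

definition causally_convex :: "'a lorentz \<Rightarrow> 'a set \<Rightarrow> bool" where
  "causally_convex M U \<longleftrightarrow>
     openin (events M) U \<and>
     (\<forall>a b \<gamma>. nonspacelike_curve M a b \<gamma> \<longrightarrow> connectedin (events M) (\<gamma> ` {a..b} \<inter> U))"

definition strongly_causal :: "'a lorentz \<Rightarrow> bool" where
  "strongly_causal M \<longleftrightarrow>
     (\<forall>p\<in>topspace (events M). \<forall>W. openin (events M) W \<and> p \<in> W \<longrightarrow>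
        (\<exists>U. causally_convex M U \<and> p \<in> U \<and> U \<subseteq> W))"

definition causal_le :: "'a lorentz \<Rightarrow> 'a \<Rightarrow> 'a \<Rightarrow> bool" where
  "causal_le M p q \<longleftrightarrow>
     p \<in> topspace (events M) \<and> q \<in> topspace (events M) \<and>
     (p = q \<or> (\<exists>a b \<gamma>. future_nonspacelike_curve M a b \<gamma> \<and> \<gamma> a = p \<and> \<gamma> b = q))"

definition J_plus :: "'a lorentz \<Rightarrow> 'a \<Rightarrow> 'a set" where
  "J_plus M p = {q. causal_le M p q}"

definition J_minus :: "'a lorentz \<Rightarrow> 'a \<Rightarrow> 'a set" where
  "J_minus M p = {q. causal_le M q p}"

definition globally_hyperbolic :: "'a lorentz \<Rightarrow> bool" where
  "globally_hyperbolic M \<longleftrightarrow>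
     strongly_causal M \<and>
     (\<forall>p\<in>topspace (events M). \<forall>q\<in>topspace (events M).
        compactin (events M) (J_plus M p \<inter> J_minus M q))"


section \<open>Geodesics, completeness and refocusing\<close>

text \<open>Christoffel symbols of the first kind, \<open>\<Gamma>\<^sub>k\<^sub>i\<^sub>j = g(\<nabla>\<^sub>i \<partial>\<^sub>j, \<partial>\<^sub>k)\<close>.\<close>

definition metric_partial :: "'a lorentz \<Rightarrow> 'a chart \<Rightarrow> 'a \<Rightarrow> nat \<Rightarrow> nat \<Rightarrow> nat \<Rightarrow> real" where
  "metric_partial M c p i j k = partial i (\<lambda>x. metric M c (chart_inv c x) j k) (snd c p)"

definition christoffel :: "'a lorentz \<Rightarrow> 'a chart \<Rightarrow> 'a \<Rightarrow> nat \<Rightarrow> nat \<Rightarrow> nat \<Rightarrow> real" where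
  "christoffel M c p k i j =
     (metric_partial M c p i j k + metric_partial M c p j i k - metric_partial M c p k i j) / 2"

text \<open>
  An affinely parametrized geodesic: the equation is \<open>g(\<nabla>\<^bsub>\<gamma>'\<^esub> \<gamma>', \<partial>\<^sub>k) = 0\<close> for all \<open>k\<close>, that is,
  the usual geodesic equation with the free index lowered.
\<close>

definition geodesic :: "'a lorentz \<Rightarrow> real set \<Rightarrow> (real \<Rightarrow> 'a) \<Rightarrow> bool" where
  "geodesic M I \<gamma> \<longleftrightarrow>
     smooth_curve M I \<gamma> \<and>
     (\<forall>t\<in>I. \<forall>c\<in>atlas M. \<gamma> t \<in> fst c \<longrightarrow>
        (\<forall>k<ndim M.
           (\<Sum>l<ndim M. metric M c (\<gamma> t) k l * deriv (\<lambda>s. velocity c \<gamma> s l) t) +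
           (\<Sum>i<ndim M. \<Sum>j<ndim M.
              christoffel M c (\<gamma> t) k i j * velocity c \<gamma> t i * velocity c \<gamma> t j) = 0))"

definition inextendible_geodesic :: "'a lorentz \<Rightarrow> real set \<Rightarrow> (real \<Rightarrow> 'a) \<Rightarrow> bool" where
  "inextendible_geodesic M I \<gamma> \<longleftrightarrow>
     geodesic M I \<gamma> \<and>
     \<not> (\<exists>J \<delta>. I \<subset> J \<and> geodesic M J \<delta> \<and> (\<forall>t\<in>I. \<delta> t = \<gamma> t))"

definition null_geodesic :: "'a lorentz \<Rightarrow> real set \<Rightarrow> (real \<Rightarrow> 'a) \<Rightarrow> bool" where
  "null_geodesic M I \<gamma> \<longleftrightarrow> inextendible_geodesic M I \<gamma> \<and> (\<forall>t\<in>I. null_at M \<gamma> t)"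

definition timelike_geodesic :: "'a lorentz \<Rightarrow> real set \<Rightarrow> (real \<Rightarrow> 'a) \<Rightarrow> bool" where
  "timelike_geodesic M I \<gamma> \<longleftrightarrow> inextendible_geodesic M I \<gamma> \<and> (\<forall>t\<in>I. timelike_at M \<gamma> t)"

definition null_complete :: "'a lorentz \<Rightarrow> bool" where
  "null_complete M \<longleftrightarrow> (\<forall>I \<gamma>. null_geodesic M I \<gamma> \<longrightarrow> I = UNIV)"

definition timelike_complete :: "'a lorentz \<Rightarrow> bool" where
  "timelike_complete M \<longleftrightarrow> (\<forall>I \<gamma>. timelike_geodesic M I \<gamma> \<longrightarrow> I = UNIV)"

definition all_null_geodesics_enter :: "'a lorentz \<Rightarrow> 'a \<Rightarrow> 'a set \<Rightarrow> bool" where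
  "all_null_geodesics_enter M y U \<longleftrightarrow>
     (\<forall>I \<gamma>. null_geodesic M I \<gamma> \<and> y \<in> \<gamma> ` I \<longrightarrow> \<gamma> ` I \<inter> U \<noteq> {})"

text \<open>
  Both notions are meant for an event \<open>x\<close> of a strongly causal space-time. Of the several known
  characterizations of refocusing, which are equivalent under strong causality, the definition
  uses the one where \<open>y\<close> is only required to lie outside \<open>U\<close>.
\<close>

definition strongly_refocusing_at :: "'a lorentz \<Rightarrow> 'a \<Rightarrow> bool" where
  "strongly_refocusing_at M x \<longleftrightarrow>
     (\<exists>y\<in>topspace (events M). y \<noteq> x \<and> all_null_geodesics_enter M y {x})"

definition refocusing_at :: "'a lorentz \<Rightarrow> 'a \<Rightarrow> bool" where
  "refocusing_at M x \<longleftrightarrow>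
     (\<exists>V. openin (events M) V \<and> x \<in> V \<and>
        (\<forall>U. openin (events M) U \<and> x \<in> U \<and> U \<subseteq> V \<longrightarrow>
           (\<exists>y\<in>topspace (events M). y \<notin> U \<and> all_null_geodesics_enter M y U)))"

end

theory Submission
  imports Defs
begin

text \<open>
  The example is two-dimensional de Sitter space with its spatial circle halved. With conformal time
  \<open>\<eta>\<close> and an angle \<open>\<phi>\<close> of period \<open>2\<pi>\<close>, the metric is a positive multiple of
  \<open>d\<phi>\<^sup>2 - d\<eta>\<^sup>2\<close> on \<open>0 < \<eta> < 2\<pi>\<close>: the time available is exactly as long as the circle. The two
  null geodesics through an event \<open>y\<close> meet again after conformal time \<open>\<pi>\<close>, on the opposite side of
  the circle. For an event \<open>x\<close> on the circle \<open>\<eta> = \<pi>\<close> the conjugate event would lie at \<open>\<eta> = 2\<pi>\<close> or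
  \<open>\<eta> = 0\<close>, hence just outside the space-time, so \<open>x\<close> is not strongly refocusing; but events \<open>y\<close>
  opposite to \<open>x\<close> with \<open>\<eta>\<close> close to \<open>2\<pi>\<close> have null geodesics that all pass arbitrarily close to \<open>x\<close>.
  Thus one space-time serves for both claims, the hypersurface being the circle \<open>\<eta> = \<pi>\<close>.

  The cylinder is realized as the punctured plane, which needs a single chart; \<open>\<tau> = ln \<bar>p\<bar>\<close> is the
  proper time from the circle \<open>\<eta> = \<pi>\<close> and \<open>\<phi>\<close> the polar angle.
\<close>

section \<open>Smooth functions of one variable\<close>

text \<open>In de Sitter space itself the circle is twice as long as conformal time lasts, so the
  two null geodesics through an event never meet again; halving the circle moves the second meeting
  for events of the middle circle exactly to the missing boundary. Dimension two reduces "all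
  null-geodesics through \<open>y\<close>" to two, one for each sense of rotation. The definitions
  quantify over arbitrary curves in the Cartesian chart, while everything is computable only in
  \<tau> and \<phi>, which form no global chart. Hence every smooth curve is lifted to real
  functions \<tau>, \<phi>, and the ambiguity of the angle by 2 pi n is carried along. For
  geodesics, two first integrals turn the nonlinear equations into s'' = E s with s = sinh \<tau>,
  where E is nonnegative in the causal case; solutions are explicit and extend to the whole line. In
  the null case E = 0, sinh \<tau> is affine and \<phi> = c + 2 arctan (sinh \<tau>) or c - 2 arctan
  (sinh \<tau>). For causality, the null coordinates \<eta> + \<phi> and \<eta> - \<phi> are
  monotone along future-directed causal curves, so the causal order is that of a flat strip of
  finite height, taken modulo 2 pi.\<close>

definition diff_times :: "nat \<Rightarrow> real set \<Rightarrow> (real \<Rightarrow> real) \<Rightarrow> bool" where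
  "diff_times n I f \<longleftrightarrow> (\<forall>k<n. \<forall>t\<in>I. (deriv ^^ k) f differentiable (at t))"

definition smooth_fn :: "real set \<Rightarrow> (real \<Rightarrow> real) \<Rightarrow> bool" where
  "smooth_fn I f \<longleftrightarrow> (\<forall>k. \<forall>t\<in>I. (deriv ^^ k) f differentiable (at t))"

text \<open>Closure under products and composition needs an induction on the order of
  differentiability. It is carried out for finite order, and this equivalence transfers the results
  to all orders.\<close>

lemma smooth_fn_iff: "smooth_fn I f \<longleftrightarrow> (\<forall>n. diff_times n I f)"
  unfolding smooth_fn_def diff_times_def by blast

lemma diff_times_0 [simp]: "diff_times 0 I f"
  by (simp add: diff_times_def)

text \<open>The innermost derivative is peeled off, so that an induction hypothesis generalized over
  the function applies to \<open>deriv f\<close>.\<close>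

lemma diff_times_Suc:
  "diff_times (Suc n) I f \<longleftrightarrow> (\<forall>t\<in>I. f differentiable (at t)) \<and> diff_times n I (deriv f)"
  unfolding diff_times_def All_less_Suc2 by (simp add: funpow_Suc_right del: funpow.simps(2))

lemma diff_times_mono: "diff_times n I f \<Longrightarrow> m \<le> n \<Longrightarrow> diff_times m I f"
  unfolding diff_times_def by auto

lemma higher_deriv_cong:
  assumes "open I" "\<And>t. t \<in> I \<Longrightarrow> f t = g t" "t \<in> I"
  shows "(deriv ^^ k) f t = (deriv ^^ k) (g :: real \<Rightarrow> real) t"
  using assms(3)
proof (induction k arbitrary: t)
  case (Suc k)
  have "eventually (\<lambda>s. s \<in> I) (nhds t)"
    using assms(1) Suc.prems by (rule eventually_nhds_in_open)
  then have "eventually (\<lambda>s. (deriv ^^ k) f s = (deriv ^^ k) g s) (nhds t)"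
    by (rule eventually_mono) (rule Suc.IH)
  then show ?case
    by (simp add: deriv_cong_ev)
qed (simp add: assms(2))

lemma differentiable_cong_open:
  fixes f g :: "real \<Rightarrow> real"
  assumes "open I" "\<And>t. t \<in> I \<Longrightarrow> f t = g t" "t \<in> I" "g differentiable (at t)"
  shows "f differentiable (at t)"
proof -
  obtain D where "(g has_derivative D) (at t)"
    using assms(4) by (auto simp: differentiable_def)
  then have "(f has_derivative D) (at t)"
    by (rule has_derivative_transform_within_open[OF _ assms(1,3)]) (simp add: assms(2))
  then show ?thesis
    by (auto simp: differentiable_def)
qed

lemma diff_times_cong:
  assumes "open I" "\<And>t. t \<in> I \<Longrightarrow> f t = g t" "diff_times n I g"
  shows "diff_times n I f"
  unfolding diff_times_def
proof (intro allI impI ballI)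
  fix k t assume "k < n" "t \<in> I"
  then have "(deriv ^^ k) g differentiable (at t)"
    using assms(3) by (simp add: diff_times_def)
  then show "(deriv ^^ k) f differentiable (at t)"
    using \<open>t \<in> I\<close> assms(1,2) differentiable_cong_open[of I "(deriv ^^ k) f" "(deriv ^^ k) g" t]
      higher_deriv_cong[of I f g]
    by blast
qed

text \<open>Differentiation rules produce an explicit \<open>f'\<close> that agrees with
  \<open>deriv f\<close> only on \<open>I\<close>; since \<open>I\<close> is open, this agreement
  persists for all higher derivatives.\<close>

lemma diff_times_SucI:
  assumes "open I" "\<And>t. t \<in> I \<Longrightarrow> (f has_real_derivative f' t) (at t)" "diff_times n I f'"
  shows "diff_times (Suc n) I f"
  unfolding diff_times_Suc
proof
  show "\<forall>t\<in>I. f differentiable (at t)"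
    using assms(2) real_differentiable_def by blast
  show "diff_times n I (deriv f)"
    by (rule diff_times_cong[OF assms(1) _ assms(3)]) (simp add: DERIV_imp_deriv assms(2))
qed

lemma diff_times_SucD:
  assumes "diff_times (Suc n) I f" "t \<in> I"
  shows "(f has_real_derivative deriv f t) (at t)"
  using assms by (simp add: diff_times_Suc DERIV_deriv_iff_real_differentiable)

lemma diff_times_const: "open I \<Longrightarrow> diff_times n I (\<lambda>_. c)"
proof (induction n arbitrary: c)
  case (Suc n)
  then show ?case by (intro diff_times_SucI[where f' = "\<lambda>_. 0"]) auto
qed simp

lemma diff_times_ident: "open I \<Longrightarrow> diff_times n I (\<lambda>t. t)"
proof (cases n)
  case (Suc m)
  assume "open I"
  then show ?thesis unfolding Suc
    by (intro diff_times_SucI[where f' = "\<lambda>_. 1"]) (auto intro: diff_times_const)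
qed simp

lemma diff_times_add:
  assumes "open I"
  shows "diff_times n I f \<Longrightarrow> diff_times n I g \<Longrightarrow> diff_times n I (\<lambda>t. f t + g t)"
proof (induction n arbitrary: f g)
  case (Suc n)
  show ?case
    by (rule diff_times_SucI[OF assms, where f' = "\<lambda>t. deriv f t + deriv g t"])
       (use Suc.prems in \<open>auto intro!: DERIV_add Suc.IH simp: diff_times_Suc[of n I] DERIV_deriv_iff_real_differentiable\<close>)
qed simp

lemma diff_times_mult:
  assumes "open I"
  shows "diff_times n I f \<Longrightarrow> diff_times n I g \<Longrightarrow> diff_times n I (\<lambda>t. f t * g t)"
proof (induction n arbitrary: f g)
  case (Suc n)
  have fg: "diff_times n I f" "diff_times n I g" "diff_times n I (deriv f)" "diff_times n I (deriv g)"
    using Suc.prems diff_times_mono[of "Suc n" I f n] diff_times_mono[of "Suc n" I g n]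
    by (simp_all add: diff_times_Suc)
  show ?case
  proof (rule diff_times_SucI[OF assms, where f' = "\<lambda>t. deriv f t * g t + deriv g t * f t"])
    fix t assume "t \<in> I"
    then show "((\<lambda>t. f t * g t) has_real_derivative deriv f t * g t + deriv g t * f t) (at t)"
      using Suc.prems by (intro DERIV_mult diff_times_SucD)
  qed (intro diff_times_add[OF assms] Suc.IH fg)
qed simp

lemma diff_times_compose:
  assumes "open I" "open J" "f ` I \<subseteq> J"
  shows "diff_times n I f \<Longrightarrow> diff_times n J h \<Longrightarrow> diff_times n I (\<lambda>t. h (f t))"
proof (induction n arbitrary: h)
  case (Suc n)
  have fh: "diff_times n I f" "diff_times n J h" "diff_times n I (deriv f)" "diff_times n J (deriv h)"
    using Suc.prems diff_times_mono[of "Suc n" I f n] diff_times_mono[of "Suc n" J h n]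
    by (simp_all add: diff_times_Suc)
  show ?case
  proof (rule diff_times_SucI[OF assms(1), where f' = "\<lambda>t. deriv h (f t) * deriv f t"])
    fix t assume "t \<in> I"
    then show "((\<lambda>t. h (f t)) has_real_derivative deriv h (f t) * deriv f t) (at t)"
      using Suc.prems assms(3) by (intro DERIV_chain2[of h] diff_times_SucD) auto
  qed (rule diff_times_mult[OF assms(1) Suc.IH[OF fh(1,4)] fh(3)])
qed simp

section \<open>Elementary functions\<close>

text \<open>Linear combinations are closed under differentiation, so one induction covers sine and
  cosine together.\<close>

lemma diff_times_sin_cos:
  "diff_times n UNIV (\<lambda>t. c * sin t + d * cos t)"
proof (induction n arbitrary: c d)
  case (Suc n)
  show ?case
    by (rule diff_times_SucI[where f' = "\<lambda>t. (-d) * sin t + c * cos t", OF open_UNIV _ Suc.IH])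
       (auto intro!: derivative_eq_intros)
qed simp

lemma diff_times_exp: "diff_times n UNIV exp"
proof (induction n)
  case (Suc n)
  then show ?case
    by (intro diff_times_SucI[where f' = exp]) (auto intro!: derivative_eq_intros)
qed simp

lemma diff_times_inverse: "diff_times n (- {0}) inverse"
proof (induction n)
  case (Suc n)
  have op: "open (- {0::real})" by (simp add: open_Compl)
  show ?case
    by (intro diff_times_SucI[where f' = "\<lambda>t. (-1) * (inverse t * inverse t)"] diff_times_mult op
         diff_times_const Suc)
       (auto intro!: derivative_eq_intros)
qed simp

lemma diff_times_subset: "diff_times n J f \<Longrightarrow> I \<subseteq> J \<Longrightarrow> diff_times n I f"
  unfolding diff_times_def by blast

lemma diff_times_ln: "diff_times n {0<..} ln"
proof (cases n)
  case (Suc m)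
  show ?thesis unfolding Suc
    by (intro diff_times_SucI[where f' = inverse] diff_times_subset[OF diff_times_inverse])
       (auto intro!: derivative_eq_intros simp: field_simps)
qed simp

lemma smooth_fn_const: "open I \<Longrightarrow> smooth_fn I (\<lambda>_. c)"
  and smooth_fn_ident: "open I \<Longrightarrow> smooth_fn I (\<lambda>t. t)"
  and smooth_fn_add: "open I \<Longrightarrow> smooth_fn I f \<Longrightarrow> smooth_fn I g \<Longrightarrow> smooth_fn I (\<lambda>t. f t + g t)"
  and smooth_fn_mult: "open I \<Longrightarrow> smooth_fn I f \<Longrightarrow> smooth_fn I g \<Longrightarrow> smooth_fn I (\<lambda>t. f t * g t)"
  and smooth_fn_compose: "open I \<Longrightarrow> open J \<Longrightarrow> f ` I \<subseteq> J \<Longrightarrow> smooth_fn I f \<Longrightarrow> smooth_fn J h \<Longrightarrow>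
         smooth_fn I (\<lambda>t. h (f t))"
  and smooth_fn_cong: "open I \<Longrightarrow> (\<And>t. t \<in> I \<Longrightarrow> f t = g t) \<Longrightarrow> smooth_fn I g \<Longrightarrow> smooth_fn I f"
  unfolding smooth_fn_iff
  by (blast intro: diff_times_const diff_times_ident diff_times_add diff_times_mult
       diff_times_compose diff_times_cong)+

lemma smooth_fn_diff:
  assumes "open I" "smooth_fn I f" "smooth_fn I g"
  shows "smooth_fn I (\<lambda>t. f t - g t)"
  using smooth_fn_add[OF assms(1,2) smooth_fn_mult[OF assms(1) smooth_fn_const[OF assms(1), of "-1"] assms(3)]]
  by simp

lemma smooth_fn_D: "smooth_fn I f \<Longrightarrow> t \<in> I \<Longrightarrow> (f has_real_derivative deriv f t) (at t)"
  by (metis diff_times_SucD smooth_fn_iff)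

lemma smooth_fn_deriv: "smooth_fn I f \<Longrightarrow> smooth_fn I (deriv f)"
  by (meson diff_times_Suc smooth_fn_iff)

lemma smooth_fn_continuous: "smooth_fn I f \<Longrightarrow> continuous_on I f"
  by (meson DERIV_isCont continuous_at_imp_continuous_on smooth_fn_D)

text \<open>For functions accessible only through their derivative: the arctangent, and the angle
  along a curve.\<close>

lemma smooth_fn_antiderivative:
  assumes "open I" "\<And>t. t \<in> I \<Longrightarrow> (f has_real_derivative f' t) (at t)" "smooth_fn I f'"
  shows "smooth_fn I f"
  unfolding smooth_fn_iff
proof
  fix n show "diff_times n I f"
    by (cases n) (use assms in \<open>auto intro!: diff_times_SucI simp: smooth_fn_iff\<close>)
qed

lemma smooth_fn_exp: "open I \<Longrightarrow> smooth_fn I f \<Longrightarrow> smooth_fn I (\<lambda>t. exp (f t))"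
  by (rule smooth_fn_compose[of I UNIV]) (auto simp: smooth_fn_iff[of UNIV] diff_times_exp)

lemma smooth_fn_sin: "open I \<Longrightarrow> smooth_fn I f \<Longrightarrow> smooth_fn I (\<lambda>t. sin (f t))"
  by (rule smooth_fn_compose[of I UNIV])
     (simp_all add: smooth_fn_iff[of UNIV] diff_times_sin_cos[where c = 1 and d = 0, simplified])

lemma smooth_fn_cos: "open I \<Longrightarrow> smooth_fn I f \<Longrightarrow> smooth_fn I (\<lambda>t. cos (f t))"
  by (rule smooth_fn_compose[of I UNIV])
     (simp_all add: smooth_fn_iff[of UNIV] diff_times_sin_cos[where c = 0 and d = 1, simplified])

lemma smooth_fn_inverse:
  "open I \<Longrightarrow> smooth_fn I f \<Longrightarrow> (\<And>t. t \<in> I \<Longrightarrow> f t \<noteq> 0) \<Longrightarrow> smooth_fn I (\<lambda>t. inverse (f t))"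
  by (rule smooth_fn_compose[of I "- {0}"]) (auto simp: smooth_fn_iff[of "- {0}"] diff_times_inverse)

lemma smooth_fn_divide:
  "open I \<Longrightarrow> smooth_fn I f \<Longrightarrow> smooth_fn I g \<Longrightarrow> (\<And>t. t \<in> I \<Longrightarrow> g t \<noteq> 0) \<Longrightarrow>
    smooth_fn I (\<lambda>t. f t / g t)"
  unfolding divide_inverse by (intro smooth_fn_mult smooth_fn_inverse)

lemma smooth_fn_ln:
  "open I \<Longrightarrow> smooth_fn I f \<Longrightarrow> (\<And>t. t \<in> I \<Longrightarrow> f t > 0) \<Longrightarrow> smooth_fn I (\<lambda>t. ln (f t))"
  by (rule smooth_fn_compose[of I "{0<..}"]) (auto simp: smooth_fn_iff[of "{0<..}"] diff_times_ln)

lemma smooth_fn_power2: "open I \<Longrightarrow> smooth_fn I f \<Longrightarrow> smooth_fn I (\<lambda>t. (f t)\<^sup>2)"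
  unfolding power2_eq_square by (rule smooth_fn_mult)

lemma smooth_fn_sqrt:
  assumes "open I" "smooth_fn I f" "\<And>t. t \<in> I \<Longrightarrow> f t > 0"
  shows "smooth_fn I (\<lambda>t. sqrt (f t))"
proof (rule smooth_fn_cong[OF assms(1)])
  show "sqrt (f t) = exp (ln (f t) * (1 / 2))" if "t \<in> I" for t
    using assms(3)[OF that] by (simp add: powr_half_sqrt[symmetric] powr_def)
  show "smooth_fn I (\<lambda>t. exp (ln (f t) * (1 / 2)))"
    by (intro smooth_fn_exp smooth_fn_mult smooth_fn_ln smooth_fn_const assms)
qed

lemma smooth_fn_arsinh: "open I \<Longrightarrow> smooth_fn I f \<Longrightarrow> smooth_fn I (\<lambda>t. arsinh (f t))"
  unfolding arsinh_real_def
  by (intro smooth_fn_ln smooth_fn_add smooth_fn_sqrt smooth_fn_power2 smooth_fn_const)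
     (auto simp: arsinh_real_aux add_nonneg_pos)

lemma smooth_fn_arctan:
  assumes "open I" "smooth_fn I f" shows "smooth_fn I (\<lambda>t. arctan (f t))"
proof (rule smooth_fn_compose[OF assms(1) open_UNIV _ assms(2)])
  show "smooth_fn UNIV arctan"
  proof (rule smooth_fn_antiderivative[OF open_UNIV])
    show "smooth_fn UNIV (\<lambda>t. inverse (1 + t\<^sup>2))"
      by (intro smooth_fn_inverse smooth_fn_add smooth_fn_power2 smooth_fn_const smooth_fn_ident open_UNIV)
         (metis add_pos_nonneg less_numeral_extra(1,3) zero_le_power2)
    show "(arctan has_real_derivative inverse (1 + t\<^sup>2)) (at t)" for t
      by (rule DERIV_arctan)
  qed
qed simp

text \<open>An open interval has no end point to integrate from, so the integral starts at an inner
  point \<open>c\<close> and runs in either direction. At most one of the two integrals in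
  \<open>F\<close> is nonzero, which realizes the usual sign convention.\<close>

lemma antiderivative_exists:
  fixes h :: "real \<Rightarrow> real"
  assumes I: "open I" "is_interval I" and h: "continuous_on I h"
  obtains F where "\<And>t. t \<in> I \<Longrightarrow> (F has_real_derivative h t) (at t)"
proof (cases "I = {}")
  case False
  then obtain c where c: "c \<in> I" by blast
  define F where "F t = integral {c..t} h - integral {t..c} h" for t
  have "(F has_real_derivative h t) (at t)" if t: "t \<in> I" for t
  proof -
    obtain e where e: "e > 0" "cball t e \<subseteq> I"
      using I(1) t open_contains_cball by blast
    \<comment> \<open>\<open>{l..u}\<close> contains \<open>c\<close> and a neighbourhood of
      \<open>t\<close>; near \<open>t\<close>, \<open>F\<close> differs by a constant from the
      integral with fixed lower limit \<open>l\<close>, whichever of \<open>c\<close> and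
      \<open>t\<close> is larger.\<close>
    define l where "l = min c (t - e)"
    define u where "u = max c (t + e)"
    have lu: "l \<in> I" "u \<in> I"
    proof -
      have "t - e \<in> cball t e" "t + e \<in> cball t e"
        using e(1) by (auto simp: dist_real_def)
      then have "t - e \<in> I" "t + e \<in> I"
        using e(2) by blast+
      then show "l \<in> I" "u \<in> I"
        using c by (simp_all add: l_def u_def min_def max_def)
    qed
    have sub: "{l..u} \<subseteq> I"
      using I(2) lu unfolding is_interval_1 by (meson atLeastAtMost_iff subsetI)
    have lt: "l < t" "t < u" and lc: "l \<le> c" "c \<le> u"
      using e by (auto simp: l_def u_def)
    have int: "h integrable_on {a..b}" if "l \<le> a" "b \<le> u" for a b
    proof -
      have "{a..b} \<subseteq> I" using that sub by (meson atLeastatMost_subset_iff order_trans)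
      then show ?thesis
        by (intro integrable_continuous_real continuous_on_subset[OF h])
    qed
    have F: "integral {l..s} h - integral {l..c} h = F s" if "s \<in> {l<..<u}" for s
    proof (cases "c \<le> s")
      case True
      have "integral {l..c} h + integral {c..s} h = integral {l..s} h"
        using that lc True by (intro Henstock_Kurzweil_Integration.integral_combine int) auto
      moreover have "integral {s..c} h = 0"
        using True by (cases "c = s") auto
      ultimately show ?thesis by (simp add: F_def)
    next
      case False
      have "integral {l..s} h + integral {s..c} h = integral {l..c} h"
        using that lc False by (intro Henstock_Kurzweil_Integration.integral_combine int) auto
      then show ?thesis using False by (simp add: F_def)
    qed
    have "((\<lambda>s. integral {l..s} h) has_real_derivative h t) (at t within {l..u})"
      using lt by (intro integral_has_real_derivative continuous_on_subset[OF h sub]) auto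
    then have "((\<lambda>s. integral {l..s} h) has_real_derivative h t) (at t)"
      using lt by (simp add: at_within_Icc_at)
    then have "((\<lambda>s. integral {l..s} h - integral {l..c} h) has_real_derivative h t) (at t)"
      by (auto intro!: derivative_eq_intros)
    then show ?thesis
      by (rule has_field_derivative_transform_within_open[of _ _ _ "{l<..<u}"]) (use lt F in auto)
  qed
  then show ?thesis using that by blast
qed (use that in auto)

section \<open>Smooth functions of several variables\<close>

lemma Euclidean_space_top_of_set:
  "Euclidean_space n = top_of_set {x. \<forall>i\<ge>n. x i = 0}"
  by (simp add: Euclidean_space_def euclidean_product_topology)

text \<open>Openness in \<open>Euclidean_space n\<close> is relative to the subspace of sequences
  vanishing from \<open>n\<close> on. Moving a coordinate below \<open>n\<close> stays in that
  subspace, so partial derivatives depend only on values in \<open>V\<close>.\<close>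

lemma eventually_coordinate_update:
  assumes V: "openin (Euclidean_space n) V" "x \<in> V" and i: "i < n"
  shows "eventually (\<lambda>t. x(i := t) \<in> V) (nhds (x i))"
proof -
  have x: "\<And>j. j \<ge> n \<Longrightarrow> x j = 0"
    using openin_subset[OF V(1)] V(2) by (auto simp: topspace_Euclidean_space)
  obtain T where T: "open T" "V = {x. \<forall>i\<ge>n. x i = 0} \<inter> T"
    using V(1) by (auto simp: Euclidean_space_top_of_set openin_open)
  have "continuous_on UNIV (\<lambda>t. (x(i := t)) j)" for j
    by (cases "j = i") auto
  then have "continuous_on UNIV (\<lambda>t. x(i := t))"
    by (rule continuous_on_coordinatewise_then_product)
  then have "open ((\<lambda>t. x(i := t)) -` T)"
    by (metis T(1) open_vimage)
  then have "eventually (\<lambda>t. t \<in> (\<lambda>t. x(i := t)) -` T) (nhds (x i))"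
    using V(2) T(2) by (intro eventually_nhds_in_open) auto
  then show ?thesis
    by (rule eventually_mono) (use T x i in auto)
qed

lemma differentiable_cong_nhds:
  fixes f g :: "real \<Rightarrow> real"
  assumes "eventually (\<lambda>t. f t = g t) (nhds a)" "g differentiable (at a)"
  shows "f differentiable (at a)"
  using assms DERIV_cong_ev[OF refl assms(1) refl] by (auto simp: real_differentiable_def)

lemma partial_cong:
  assumes V: "openin (Euclidean_space n) V" "x \<in> V" and i: "i < n"
    and eq: "\<And>x. x \<in> V \<Longrightarrow> f x = g x"
  shows "partial i f x = partial i g x"
    and "(\<lambda>t. g (x(i := t))) differentiable (at (x i)) \<Longrightarrow>
         (\<lambda>t. f (x(i := t))) differentiable (at (x i))"
proof -
  have ev: "eventually (\<lambda>t. f (x(i := t)) = g (x(i := t))) (nhds (x i))"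
    using eventually_coordinate_update[OF V i] by (rule eventually_mono) (rule eq)
  show "partial i f x = partial i g x"
    unfolding partial_def by (rule deriv_cong_ev[OF ev refl])
  show "(\<lambda>t. g (x(i := t))) differentiable (at (x i)) \<Longrightarrow>
         (\<lambda>t. f (x(i := t))) differentiable (at (x i))"
    by (rule differentiable_cong_nhds[OF ev])
qed

text \<open>Transition maps and metric components are defined through \<open>chart_inv\<close>,
  which is given by a usable formula only on the image of the chart; smoothness is transferred to
  them from that formula.\<close>

lemma C_k_on_cong:
  assumes V: "openin (Euclidean_space n) V"
  shows "(\<And>x. x \<in> V \<Longrightarrow> f x = g x) \<Longrightarrow> C_k_on n k V g \<Longrightarrow> C_k_on n k V f"
proof (induction k arbitrary: f g)
  case 0
  then show ?case
    using continuous_map_eq[of "subtopology (Euclidean_space n) V" euclideanreal g f] by simp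
next
  case (Suc k)
  have "continuous_map (subtopology (Euclidean_space n) V) euclideanreal f"
    using Suc.prems continuous_map_eq[of "subtopology (Euclidean_space n) V" _ g f] by simp
  moreover have "C_k_on n k V (partial i f)" if "i < n" for i
    using Suc.prems that by (intro Suc.IH[of "partial i f" "partial i g"] partial_cong(1)[OF V]) auto
  moreover have "(\<lambda>t. f (x(i := t))) differentiable (at (x i))" if "i < n" "x \<in> V" for i x
    using Suc.prems that by (intro partial_cong(2)[OF V, of _ _ f g]) auto
  ultimately show ?case by simp
qed

lemma C_k_on_SucI:
  assumes V: "openin (Euclidean_space n) V"
    and f: "continuous_map (subtopology (Euclidean_space n) V) euclideanreal f"
    and d: "\<And>i x. i < n \<Longrightarrow> x \<in> V \<Longrightarrow> ((\<lambda>t. f (x(i := t))) has_real_derivative f' i x) (at (x i))"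
    and f': "\<And>i. i < n \<Longrightarrow> C_k_on n k V (f' i)"
  shows "C_k_on n (Suc k) V f"
proof -
  have "partial i f x = f' i x" if "i < n" "x \<in> V" for i x
    unfolding partial_def using d[OF that] by (rule DERIV_imp_deriv)
  then show ?thesis
    using f d C_k_on_cong[OF V _ f'] real_differentiable_def by (simp; blast)
qed

lemma C_k_on_SucD:
  assumes "C_k_on n (Suc k) V f" "i < n" "x \<in> V"
  shows "((\<lambda>t. f (x(i := t))) has_real_derivative partial i f x) (at (x i))"
  using assms by (auto simp: partial_def DERIV_deriv_iff_real_differentiable)

lemma C_k_on_continuous:
  "C_k_on n k V f \<Longrightarrow> continuous_map (subtopology (Euclidean_space n) V) euclideanreal f"
  by (cases k) auto

lemma C_k_on_Suc_imp: "C_k_on n (Suc k) V f \<Longrightarrow> C_k_on n k V f"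
proof (induction k arbitrary: f)
  case (Suc k)
  then show ?case by (metis C_k_on.simps(2))
qed simp

lemma C_k_on_const: "openin (Euclidean_space n) V \<Longrightarrow> C_k_on n k V (\<lambda>_. c)"
proof (induction k arbitrary: c)
  case (Suc k)
  then show ?case by (intro C_k_on_SucI[where f' = "\<lambda>_ _. 0"]) auto
qed simp

lemma continuous_map_coordinate:
  "continuous_map (subtopology (Euclidean_space n) V) euclideanreal (\<lambda>x. x j)"
  by (simp add: Euclidean_space_top_of_set subtopology_subtopology continuous_on_product_coordinates
      continuous_on_subset[OF continuous_on_product_coordinates])

lemma C_k_on_coordinate: "openin (Euclidean_space n) V \<Longrightarrow> C_k_on n k V (\<lambda>x. x j)"
proof (cases k)
  case (Suc m)
  assume "openin (Euclidean_space n) V"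
  then show ?thesis unfolding Suc
    by (intro C_k_on_SucI[where f' = "\<lambda>i _. if i = j then 1 else 0"] continuous_map_coordinate C_k_on_const)
       (auto intro!: derivative_eq_intros)
qed (simp add: continuous_map_coordinate)

lemma C_k_on_add:
  assumes V: "openin (Euclidean_space n) V"
  shows "C_k_on n k V f \<Longrightarrow> C_k_on n k V g \<Longrightarrow> C_k_on n k V (\<lambda>x. f x + g x)"
proof (induction k arbitrary: f g)
  case 0
  then show ?case by (auto intro: continuous_map_add)
next
  case (Suc k)
  show ?case
  proof (rule C_k_on_SucI[OF V, where f' = "\<lambda>i x. partial i f x + partial i g x"])
    show "continuous_map (subtopology (Euclidean_space n) V) euclideanreal (\<lambda>x. f x + g x)"
      using Suc.prems by (intro continuous_map_add C_k_on_continuous)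
    show "((\<lambda>t. f (x(i := t)) + g (x(i := t))) has_real_derivative partial i f x + partial i g x)
        (at (x i))" if "i < n" "x \<in> V" for i x
      using Suc.prems that by (intro DERIV_add C_k_on_SucD)
    show "C_k_on n k V (\<lambda>x. partial i f x + partial i g x)" if "i < n" for i
      using Suc.prems that by (intro Suc.IH) auto
  qed
qed

lemma C_k_on_mult:
  assumes V: "openin (Euclidean_space n) V"
  shows "C_k_on n k V f \<Longrightarrow> C_k_on n k V g \<Longrightarrow> C_k_on n k V (\<lambda>x. f x * g x)"
proof (induction k arbitrary: f g)
  case 0
  then show ?case by (auto intro: continuous_map_real_mult)
next
  case (Suc k)
  show ?case
  proof (rule C_k_on_SucI[OF V, where f' = "\<lambda>i x. partial i f x * g x + partial i g x * f x"])
    show "continuous_map (subtopology (Euclidean_space n) V) euclideanreal (\<lambda>x. f x * g x)"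
      using Suc.prems by (intro continuous_map_real_mult C_k_on_continuous)
    show "((\<lambda>t. f (x(i := t)) * g (x(i := t))) has_real_derivative
        partial i f x * g x + partial i g x * f x) (at (x i))" if "i < n" "x \<in> V" for i x
      using DERIV_mult[OF C_k_on_SucD[OF Suc.prems(1) that] C_k_on_SucD[OF Suc.prems(2) that]]
      by (simp only: fun_upd_triv)
    show "C_k_on n k V (\<lambda>x. partial i f x * g x + partial i g x * f x)" if "i < n" for i
      using Suc.prems[THEN C_k_on_Suc_imp] Suc.prems that
      by (intro C_k_on_add[OF V] Suc.IH) auto
  qed
qed

lemma C_k_on_inverse:
  assumes V: "openin (Euclidean_space n) V" and nz: "\<And>x. x \<in> V \<Longrightarrow> f x \<noteq> 0"
  shows "C_k_on n k V f \<Longrightarrow> C_k_on n k V (\<lambda>x. inverse (f x))"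
proof (induction k)
  case 0
  then show ?case using nz by (auto intro!: continuous_map_real_inverse)
next
  case (Suc k)
  have IH: "C_k_on n k V (\<lambda>x. inverse (f x))"
    using Suc by (metis C_k_on_Suc_imp)
  show ?case
  proof (rule C_k_on_SucI[OF V, where f' = "\<lambda>i x. (-1) * (partial i f x * (inverse (f x) * inverse (f x)))"])
    show "continuous_map (subtopology (Euclidean_space n) V) euclideanreal (\<lambda>x. inverse (f x))"
      using IH by (rule C_k_on_continuous)
    show "((\<lambda>t. inverse (f (x(i := t)))) has_real_derivative
        (-1) * (partial i f x * (inverse (f x) * inverse (f x)))) (at (x i))" if "i < n" "x \<in> V" for i x
      by (rule DERIV_cong[OF DERIV_inverse_fun[OF C_k_on_SucD[OF Suc.prems that]]])
         (use nz that in \<open>auto simp: power2_eq_square\<close>)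
    show "C_k_on n k V (\<lambda>x. (-1) * (partial i f x * (inverse (f x) * inverse (f x))))" if "i < n" for i
      using Suc.prems that by (intro C_k_on_mult[OF V] C_k_on_const[OF V] IH) auto
  qed
qed

lemma smooth_on_const: "openin (Euclidean_space n) V \<Longrightarrow> smooth_on n V (\<lambda>_. c)"
  and smooth_on_coordinate: "openin (Euclidean_space n) V \<Longrightarrow> smooth_on n V (\<lambda>x. x j)"
  and smooth_on_add: "openin (Euclidean_space n) V \<Longrightarrow> smooth_on n V f \<Longrightarrow> smooth_on n V g \<Longrightarrow>
        smooth_on n V (\<lambda>x. f x + g x)"
  and smooth_on_mult: "openin (Euclidean_space n) V \<Longrightarrow> smooth_on n V f \<Longrightarrow> smooth_on n V g \<Longrightarrow>
        smooth_on n V (\<lambda>x. f x * g x)"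
  and smooth_on_inverse: "openin (Euclidean_space n) V \<Longrightarrow> (\<And>x. x \<in> V \<Longrightarrow> f x \<noteq> 0) \<Longrightarrow>
        smooth_on n V f \<Longrightarrow> smooth_on n V (\<lambda>x. inverse (f x))"
  and smooth_on_cong: "openin (Euclidean_space n) V \<Longrightarrow> (\<And>x. x \<in> V \<Longrightarrow> f x = g x) \<Longrightarrow>
        smooth_on n V g \<Longrightarrow> smooth_on n V f"
  unfolding smooth_on_def
  by (blast intro: C_k_on_const C_k_on_coordinate C_k_on_add C_k_on_mult C_k_on_inverse C_k_on_cong)+

lemma smooth_on_diff:
  assumes V: "openin (Euclidean_space n) V" and "smooth_on n V f" "smooth_on n V g"
  shows "smooth_on n V (\<lambda>x. f x - g x)"
  using smooth_on_add[OF V assms(2) smooth_on_mult[OF V smooth_on_const[OF V, of "-1"] assms(3)]]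
  by simp

lemma smooth_on_power:
  assumes V: "openin (Euclidean_space n) V" and "smooth_on n V f"
  shows "smooth_on n V (\<lambda>x. f x ^ m)"
  by (induction m) (use assms in \<open>auto intro: smooth_on_const smooth_on_mult\<close>)

lemma smooth_on_divide:
  assumes "openin (Euclidean_space n) V" "smooth_on n V f" "smooth_on n V g" "\<And>x. x \<in> V \<Longrightarrow> g x \<noteq> 0"
  shows "smooth_on n V (\<lambda>x. f x / g x)"
  unfolding divide_inverse using assms by (intro smooth_on_mult smooth_on_inverse)

section \<open>The space-time\<close>

definition nsq :: "(nat \<Rightarrow> real) \<Rightarrow> real" where
  "nsq p = (p 0)\<^sup>2 + (p 1)\<^sup>2"

definition plane0 :: "(nat \<Rightarrow> real) set" where
  "plane0 = {p. (\<forall>i\<ge>2. p i = 0) \<and> nsq p > 0}"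

text \<open>The coordinate field of \<phi>. Dividing the components of \<open>p\<close> and of
  \<open>rot p\<close> by \<open>nsq p\<close> gives the 1-forms d\<tau> and d\<phi>; together with
  (cosh \<tau>)^2 / 4 = (\<open>nsq p\<close> + 1)^2 / (16 \<open>nsq p\<close>) this explains the
  coefficients of \<open>dS_metric\<close>.\<close>

definition rot :: "(nat \<Rightarrow> real) \<Rightarrow> nat \<Rightarrow> real" where
  "rot p i = (if i = 0 then - p 1 else p 0)"

text \<open>
  In polar coordinates \<open>(\<tau>, \<phi>)\<close> with \<open>p = e\<^sup>\<tau> (cos \<phi>, sin \<phi>)\<close> this is
  \<open>(cosh \<tau>)\<^sup>2 / 4 d\<phi>\<^sup>2 - d\<tau>\<^sup>2\<close>. De Sitter space has \<open>(cosh \<tau>)\<^sup>2 d\<theta>\<^sup>2 - d\<tau>\<^sup>2\<close> with \<open>\<theta>\<close> of period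
  \<open>2\<pi>\<close>; here \<open>\<theta> = \<phi> / 2\<close> has period \<open>\<pi>\<close>.
\<close>

definition dS_metric :: "(nat \<Rightarrow> real) \<Rightarrow> nat \<Rightarrow> nat \<Rightarrow> real" where
  "dS_metric p i j =
     (nsq p + 1)\<^sup>2 / (16 * nsq p ^ 3) * (rot p i * rot p j) - p i * p j / (nsq p)\<^sup>2"

lemma dS_metric_commute: "dS_metric p i j = dS_metric p j i"
  by (simp add: dS_metric_def mult.commute)

definition dS_chart :: "(nat \<Rightarrow> real) chart" where
  "dS_chart = (plane0, \<lambda>p. p)"

text \<open>Since events scale with exp \<tau>, the position vector is the coordinate field of
  \<tau>, which points to the future. Metric and time field can disregard the chart because the
  atlas has just one.\<close>

definition dS :: "(nat \<Rightarrow> real) lorentz" where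
  "dS = \<lparr>events = top_of_set plane0, ndim = 2, atlas = {dS_chart},
         metric = (\<lambda>c. dS_metric), time_field = (\<lambda>c p. p)\<rparr>"

lemma dS_simps [simp]:
  "events dS = top_of_set plane0" "ndim dS = 2" "atlas dS = {dS_chart}"
  "metric dS c p i j = dS_metric p i j" "time_field dS c p = p"
  "fst dS_chart = plane0" "snd dS_chart = (\<lambda>p. p)"
  by (simp_all add: dS_def dS_chart_def)

lemma sum_less_2: "(\<Sum>i<2. f i) = f 0 + f (1::nat)"
  by (simp add: numeral_2_eq_2)

lemma all_less_2: "(\<forall>i<2. P i) \<longleftrightarrow> P 0 \<and> P (1::nat)"
  by (auto simp: less_2_cases_iff)

lemma ex_less_2: "(\<exists>i<2. P i) \<longleftrightarrow> P 0 \<or> P (1::nat)"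
  by (auto simp: less_2_cases_iff)

lemma continuous_on_coordinate [continuous_intros]: "continuous_on S (\<lambda>p :: nat \<Rightarrow> real. p i)"
  by (rule continuous_on_subset[OF continuous_on_product_coordinates]) simp

lemma openin_plane0: "openin (Euclidean_space 2) plane0"
proof -
  have "open {p. nsq p > 0}"
    unfolding nsq_def by (intro open_Collect_less continuous_intros)
  moreover have "plane0 = {p. \<forall>i\<ge>2. p i = 0} \<inter> {p. nsq p > 0}"
    by (auto simp: plane0_def)
  ultimately show ?thesis
    unfolding Euclidean_space_top_of_set by (auto simp: openin_open)
qed

lemma subtopology_plane0: "U \<subseteq> plane0 \<Longrightarrow> subtopology (Euclidean_space 2) U = top_of_set U"
  by (auto simp: Euclidean_space_top_of_set subtopology_subtopology plane0_def intro!: arg_cong[where f = top_of_set])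

lemma chart_inv_dS [simp]: "p \<in> plane0 \<Longrightarrow> chart_inv dS_chart p = p"
  by (simp add: chart_inv_def inv_into_f_f[OF inj_on_id2])

section \<open>Polar coordinates\<close>

definition polar :: "real \<Rightarrow> real \<Rightarrow> nat \<Rightarrow> real" where
  "polar \<tau> \<phi> i = (if i = 0 then exp \<tau> * cos \<phi> else if i = 1 then exp \<tau> * sin \<phi> else 0)"

lemma polar_simps [simp]: "polar \<tau> \<phi> 0 = exp \<tau> * cos \<phi>" "polar \<tau> \<phi> (Suc 0) = exp \<tau> * sin \<phi>"
  by (simp_all add: polar_def)

lemma nsq_polar: "nsq (polar \<tau> \<phi>) = (exp \<tau>)\<^sup>2"
proof -
  have "nsq (polar \<tau> \<phi>) = (exp \<tau>)\<^sup>2 * ((cos \<phi>)\<^sup>2 + (sin \<phi>)\<^sup>2)"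
    by (simp add: nsq_def power_mult_distrib distrib_left del: sin_cos_squared_add sin_cos_squared_add2)
  then show ?thesis by simp
qed

lemma polar_in_plane0 [simp]: "polar \<tau> \<phi> \<in> plane0"
  by (auto simp: plane0_def nsq_polar polar_def)

lemma plane0_eqI: "p \<in> plane0 \<Longrightarrow> q \<in> plane0 \<Longrightarrow> p 0 = q 0 \<Longrightarrow> p 1 = q 1 \<Longrightarrow> p = q"
proof (rule ext)
  fix i assume *: "p \<in> plane0" "q \<in> plane0" "p 0 = q 0" "p 1 = q 1"
  show "p i = q i"
  proof (cases "i < 2")
    case True
    then show ?thesis using * by (auto simp: less_2_cases_iff)
  next
    case False
    then show ?thesis using * by (simp add: plane0_def)
  qed
qed

lemma plane0_polar:
  assumes "p \<in> plane0" obtains \<tau> \<phi> where "p = polar \<tau> \<phi>"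
proof -
  have n: "nsq p > 0" using assms by (simp add: plane0_def)
  define r where "r = sqrt (nsq p)"
  have r: "r > 0" "r\<^sup>2 = nsq p" using n by (auto simp: r_def)
  have "(p 0 / r)\<^sup>2 + (p 1 / r)\<^sup>2 = 1"
    using r n by (simp add: power_divide flip: add_divide_distrib nsq_def[unfolded One_nat_def])
  then obtain \<phi> where "p 0 / r = cos \<phi>" "p 1 / r = sin \<phi>"
    using sincos_total_2pi by metis
  then have "p = polar (ln r) \<phi>"
    using r by (intro plane0_eqI assms) (auto simp: field_simps)
  then show thesis by (rule that)
qed

text \<open>The time belongs to the event, the angle only to a lift of it. Every later comparison of
  two lifts of one event uses this.\<close>

lemma polar_eq_iff: "polar \<tau> \<phi> = polar \<tau>' \<phi>' \<longleftrightarrow> \<tau> = \<tau>' \<and> (\<exists>n::int. \<phi> = \<phi>' + 2 * pi * n)"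
proof
  assume eq: "polar \<tau> \<phi> = polar \<tau>' \<phi>'"
  then have "(exp \<tau>)\<^sup>2 = (exp \<tau>')\<^sup>2" by (metis nsq_polar)
  then have "exp \<tau> = exp \<tau>'" by (rule power2_eq_imp_eq) auto
  then have \<tau>: "\<tau> = \<tau>'" by simp
  have "exp \<tau> * cos \<phi> = exp \<tau> * cos \<phi>'" "exp \<tau> * sin \<phi> = exp \<tau> * sin \<phi>'"
    using fun_cong[OF eq, of 0] fun_cong[OF eq, of 1] \<tau> by simp_all
  then have "sin \<phi> = sin \<phi>' \<and> cos \<phi> = cos \<phi>'" by simp
  then show "\<tau> = \<tau>' \<and> (\<exists>n::int. \<phi> = \<phi>' + 2 * pi * n)"
    using \<tau> by (simp add: sin_cos_eq_iff)
next
  assume "\<tau> = \<tau>' \<and> (\<exists>n::int. \<phi> = \<phi>' + 2 * pi * n)"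
  then obtain n :: int where "\<tau> = \<tau>'" "\<phi> = \<phi>' + 2 * pi * n" by blast
  then have "sin \<phi> = sin \<phi>'" "cos \<phi> = cos \<phi>'" using sin_cos_eq_iff by blast+
  then show "polar \<tau> \<phi> = polar \<tau>' \<phi>'"
    using \<open>\<tau> = \<tau>'\<close> by (auto simp: polar_def)
qed

lemma continuous_on_polar:
  fixes f g :: "'a :: t2_space \<Rightarrow> real"
  assumes "continuous_on S f" "continuous_on S g"
  shows "continuous_on S (\<lambda>x. polar (f x) (g x))"
proof (rule continuous_on_coordinatewise_then_product)
  fix i show "continuous_on S (\<lambda>x. polar (f x) (g x) i)"
    unfolding polar_def
    by (cases "i = 0"; cases "i = 1") (auto intro!: continuous_intros continuous_on_cos continuous_on_sin assms)
qed

lemma plane0_eq: "plane0 = (\<lambda>z. polar (fst z) (snd z)) ` UNIV"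
proof
  show "plane0 \<subseteq> (\<lambda>z. polar (fst z) (snd z)) ` UNIV"
  proof
    fix p assume "p \<in> plane0"
    then obtain \<tau> \<phi> where "p = polar \<tau> \<phi>" by (rule plane0_polar)
    then have "p = (\<lambda>z. polar (fst z) (snd z)) (\<tau>, \<phi>)" by simp
    then show "p \<in> (\<lambda>z. polar (fst z) (snd z)) ` UNIV" by blast
  qed
qed auto

section \<open>The axioms of a space-time\<close>

lemma smooth_on_nsq: "smooth_on 2 plane0 nsq"
  unfolding nsq_def by (intro smooth_on_add smooth_on_power smooth_on_coordinate openin_plane0)

lemma smooth_on_rot: "smooth_on 2 plane0 (\<lambda>p. rot p i)"
proof (cases "i = 0")
  case True
  show ?thesis
    using smooth_on_diff[OF openin_plane0 smooth_on_const[OF openin_plane0] smooth_on_coordinate[OF openin_plane0], of 0 1]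
    by (simp add: rot_def True)
qed (simp add: rot_def smooth_on_coordinate openin_plane0)

lemma smooth_on_dS_metric: "smooth_on 2 plane0 (\<lambda>p. dS_metric p i j)"
  unfolding dS_metric_def
  by (intro smooth_on_diff smooth_on_mult smooth_on_divide smooth_on_power smooth_on_add
        smooth_on_const smooth_on_coordinate openin_plane0 smooth_on_nsq smooth_on_rot)
     (auto simp: plane0_def)

lemma second_countable_euclidean:
  "second_countable (euclidean :: 'a :: second_countable_topology topology)"
proof -
  obtain B :: "'a set set" where B: "countable B" "\<And>C. C \<in> B \<Longrightarrow> open C"
    "\<And>S. open S \<Longrightarrow> \<exists>U. U \<subseteq> B \<and> S = \<Union> U"
    using univ_second_countable by metis
  have "\<exists>V\<in>B. x \<in> V \<and> V \<subseteq> U" if "open U" "x \<in> U" for U x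
    using B(3)[OF that(1)] that(2) by blast
  then show ?thesis
    unfolding second_countable_def using B(1,2) by (intro exI[of _ B]) auto
qed

lemma smooth_manifold_dS: "smooth_manifold (top_of_set plane0) 2 {dS_chart}"
proof -
  have "is_chart (top_of_set plane0) 2 dS_chart"
    using homeomorphic_map_id[of "top_of_set plane0" "top_of_set plane0"]
    by (simp add: is_chart_def openin_plane0 subtopology_plane0 subtopology_subtopology id_def)
  moreover have "smooth_transition 2 dS_chart dS_chart"
    unfolding smooth_transition_def
    by (auto simp: transition_def
          intro: smooth_on_cong[OF openin_plane0 _ smooth_on_coordinate[OF openin_plane0]])
  ultimately show ?thesis
    unfolding smooth_manifold_def
    by (simp add: Hausdorff_space_subtopology second_countable_subtopology second_countable_euclidean)
qed

lemma transition_dS: "p \<in> plane0 \<Longrightarrow> transition dS_chart dS_chart p = p"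
  by (simp add: transition_def)

lemma jacobian_dS: "p \<in> plane0 \<Longrightarrow> i < 2 \<Longrightarrow> jacobian dS_chart dS_chart p k i = (if i = k then 1 else 0)"
proof -
  assume p: "p \<in> plane0" and i: "i < 2"
  have "jacobian dS_chart dS_chart p k i = partial i (\<lambda>x. x k) p"
    unfolding jacobian_def using partial_cong(1)[OF openin_plane0 p i, of "\<lambda>x. transition dS_chart dS_chart x k" "\<lambda>x. x k"]
    by (simp add: transition_dS)
  also have "\<dots> = (if i = k then 1 else 0)"
    unfolding partial_def by (rule DERIV_imp_deriv) (auto intro!: derivative_eq_intros)
  finally show ?thesis .
qed

lemma g_at_dS:
  "g_at dS c p v w = (nsq p + 1)\<^sup>2 / (16 * nsq p ^ 3) * (p 0 * v 1 - p 1 * v 0) * (p 0 * w 1 - p 1 * w 0)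
     - (p 0 * v 0 + p 1 * v 1) * (p 0 * w 0 + p 1 * w 1) / (nsq p)\<^sup>2"
proof -
  define a b where "a = (nsq p + 1)\<^sup>2 / (16 * nsq p ^ 3)" and "b = inverse ((nsq p)\<^sup>2)"
  show ?thesis
    unfolding g_at_def dS_simps sum_less_2 dS_metric_def a_def[symmetric] divide_inverse[of _ "(nsq p)\<^sup>2"]
      b_def[symmetric]
    by (simp add: rot_def algebra_simps)
qed

lemma lorentz_metric_dS: "lorentz_metric dS"
proof -
  have "\<exists>e :: nat \<Rightarrow> nat \<Rightarrow> real. \<forall>i<2. \<forall>j<2.
      g_at dS dS_chart p (e i) (e j) = (if i \<noteq> j then 0 else if i = 1 then -1 else 1)"
    if p: "p \<in> plane0" for p
  proof -
    define \<rho> where "\<rho> = nsq p"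
    have \<rho>: "\<rho> > 0" "p 0 * p 0 + p 1 * p 1 = \<rho>"
      using p by (auto simp: plane0_def \<rho>_def nsq_def power2_eq_square)
    \<comment> \<open>The rotational field has squared length (\<rho> + 1)^2 / (16 \<rho>), and
      \<open>c\<close> normalizes it. The position vector already has square -1; it takes the index
      1 = \<open>ndim\<close> - 1 that is reserved for the timelike direction.\<close>
    define c where "c = 4 * sqrt \<rho> / (\<rho> + 1)"
    have c: "c * c = 16 * \<rho> / (\<rho> + 1)\<^sup>2"
      using \<rho>(1) by (simp add: c_def power2_eq_square field_simps)
    define e :: "nat \<Rightarrow> nat \<Rightarrow> real" where "e = (\<lambda>i. if i = 0 then (\<lambda>k. c * rot p k) else p)"
    have 1: "p 0 * e 0 1 - p 1 * e 0 0 = c * \<rho>" "p 0 * e 0 0 + p 1 * e 0 1 = 0"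
      "p 0 * e 1 1 - p 1 * e 1 0 = 0" "p 0 * e 1 0 + p 1 * e 1 1 = \<rho>"
      using \<rho>(2) by (auto simp: e_def rot_def algebra_simps)
    have "(\<rho> + 1)\<^sup>2 / (16 * \<rho> ^ 3) * (c * \<rho>) * (c * \<rho>) = (\<rho> + 1)\<^sup>2 / (16 * \<rho> ^ 3) * (c * c) * \<rho>\<^sup>2"
      by (simp add: power2_eq_square)
    also have "\<dots> = 1"
      using \<rho>(1) add_pos_pos[OF \<rho>(1) zero_less_one] by (simp add: c power2_eq_square power3_eq_cube)
    finally have 2: "(\<rho> + 1)\<^sup>2 / (16 * \<rho> ^ 3) * (c * \<rho>) * (c * \<rho>) = 1" .
    have "g_at dS dS_chart p (e 0) (e 0) = 1" "g_at dS dS_chart p (e 0) (e 1) = 0"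
      "g_at dS dS_chart p (e 1) (e 0) = 0" "g_at dS dS_chart p (e 1) (e 1) = -1"
      unfolding g_at_dS 1 \<rho>_def[symmetric] 2 using \<rho>(1) by (simp_all add: power2_eq_square)
    then show ?thesis
      by (intro exI[of _ e]) (simp add: all_less_2)
  qed
  moreover have "smooth_on 2 plane0 (\<lambda>x. dS_metric (chart_inv dS_chart x) i j)" for i j
    by (rule smooth_on_cong[OF openin_plane0 _ smooth_on_dS_metric[of i j]]) simp
  ultimately show ?thesis
    unfolding lorentz_metric_def
    by (auto simp: jacobian_dS sum_less_2 all_less_2 dS_metric_commute[of _ "Suc 0" 0])
qed

lemma time_orientation_dS: "time_orientation dS"
proof -
  have "g_at dS dS_chart p p p < 0" if "p \<in> plane0" for p
    using that unfolding g_at_dS by (auto simp: plane0_def nsq_def power2_eq_square)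
  moreover have "continuous_map (subtopology (top_of_set plane0) plane0) euclideanreal (\<lambda>p. p i)" for i
    by (simp add: subtopology_subtopology continuous_on_coordinate)
  ultimately show ?thesis
    unfolding time_orientation_def by (simp add: jacobian_dS sum_less_2 all_less_2)
qed

lemma spacetime_dS: "spacetime dS"
proof -
  have "connected plane0"
    unfolding plane0_eq
    by (intro connected_continuous_image continuous_on_polar continuous_on_fst continuous_on_snd
        continuous_on_id connected_UNIV)
  then have "connected_space (top_of_set plane0)"
    using connectedin_def connectedin_iff_connected by blast
  then show ?thesis
    unfolding spacetime_def
    by (simp add: smooth_manifold_dS lorentz_metric_dS time_orientation_dS)
qed

section \<open>Curves in polar coordinates\<close>

text \<open>Continuity into the product topology holds coordinatewise: the first two coordinates are
  differentiable, the others vanish on \<open>plane0\<close>.\<close>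

lemma smooth_curve_dS:
  "smooth_curve dS I \<gamma> \<longleftrightarrow> open_interval I \<and> \<gamma> ` I \<subseteq> plane0 \<and>
     smooth_fn I (\<lambda>t. \<gamma> t 0) \<and> smooth_fn I (\<lambda>t. \<gamma> t 1)"
proof -
  have "continuous_on I \<gamma>"
    if "\<gamma> ` I \<subseteq> plane0" "smooth_fn I (\<lambda>t. \<gamma> t 0)" "smooth_fn I (\<lambda>t. \<gamma> t 1)"
  proof (rule continuous_on_coordinatewise_then_product)
    fix i show "continuous_on I (\<lambda>t. \<gamma> t i)"
    proof (cases "i < 2")
      case True
      then show ?thesis using that(2,3) by (auto simp: less_2_cases_iff intro: smooth_fn_continuous)
    next
      case False
      then have "\<gamma> t i = 0" if "t \<in> I" for t
        using \<open>\<gamma> ` I \<subseteq> plane0\<close> that by (auto simp: plane0_def)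
      then have "continuous_on I (\<lambda>t. \<gamma> t i) = continuous_on I (\<lambda>_. 0 :: real)"
        by (intro continuous_on_cong) auto
      then show ?thesis by simp
    qed
  qed
  then show ?thesis
    unfolding smooth_curve_def smooth_fn_def by (auto simp: all_less_2 image_subset_iff)
qed

text \<open>A curve with a chosen lift: \<phi> is a smooth real function rather than an angle modulo
  2 pi, so that it can be differentiated and compared along the curve.\<close>

locale polar_curve =
  fixes I :: "real set" and \<tau> \<phi> :: "real \<Rightarrow> real" and \<gamma> :: "real \<Rightarrow> nat \<Rightarrow> real"
  assumes I: "open_interval I"
    and smooth: "smooth_fn I \<tau>" "smooth_fn I \<phi>"
    and \<gamma>: "\<And>t. t \<in> I \<Longrightarrow> \<gamma> t = polar (\<tau> t) (\<phi> t)"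
begin

lemma open_I: "open I"
  using I by (simp add: open_interval_def)

lemma in_plane0 [simp]: "t \<in> I \<Longrightarrow> \<gamma> t \<in> plane0"
  by (simp add: \<gamma>)

lemma smooth_curve: "smooth_curve dS I \<gamma>"
proof -
  have "smooth_fn I (\<lambda>t. exp (\<tau> t) * cos (\<phi> t))" "smooth_fn I (\<lambda>t. exp (\<tau> t) * sin (\<phi> t))"
    by (intro smooth_fn_mult smooth_fn_exp smooth_fn_cos smooth_fn_sin open_I smooth)+
  then show ?thesis
    unfolding smooth_curve_dS using I \<gamma>
    by (auto intro: smooth_fn_cong[OF open_I])
qed

lemma has_velocity:
  assumes "t \<in> I"
  shows "((\<lambda>s. \<gamma> s 0) has_real_derivative deriv \<tau> t * \<gamma> t 0 - deriv \<phi> t * \<gamma> t 1) (at t)"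
    and "((\<lambda>s. \<gamma> s 1) has_real_derivative deriv \<tau> t * \<gamma> t 1 + deriv \<phi> t * \<gamma> t 0) (at t)"
proof -
  note d = smooth_fn_D[OF smooth(1) assms] smooth_fn_D[OF smooth(2) assms]
  have "((\<lambda>s. exp (\<tau> s) * cos (\<phi> s)) has_real_derivative deriv \<tau> t * \<gamma> t 0 - deriv \<phi> t * \<gamma> t 1) (at t)"
    using assms by (auto intro!: derivative_eq_intros d simp: \<gamma>)
  then show "((\<lambda>s. \<gamma> s 0) has_real_derivative deriv \<tau> t * \<gamma> t 0 - deriv \<phi> t * \<gamma> t 1) (at t)"
    by (rule has_field_derivative_transform_within_open[OF _ open_I assms]) (simp add: \<gamma>)
  have "((\<lambda>s. exp (\<tau> s) * sin (\<phi> s)) has_real_derivative deriv \<tau> t * \<gamma> t 1 + deriv \<phi> t * \<gamma> t 0) (at t)"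
    using assms by (auto intro!: derivative_eq_intros d simp: \<gamma>)
  then show "((\<lambda>s. \<gamma> s 1) has_real_derivative deriv \<tau> t * \<gamma> t 1 + deriv \<phi> t * \<gamma> t 0) (at t)"
    by (rule has_field_derivative_transform_within_open[OF _ open_I assms]) (simp add: \<gamma>)
qed

lemma velocity:
  assumes "t \<in> I"
  shows "velocity dS_chart \<gamma> t 0 = deriv \<tau> t * \<gamma> t 0 - deriv \<phi> t * \<gamma> t 1"
    and "velocity dS_chart \<gamma> t 1 = deriv \<tau> t * \<gamma> t 1 + deriv \<phi> t * \<gamma> t 0"
  unfolding velocity_def using has_velocity[OF assms, THEN DERIV_imp_deriv] by simp_all

text \<open>In complex notation \<gamma> = exp (\<tau> + i \<phi>), so \<gamma>' = (\<tau>' + i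
  \<phi>') \<gamma> and \<gamma>'' = (\<tau>'' + i \<phi>'' + (\<tau>' + i \<phi>')^2) \<gamma>; the
  claims are the real and imaginary parts.\<close>

lemma acceleration:
  assumes t: "t \<in> I"
  shows "deriv (\<lambda>s. velocity dS_chart \<gamma> s 0) t =
      (deriv (deriv \<tau>) t + (deriv \<tau> t)\<^sup>2 - (deriv \<phi> t)\<^sup>2) * \<gamma> t 0
      - (deriv (deriv \<phi>) t + 2 * deriv \<tau> t * deriv \<phi> t) * \<gamma> t 1" (is ?th0)
    and "deriv (\<lambda>s. velocity dS_chart \<gamma> s 1) t =
      (deriv (deriv \<tau>) t + (deriv \<tau> t)\<^sup>2 - (deriv \<phi> t)\<^sup>2) * \<gamma> t 1
      + (deriv (deriv \<phi>) t + 2 * deriv \<tau> t * deriv \<phi> t) * \<gamma> t 0" (is ?th1)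
proof -
  note d = smooth_fn_D[OF smooth_fn_deriv[OF smooth(1)] t] smooth_fn_D[OF smooth_fn_deriv[OF smooth(2)] t]
    has_velocity[OF t, unfolded One_nat_def]
  have "((\<lambda>s. deriv \<tau> s * \<gamma> s 0 - deriv \<phi> s * \<gamma> s 1) has_real_derivative
      (deriv (deriv \<tau>) t + (deriv \<tau> t)\<^sup>2 - (deriv \<phi> t)\<^sup>2) * \<gamma> t 0
      - (deriv (deriv \<phi>) t + 2 * deriv \<tau> t * deriv \<phi> t) * \<gamma> t 1) (at t)"
    by (auto intro!: derivative_eq_intros d simp: algebra_simps power2_eq_square)
  then have "((\<lambda>s. velocity dS_chart \<gamma> s 0) has_real_derivative
      (deriv (deriv \<tau>) t + (deriv \<tau> t)\<^sup>2 - (deriv \<phi> t)\<^sup>2) * \<gamma> t 0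
      - (deriv (deriv \<phi>) t + 2 * deriv \<tau> t * deriv \<phi> t) * \<gamma> t 1) (at t)"
    by (rule has_field_derivative_transform_within_open[OF _ open_I t]) (simp add: velocity)
  then show ?th0 by (rule DERIV_imp_deriv)
  have "((\<lambda>s. deriv \<tau> s * \<gamma> s 1 + deriv \<phi> s * \<gamma> s 0) has_real_derivative
      (deriv (deriv \<tau>) t + (deriv \<tau> t)\<^sup>2 - (deriv \<phi> t)\<^sup>2) * \<gamma> t 1
      + (deriv (deriv \<phi>) t + 2 * deriv \<tau> t * deriv \<phi> t) * \<gamma> t 0) (at t)"
    by (auto intro!: derivative_eq_intros d simp: algebra_simps power2_eq_square)
  then have "((\<lambda>s. velocity dS_chart \<gamma> s 1) has_real_derivative
      (deriv (deriv \<tau>) t + (deriv \<tau> t)\<^sup>2 - (deriv \<phi> t)\<^sup>2) * \<gamma> t 1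
      + (deriv (deriv \<phi>) t + 2 * deriv \<tau> t * deriv \<phi> t) * \<gamma> t 0) (at t)"
    by (rule has_field_derivative_transform_within_open[OF _ open_I t])
       (simp add: velocity(2)[unfolded One_nat_def])
  then show ?th1 by (rule DERIV_imp_deriv)
qed

end

text \<open>The angle arises by integrating d\<phi> = (x dy - y dx) / (x^2 + y^2) along the curve,
  which yields smoothness at once; a topological lift through the covering would only be continuous.
  What remains is to show that the result is correct up to a constant.\<close>

lemma polar_lift:
  assumes "smooth_curve dS I \<gamma>"
  obtains \<tau> \<phi> where "polar_curve I \<tau> \<phi> \<gamma>"
proof -
  have I: "open_interval I" "open I" "is_interval I"
    and p: "\<And>t. t \<in> I \<Longrightarrow> \<gamma> t \<in> plane0"
    and sm: "smooth_fn I (\<lambda>t. \<gamma> t 0)" "smooth_fn I (\<lambda>t. \<gamma> t 1)"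
    using assms by (auto simp: smooth_curve_dS open_interval_def)
  define x where "x t = \<gamma> t 0" for t
  define y where "y t = \<gamma> t 1" for t
  have xy: "smooth_fn I x" "smooth_fn I y"
    using sm by (simp_all add: x_def[abs_def] y_def[abs_def])
  have pos: "(x t)\<^sup>2 + (y t)\<^sup>2 > 0" if "t \<in> I" for t
    using p[OF that] by (simp add: x_def y_def plane0_def nsq_def)
  define \<tau> where "\<tau> t = ln ((x t)\<^sup>2 + (y t)\<^sup>2) * (1 / 2)" for t
  define h where "h t = (x t * deriv y t - y t * deriv x t) / ((x t)\<^sup>2 + (y t)\<^sup>2)" for t
  have \<tau>: "smooth_fn I \<tau>"
    unfolding \<tau>_def[abs_def] using pos
    by (intro smooth_fn_mult smooth_fn_ln smooth_fn_add smooth_fn_power2 smooth_fn_const I xy) auto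
  have h: "smooth_fn I h"
    unfolding h_def[abs_def] using pos
    by (intro smooth_fn_divide smooth_fn_mult smooth_fn_diff smooth_fn_add smooth_fn_power2
        smooth_fn_deriv I xy) force
  obtain \<Phi> where \<Phi>: "\<And>t. t \<in> I \<Longrightarrow> (\<Phi> has_real_derivative h t) (at t)"
    using antiderivative_exists[OF I(2,3) smooth_fn_continuous[OF h]] by blast
  have \<tau>': "(\<tau> has_real_derivative (x t * deriv x t + y t * deriv y t) / ((x t)\<^sup>2 + (y t)\<^sup>2)) (at t)"
    if "t \<in> I" for t
  proof -
    have "((\<lambda>s. (x s)\<^sup>2 + (y s)\<^sup>2) has_real_derivative 2 * (x t * deriv x t + y t * deriv y t)) (at t)"
      by (auto intro!: derivative_eq_intros smooth_fn_D[OF xy(1) that] smooth_fn_D[OF xy(2) that]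
          simp: algebra_simps)
    note d = DERIV_cmult_right[OF DERIV_chain2[OF DERIV_ln_divide[OF pos[OF that]] this], of "1 / 2"]
    have half: "1 / q * (2 * z) * (1 / 2) = z / q" for q z :: real by simp
    show ?thesis
      unfolding \<tau>_def[abs_def] by (rule DERIV_cong[OF d half])
  qed
  text \<open>\<open>u + iv\<close> is the complex number \<open>(x + iy) exp (- \<tau> - i\<Phi>)\<close>.\<close>
  define u where "u t = exp (- \<tau> t) * (x t * cos (\<Phi> t) + y t * sin (\<Phi> t))" for t
  define v where "v t = exp (- \<tau> t) * (y t * cos (\<Phi> t) - x t * sin (\<Phi> t))" for t
  have uv': "(u has_real_derivative 0) (at t) \<and> (v has_real_derivative 0) (at t)" if t: "t \<in> I" for t
  proof -
    \<comment> \<open>\<open>T\<close> is \<tau>'. The next two equations say (x + iy)' = (T + i h)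
      (x + iy), so the factor exp (- \<tau> - i \<Phi>) cancels all growth and rotation.\<close>
    define T where "T = (x t * deriv x t + y t * deriv y t) / ((x t)\<^sup>2 + (y t)\<^sup>2)"
    have T: "(\<tau> has_real_derivative T) (at t)"
      using \<tau>'[OF t] by (simp add: T_def)
    have x': "(x has_real_derivative T * x t - h t * y t) (at t)"
    proof (rule DERIV_cong[OF smooth_fn_D[OF xy(1) t]])
      show "deriv x t = T * x t - h t * y t"
        using pos[OF t] by (simp add: T_def h_def divide_simps) (auto simp: algebra_simps power2_eq_square)
    qed
    have y': "(y has_real_derivative T * y t + h t * x t) (at t)"
    proof (rule DERIV_cong[OF smooth_fn_D[OF xy(2) t]])
      show "deriv y t = T * y t + h t * x t"
        using pos[OF t] by (simp add: T_def h_def divide_simps) (auto simp: algebra_simps power2_eq_square)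
    qed
    show ?thesis
      unfolding u_def[abs_def] v_def[abs_def]
      by (auto intro!: derivative_eq_intros T x' y' \<Phi>[OF t]) (simp_all add: algebra_simps)
  qed
  obtain t0 where t0: "t0 \<in> I" using I(1) by (auto simp: open_interval_def)
  have const: "u t = u t0" "v t = v t0" if "t \<in> I" for t
  proof -
    have "convex I" using I(3) by (simp add: is_interval_convex_1)
    from has_field_derivative_zero_constant[OF this, of u] has_field_derivative_zero_constant[OF this, of v]
    show "u t = u t0" "v t = v t0" using uv' t0 that
      by (metis has_field_derivative_at_within)+
  qed
  have e2: "(exp (\<tau> t))\<^sup>2 = (x t)\<^sup>2 + (y t)\<^sup>2" if "t \<in> I" for t
    using pos[OF that] by (simp add: \<tau>_def power2_eq_square flip: exp_add)
  \<comment> \<open>The constant u + iv has modulus one because exp \<tau> is the modulus of x + iy;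
    its argument \<alpha> is the integration constant missing from \<Phi>.\<close>
  have "(u t0)\<^sup>2 + (v t0)\<^sup>2 = (exp (- \<tau> t0))\<^sup>2 * (((x t0)\<^sup>2 + (y t0)\<^sup>2) * ((cos (\<Phi> t0))\<^sup>2 + (sin (\<Phi> t0))\<^sup>2))"
    unfolding u_def v_def by algebra
  also have "\<dots> = 1"
    using e2[OF t0, symmetric] by (simp add: exp_minus power_inverse)
  finally obtain \<alpha> where \<alpha>: "u t0 = cos \<alpha>" "v t0 = sin \<alpha>"
    using sincos_total_2pi by metis
  have inv: "exp (\<tau> t) * (u t * cos (\<Phi> t) - v t * sin (\<Phi> t)) = x t"
    "exp (\<tau> t) * (v t * cos (\<Phi> t) + u t * sin (\<Phi> t)) = y t" for t
  proof -
    have "u t * cos (\<Phi> t) - v t * sin (\<Phi> t) = exp (- \<tau> t) * (x t * ((cos (\<Phi> t))\<^sup>2 + (sin (\<Phi> t))\<^sup>2))"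
      "v t * cos (\<Phi> t) + u t * sin (\<Phi> t) = exp (- \<tau> t) * (y t * ((cos (\<Phi> t))\<^sup>2 + (sin (\<Phi> t))\<^sup>2))"
      unfolding u_def v_def by algebra+
    then show "exp (\<tau> t) * (u t * cos (\<Phi> t) - v t * sin (\<Phi> t)) = x t"
      "exp (\<tau> t) * (v t * cos (\<Phi> t) + u t * sin (\<Phi> t)) = y t"
      by (simp_all add: exp_minus)
  qed
  have "\<gamma> t = polar (\<tau> t) (\<Phi> t + \<alpha>)" if "t \<in> I" for t
  proof (rule plane0_eqI)
    show "\<gamma> t 0 = polar (\<tau> t) (\<Phi> t + \<alpha>) 0" "\<gamma> t 1 = polar (\<tau> t) (\<Phi> t + \<alpha>) 1"
      using inv[of t] const[OF that] \<alpha> by (simp_all add: x_def y_def cos_add sin_add algebra_simps)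
  qed (use p that in auto)
  moreover have "smooth_fn I (\<lambda>t. \<Phi> t + \<alpha>)"
    by (intro smooth_fn_add smooth_fn_const smooth_fn_antiderivative[OF I(2) \<Phi> h] I)
  ultimately have "polar_curve I \<tau> (\<lambda>t. \<Phi> t + \<alpha>) \<gamma>"
    using I(1) \<tau> by unfold_locales auto
  then show thesis by (rule that)
qed

section \<open>Geodesics\<close>

definition drot :: "nat \<Rightarrow> nat \<Rightarrow> real" where
  "drot i j = (if j = 0 then (if i = 1 then -1 else 0) else (if i = 0 then 1 else 0))"

definition dS_coeff' :: "real \<Rightarrow> real" where
  "dS_coeff' \<rho> = - ((\<rho> + 1) * (\<rho> + 3) / (16 * \<rho> ^ 4))"

lemma dS_coeff_derivative:
  "\<rho> > 0 \<Longrightarrow> ((\<lambda>r. (r + 1)\<^sup>2 / (16 * r ^ 3)) has_real_derivative dS_coeff' \<rho>) (at \<rho>)"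
  by (rule derivative_eq_intros refl)+
     (auto simp: dS_coeff'_def divide_simps power2_eq_square power3_eq_cube power4_eq_xxxx,
      simp add: algebra_simps)

lemma metric_partial_dS:
  assumes p: "p \<in> plane0" and i: "i < 2"
  shows "metric_partial dS dS_chart p i j k =
    dS_coeff' (nsq p) * (2 * p i) * (rot p j * rot p k)
    + (nsq p + 1)\<^sup>2 / (16 * nsq p ^ 3) * (drot i j * rot p k + rot p j * drot i k)
    - ((if j = i then 1 else 0) * p k + p j * (if k = i then 1 else 0)) * inverse ((nsq p)\<^sup>2)
    + p j * p k * (4 * p i * inverse (nsq p ^ 3))"
proof -
  have pos: "nsq p > 0" using p by (simp add: plane0_def)
  have c: "((\<lambda>t. (p(i := t)) j) has_real_derivative (if j = i then 1 else 0)) (at (p i))" for j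
    by (auto intro!: derivative_eq_intros)
  have n: "((\<lambda>t. nsq (p(i := t))) has_real_derivative 2 * p i) (at (p i))"
    using i unfolding nsq_def by (auto intro!: derivative_eq_intros simp: less_2_cases_iff)
  have r: "((\<lambda>t. rot (p(i := t)) j) has_real_derivative drot i j) (at (p i))" for j
    using i unfolding rot_def drot_def by (auto intro!: derivative_eq_intros simp: less_2_cases_iff)
  have A: "((\<lambda>t. (nsq (p(i := t)) + 1)\<^sup>2 / (16 * nsq (p(i := t)) ^ 3)) has_real_derivative
      dS_coeff' (nsq p) * (2 * p i)) (at (p i))"
    using DERIV_chain2[OF _ n, of "\<lambda>r. (r + 1)\<^sup>2 / (16 * r ^ 3)"] dS_coeff_derivative[OF pos] by simp
  have B: "((\<lambda>t. inverse ((nsq (p(i := t)))\<^sup>2)) has_real_derivative - (4 * p i * inverse (nsq p ^ 3))) (at (p i))"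
    using pos by (auto intro!: derivative_eq_intros n simp: field_simps power2_eq_square power3_eq_cube)
  have "((\<lambda>t. dS_metric (p(i := t)) j k) has_real_derivative
    (dS_coeff' (nsq p) * (2 * p i) * (rot p j * rot p k)
    + (nsq p + 1)\<^sup>2 / (16 * nsq p ^ 3) * (drot i j * rot p k + rot p j * drot i k))
    - (((if j = i then 1 else 0) * p k + p j * (if k = i then 1 else 0)) * inverse ((nsq p)\<^sup>2)
       + p j * p k * - (4 * p i * inverse (nsq p ^ 3)))) (at (p i))"
    unfolding dS_metric_def divide_inverse[of _ "(nsq _)\<^sup>2"]
    by (rule DERIV_cong[OF DERIV_diff[OF DERIV_mult[OF A DERIV_mult[OF r[of j] r[of k]]]
          DERIV_mult[OF DERIV_mult[OF c[of j] c[of k]] B]]])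
       (simp add: algebra_simps)
  then have "partial i (\<lambda>x. dS_metric x j k) p = 
    dS_coeff' (nsq p) * (2 * p i) * (rot p j * rot p k)
    + (nsq p + 1)\<^sup>2 / (16 * nsq p ^ 3) * (drot i j * rot p k + rot p j * drot i k)
    - (((if j = i then 1 else 0) * p k + p j * (if k = i then 1 else 0)) * inverse ((nsq p)\<^sup>2)
       + p j * p k * - (4 * p i * inverse (nsq p ^ 3)))"
    unfolding partial_def by (rule DERIV_imp_deriv)
  moreover have "metric_partial dS dS_chart p i j k = partial i (\<lambda>x. dS_metric x j k) p"
    unfolding metric_partial_def
    using partial_cong(1)[OF openin_plane0 p i, of "\<lambda>x. dS_metric (chart_inv dS_chart x) j k" "\<lambda>x. dS_metric x j k"]
    by simp
  ultimately show ?thesis by simp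
qed

text \<open>The geodesic expression with position, velocity and acceleration as independent
  arguments, so that the contraction below becomes an algebraic identity at a single point.\<close>

definition geod_lhs ::
  "(nat \<Rightarrow> real) \<Rightarrow> (nat \<Rightarrow> real) \<Rightarrow> (nat \<Rightarrow> real) \<Rightarrow> nat \<Rightarrow> real" where
  "geod_lhs p v a k = (\<Sum>l<2. dS_metric p k l * a l) +
     (\<Sum>i<2. \<Sum>j<2. christoffel dS dS_chart p k i j * v i * v j)"

text \<open>
  Contracting the Cartesian equations with the radial and the rotational vector field gives
  the equations for \<open>\<tau>\<close> and \<open>\<phi>\<close>; \<open>T\<close>, \<open>P\<close> stand for their first and \<open>T'\<close>, \<open>P'\<close> for their
  second derivatives.
\<close>

lemma geod_lhs_polar:
  fixes T P T' P' :: real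
  assumes p: "p \<in> plane0"
    and v: "v 0 = T * p 0 - P * p 1" "v 1 = T * p 1 + P * p 0"
    and a: "a 0 = (T' + T\<^sup>2 - P\<^sup>2) * p 0 - (P' + 2 * T * P) * p 1"
           "a 1 = (T' + T\<^sup>2 - P\<^sup>2) * p 1 + (P' + 2 * T * P) * p 0"
  defines "\<rho> \<equiv> nsq p"
  defines "A \<equiv> (\<rho> + 1)\<^sup>2 / (16 * \<rho> ^ 3)" and "A' \<equiv> dS_coeff' \<rho>"
  shows "p 0 * geod_lhs p v a 0 + p 1 * geod_lhs p v a 1 = - T' - (2 * A + \<rho> * A') * \<rho>\<^sup>2 * P\<^sup>2" (is ?rad)
    and "p 0 * geod_lhs p v a 1 - p 1 * geod_lhs p v a 0 =
           A * \<rho>\<^sup>2 * P' + (4 * A * \<rho>\<^sup>2 + 2 * A' * \<rho> ^ 3) * T * P" (is ?ang)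
proof -
  \<comment> \<open>The reciprocals are kept as unknowns \<open>b\<close> and \<open>c\<close>, as
    are \<open>A\<close> and \<open>A'\<close>; both contractions then become polynomial identities,
    and the relations \<open>bc\<close> enter only in the radial one.\<close>
  define b where "b = inverse (\<rho>\<^sup>2)"
  define c where "c = inverse (\<rho> ^ 3)"
  have pos: "\<rho> > 0" using p by (simp add: plane0_def \<rho>_def)
  have bc: "b * \<rho>\<^sup>2 = 1" "c * \<rho> ^ 3 = 1" using pos by (simp_all add: b_def c_def)
  define x y where "x = p 0" and "y = p 1"
  have \<rho>: "\<rho> = x\<^sup>2 + y\<^sup>2" by (simp add: \<rho>_def nsq_def x_def y_def)
  have m: "dS_metric p i j = A * (rot p i * rot p j) - p i * p j * b" for i j
    unfolding dS_metric_def A_def b_def \<rho>_def divide_inverse ..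
  have mp: "metric_partial dS dS_chart p i j k =
     A' * (2 * p i) * (rot p j * rot p k) + A * (drot i j * rot p k + rot p j * drot i k)
     - ((if j = i then 1 else 0) * p k + p j * (if k = i then 1 else 0)) * b
     + p j * p k * (4 * p i * c)" if "i < 2" for i j k
    unfolding metric_partial_dS[OF p that] A_def A'_def b_def c_def \<rho>_def ..
  have r: "rot p 0 = - y" "rot p 1 = x" by (simp_all add: rot_def x_def y_def)
  have dr: "drot 0 0 = 0" "drot 1 0 = -1" "drot 0 1 = 1" "drot 1 1 = 0" by (simp_all add: drot_def)
  note mp0 = mp[of 0 0 0] mp[of 0 0 1] mp[of 0 1 0] mp[of 0 1 1] mp[of 1 0 0] mp[of 1 0 1] mp[of 1 1 0] mp[of 1 1 1]
  note E = geod_lhs_def sum_less_2 christoffel_def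
  have rad: "p 0 * geod_lhs p v a 0 + p 1 * geod_lhs p v a 1 =
      - (2 * A + \<rho> * A') * \<rho>\<^sup>2 * P\<^sup>2 + 2 * c * \<rho> ^ 3 * T\<^sup>2 - b * \<rho> * (\<rho> * T' + 2 * \<rho> * T\<^sup>2)"
    unfolding E m v a \<rho> using mp0
    by (simp add: r[unfolded One_nat_def] dr[unfolded One_nat_def] flip: x_def y_def[unfolded One_nat_def])
       (simp add: field_simps power2_eq_square power3_eq_cube)
  then show ?rad using bc by algebra
  have "p 0 * geod_lhs p v a 1 - p 1 * geod_lhs p v a 0 =
           A * \<rho>\<^sup>2 * P' + (4 * A * \<rho>\<^sup>2 + 2 * A' * \<rho> ^ 3) * T * P"
    unfolding E m v a \<rho> using mp0
    by (simp add: r[unfolded One_nat_def] dr[unfolded One_nat_def] flip: x_def y_def[unfolded One_nat_def])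
       (simp add: field_simps power2_eq_square power3_eq_cube)
  then show ?ang .
qed

lemma interval_constant:
  assumes "open_interval I" "\<And>t. t \<in> I \<Longrightarrow> (f has_real_derivative 0) (at t)"
  obtains c where "\<And>t. t \<in> I \<Longrightarrow> f t = c"
proof -
  have "convex I" using assms(1) by (simp add: open_interval_def is_interval_convex_1)
  then obtain c where "\<forall>t\<in>I. f t = c"
    using has_field_derivative_zero_constant[of I f] assms(2) has_field_derivative_at_within by blast
  then show thesis using that by blast
qed

lemma cosh_sq: "(cosh x)\<^sup>2 = 1 + (sinh x)\<^sup>2" for x :: real
  by (simp add: cosh_square_eq)

text \<open>The first value is the component of the metric in direction \<phi>, the second is half
  its derivative with respect to \<tau>, as expected of a Christoffel symbol.\<close>

lemma dS_coeff_polar: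
  fixes \<tau> :: real
  defines "\<rho> \<equiv> (exp \<tau>)\<^sup>2"
  shows "(\<rho> + 1)\<^sup>2 / (16 * \<rho> ^ 3) * \<rho>\<^sup>2 = (cosh \<tau>)\<^sup>2 / 4"
    and "(2 * ((\<rho> + 1)\<^sup>2 / (16 * \<rho> ^ 3)) + \<rho> * dS_coeff' \<rho>) * \<rho>\<^sup>2 = sinh \<tau> * cosh \<tau> / 4"
proof -
  have pos: "exp \<tau> > 0" by simp
  define e where "e = exp \<tau>"
  have e: "e > 0" "\<rho> = e\<^sup>2" "sinh \<tau> = (e - inverse e) / 2" "cosh \<tau> = (e + inverse e) / 2"
    using pos by (simp_all add: e_def \<rho>_def sinh_def cosh_def exp_minus)
  show "(\<rho> + 1)\<^sup>2 / (16 * \<rho> ^ 3) * \<rho>\<^sup>2 = (cosh \<tau>)\<^sup>2 / 4"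
    unfolding e(2-4) using e(1) by (simp add: divide_simps power2_eq_square power3_eq_cube)
  have "(2 * ((r + 1)\<^sup>2 / (16 * r ^ 3)) + r * dS_coeff' r) * r\<^sup>2 = (r - inverse r) / 16" if "r > 0" for r
    unfolding dS_coeff'_def using that
    by (simp add: divide_simps power2_eq_square power3_eq_cube power4_eq_xxxx) (simp add: algebra_simps)
  from this[of \<rho>] have "(2 * ((\<rho> + 1)\<^sup>2 / (16 * \<rho> ^ 3)) + \<rho> * dS_coeff' \<rho>) * \<rho>\<^sup>2 = (\<rho> - inverse \<rho>) / 16"
    using e by simp
  also have "\<dots> = sinh \<tau> * cosh \<tau> / 4"
    unfolding e(2-4) using e(1) by (simp add: divide_simps power2_eq_square) (simp add: algebra_simps)
  finally show "(2 * ((\<rho> + 1)\<^sup>2 / (16 * \<rho> ^ 3)) + \<rho> * dS_coeff' \<rho>) * \<rho>\<^sup>2 = sinh \<tau> * cosh \<tau> / 4" .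
qed

section \<open>Geodesic equations and first integrals in polar coordinates\<close>

context polar_curve begin

lemma nsq_pos: "t \<in> I \<Longrightarrow> nsq (\<gamma> t) > 0"
  using in_plane0 by (simp add: plane0_def)

lemma nsq_curve: "t \<in> I \<Longrightarrow> nsq (\<gamma> t) = (exp (\<tau> t))\<^sup>2"
  by (simp add: \<gamma> nsq_polar)

lemma velocity_components:
  assumes "t \<in> I"
  shows "\<gamma> t 0 * velocity dS_chart \<gamma> t 1 - \<gamma> t 1 * velocity dS_chart \<gamma> t 0 = nsq (\<gamma> t) * deriv \<phi> t"
    and "\<gamma> t 0 * velocity dS_chart \<gamma> t 0 + \<gamma> t 1 * velocity dS_chart \<gamma> t 1 = nsq (\<gamma> t) * deriv \<tau> t"
  unfolding velocity[OF assms] nsq_def by (simp_all add: algebra_simps power2_eq_square)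

lemma g_velocity:
  assumes "t \<in> I"
  shows "g_at dS c (\<gamma> t) (velocity dS_chart \<gamma> t) (velocity dS_chart \<gamma> t) =
     (cosh (\<tau> t))\<^sup>2 / 4 * (deriv \<phi> t)\<^sup>2 - (deriv \<tau> t)\<^sup>2"
proof -
  define \<rho> where "\<rho> = nsq (\<gamma> t)"
  have \<rho>: "\<rho> > 0" "\<rho> = (exp (\<tau> t))\<^sup>2" using nsq_pos[OF assms] nsq_curve[OF assms] by (auto simp: \<rho>_def)
  have "g_at dS c (\<gamma> t) (velocity dS_chart \<gamma> t) (velocity dS_chart \<gamma> t) =
    (\<rho> + 1)\<^sup>2 / (16 * \<rho> ^ 3) * \<rho>\<^sup>2 * (deriv \<phi> t)\<^sup>2 - (\<rho> * deriv \<tau> t)\<^sup>2 / \<rho>\<^sup>2"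
    unfolding g_at_dS velocity_components[OF assms] \<rho>_def[symmetric] by (simp add: power2_eq_square)
  also have "\<dots> = (cosh (\<tau> t))\<^sup>2 / 4 * (deriv \<phi> t)\<^sup>2 - (deriv \<tau> t)\<^sup>2"
    unfolding dS_coeff_polar(1)[of "\<tau> t", folded \<rho>(2)] using \<rho>(1) by (simp add: power_mult_distrib)
  finally show ?thesis .
qed

lemma g_time:
  assumes "t \<in> I"
  shows "g_at dS c (\<gamma> t) (\<gamma> t) (velocity dS_chart \<gamma> t) = - deriv \<tau> t"
proof -
  have "g_at dS c (\<gamma> t) (\<gamma> t) (velocity dS_chart \<gamma> t) = - (nsq (\<gamma> t) * (nsq (\<gamma> t) * deriv \<tau> t) / (nsq (\<gamma> t))\<^sup>2)"
    unfolding g_at_dS velocity_components[OF assms] by (simp add: nsq_def power2_eq_square)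
  then show ?thesis
    using nsq_pos[OF assms] by (simp add: power2_eq_square)
qed

lemma velocity_nonzero:
  assumes "t \<in> I"
  shows "(\<exists>i<2. velocity dS_chart \<gamma> t i \<noteq> 0) \<longleftrightarrow> deriv \<tau> t \<noteq> 0 \<or> deriv \<phi> t \<noteq> 0"
proof -
  have "deriv \<tau> t = 0" "deriv \<phi> t = 0" if "velocity dS_chart \<gamma> t 0 = 0" "velocity dS_chart \<gamma> t 1 = 0"
    using velocity_components[OF assms] nsq_pos[OF assms] that by auto
  then show ?thesis
    unfolding ex_less_2 using velocity[OF assms] by auto
qed

lemma geodesic_iff:
  "geodesic dS I \<gamma> \<longleftrightarrow> (\<forall>t\<in>I.
     deriv (deriv \<tau>) t + sinh (\<tau> t) * cosh (\<tau> t) / 4 * (deriv \<phi> t)\<^sup>2 = 0 \<and>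
     cosh (\<tau> t) * deriv (deriv \<phi>) t + 2 * sinh (\<tau> t) * deriv \<tau> t * deriv \<phi> t = 0)"
proof -
  define E where "E t = geod_lhs (\<gamma> t) (velocity dS_chart \<gamma> t) (\<lambda>l. deriv (\<lambda>s. velocity dS_chart \<gamma> s l) t)" for t
  have "geodesic dS I \<gamma> \<longleftrightarrow> (\<forall>t\<in>I. E t 0 = 0 \<and> E t 1 = 0)"
    unfolding geodesic_def using smooth_curve by (auto simp: all_less_2 E_def geod_lhs_def)
  moreover have "E t 0 = 0 \<and> E t 1 = 0 \<longleftrightarrow>
      deriv (deriv \<tau>) t + sinh (\<tau> t) * cosh (\<tau> t) / 4 * (deriv \<phi> t)\<^sup>2 = 0 \<and>
      cosh (\<tau> t) * deriv (deriv \<phi>) t + 2 * sinh (\<tau> t) * deriv \<tau> t * deriv \<phi> t = 0" if t: "t \<in> I" for t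
  proof -
    define \<rho> where "\<rho> = nsq (\<gamma> t)"
    define A where "A = (\<rho> + 1)\<^sup>2 / (16 * \<rho> ^ 3)"
    define A' where "A' = dS_coeff' \<rho>"
    have \<rho>: "\<rho> > 0" "\<rho> = (exp (\<tau> t))\<^sup>2" using nsq_pos[OF t] nsq_curve[OF t] by (auto simp: \<rho>_def)
    have c: "A * \<rho>\<^sup>2 = (cosh (\<tau> t))\<^sup>2 / 4" "(2 * A + \<rho> * A') * \<rho>\<^sup>2 = sinh (\<tau> t) * cosh (\<tau> t) / 4"
      using dS_coeff_polar[of "\<tau> t", folded \<rho>(2)] by (simp_all add: A_def A'_def)
    note l = geod_lhs_polar[OF in_plane0[OF t] velocity[OF t] acceleration[OF t], folded E_def \<rho>_def,
        folded A_def A'_def]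
    have rad: "\<gamma> t 0 * E t 0 + \<gamma> t 1 * E t 1 =
        - (deriv (deriv \<tau>) t + sinh (\<tau> t) * cosh (\<tau> t) / 4 * (deriv \<phi> t)\<^sup>2)"
      unfolding l(1) c(2) by simp
    have "4 * A * \<rho>\<^sup>2 + 2 * A' * \<rho> ^ 3 = 2 * ((2 * A + \<rho> * A') * \<rho>\<^sup>2)"
      by (simp add: algebra_simps power2_eq_square power3_eq_cube)
    then have k: "4 * A * \<rho>\<^sup>2 + 2 * A' * \<rho> ^ 3 = sinh (\<tau> t) * cosh (\<tau> t) / 2"
      unfolding c(2) by simp
    have ang: "\<gamma> t 0 * E t 1 - \<gamma> t 1 * E t 0 =
        cosh (\<tau> t) / 4 * (cosh (\<tau> t) * deriv (deriv \<phi>) t + 2 * sinh (\<tau> t) * deriv \<tau> t * deriv \<phi> t)"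
      unfolding l(2) c(1) k by (simp add: algebra_simps power2_eq_square)
    \<comment> \<open>The position vector and its rotation are orthogonal with squared length \<rho>
      > 0, so the two contractions determine both components.\<close>
    have "\<rho> * E t 0 = \<gamma> t 0 * (\<gamma> t 0 * E t 0 + \<gamma> t 1 * E t 1) - \<gamma> t 1 * (\<gamma> t 0 * E t 1 - \<gamma> t 1 * E t 0)"
      "\<rho> * E t 1 = \<gamma> t 1 * (\<gamma> t 0 * E t 0 + \<gamma> t 1 * E t 1) + \<gamma> t 0 * (\<gamma> t 0 * E t 1 - \<gamma> t 1 * E t 0)"
      unfolding \<rho>_def nsq_def by (simp_all add: algebra_simps power2_eq_square)
    then have "E t 0 = 0 \<and> E t 1 = 0 \<longleftrightarrow>
        \<gamma> t 0 * E t 0 + \<gamma> t 1 * E t 1 = 0 \<and> \<gamma> t 0 * E t 1 - \<gamma> t 1 * E t 0 = 0"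
      using \<rho>(1) by auto
    then show ?thesis
      unfolding rad ang by auto
  qed
  ultimately show ?thesis by blast
qed

text \<open>
  \<open>P\<close> is the angular momentum that belongs to the Killing field \<open>\<partial>\<^sub>\<phi>\<close>. The point of using \<open>sinh \<tau>\<close>
  is that it satisfies a linear equation, whence completeness.
\<close>

lemma geodesic_conserved:
  assumes "geodesic dS I \<gamma>"
  obtains E P where
    "\<And>t. t \<in> I \<Longrightarrow> ((\<lambda>t. sinh (\<tau> t)) has_real_derivative cosh (\<tau> t) * deriv \<tau> t) (at t)"
    "\<And>t. t \<in> I \<Longrightarrow> ((\<lambda>t. cosh (\<tau> t) * deriv \<tau> t) has_real_derivative E * sinh (\<tau> t)) (at t)"
    "\<And>t. t \<in> I \<Longrightarrow> (cosh (\<tau> t) * deriv \<tau> t)\<^sup>2 = P\<^sup>2 / 4 + E * (1 + (sinh (\<tau> t))\<^sup>2)"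
    "\<And>t. t \<in> I \<Longrightarrow> deriv \<phi> t = P / (1 + (sinh (\<tau> t))\<^sup>2)"
    "\<And>t. t \<in> I \<Longrightarrow> g_at dS dS_chart (\<gamma> t) (velocity dS_chart \<gamma> t) (velocity dS_chart \<gamma> t) = - E"
proof -
  have eq: "deriv (deriv \<tau>) t = - (sinh (\<tau> t) * cosh (\<tau> t) / 4 * (deriv \<phi> t)\<^sup>2)"
    "cosh (\<tau> t) * deriv (deriv \<phi>) t = - (2 * sinh (\<tau> t) * deriv \<tau> t * deriv \<phi> t)" if "t \<in> I" for t
    using assms that unfolding geodesic_iff by (auto simp: eq_neg_iff_add_eq_0)
  note d = smooth_fn_D[OF smooth(1)] smooth_fn_D[OF smooth(2)]
    smooth_fn_D[OF smooth_fn_deriv[OF smooth(1)]] smooth_fn_D[OF smooth_fn_deriv[OF smooth(2)]]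
  have "((\<lambda>t. (cosh (\<tau> t))\<^sup>2 * deriv \<phi> t) has_real_derivative 0) (at t)" if t: "t \<in> I" for t
  proof -
    have "((\<lambda>t. (cosh (\<tau> t))\<^sup>2 * deriv \<phi> t) has_real_derivative
        cosh (\<tau> t) * (2 * sinh (\<tau> t) * deriv \<tau> t * deriv \<phi> t + cosh (\<tau> t) * deriv (deriv \<phi>) t)) (at t)"
      by (auto intro!: derivative_eq_intros d[OF t] simp: algebra_simps power2_eq_square)
    then show ?thesis unfolding eq[OF t] by simp
  qed
  then obtain P where P: "\<And>t. t \<in> I \<Longrightarrow> (cosh (\<tau> t))\<^sup>2 * deriv \<phi> t = P"
    using interval_constant[OF I] by blast
  \<comment> \<open>The other first integral: E is minus the squared length of the velocity, hence
    positive for timelike and zero for null geodesics.\<close>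
  have "((\<lambda>t. (deriv \<tau> t)\<^sup>2 - (cosh (\<tau> t))\<^sup>2 / 4 * (deriv \<phi> t)\<^sup>2) has_real_derivative 0) (at t)" if t: "t \<in> I" for t
  proof -
    have "((\<lambda>t. (deriv \<tau> t)\<^sup>2 - (cosh (\<tau> t))\<^sup>2 / 4 * (deriv \<phi> t)\<^sup>2) has_real_derivative
        2 * deriv \<tau> t * deriv (deriv \<tau>) t - cosh (\<tau> t) * sinh (\<tau> t) * deriv \<tau> t / 2 * (deriv \<phi> t)\<^sup>2
          - cosh (\<tau> t) * deriv \<phi> t / 2 * (cosh (\<tau> t) * deriv (deriv \<phi>) t)) (at t)"
      by (auto intro!: derivative_eq_intros d[OF t] simp: algebra_simps power2_eq_square)
    also have "2 * deriv \<tau> t * deriv (deriv \<tau>) t - cosh (\<tau> t) * sinh (\<tau> t) * deriv \<tau> t / 2 * (deriv \<phi> t)\<^sup>2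
          - cosh (\<tau> t) * deriv \<phi> t / 2 * (cosh (\<tau> t) * deriv (deriv \<phi>) t) = 0"
      unfolding eq[OF t] by (simp add: algebra_simps power2_eq_square)
    finally show ?thesis .
  qed
  then obtain E where E: "\<And>t. t \<in> I \<Longrightarrow> (deriv \<tau> t)\<^sup>2 - (cosh (\<tau> t))\<^sup>2 / 4 * (deriv \<phi> t)\<^sup>2 = E"
    using interval_constant[OF I] by blast
  show thesis
  proof (rule that)
    fix t assume t: "t \<in> I"
    have c: "cosh (\<tau> t) > 0" by simp
    show "((\<lambda>t. sinh (\<tau> t)) has_real_derivative cosh (\<tau> t) * deriv \<tau> t) (at t)"
      by (auto intro!: derivative_eq_intros d[OF t])
    have "((\<lambda>t. cosh (\<tau> t) * deriv \<tau> t) has_real_derivative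
        sinh (\<tau> t) * (deriv \<tau> t)\<^sup>2 + cosh (\<tau> t) * deriv (deriv \<tau>) t) (at t)"
      by (auto intro!: derivative_eq_intros d[OF t] simp: algebra_simps power2_eq_square)
    \<comment> \<open>Inserting the definition of E eliminates \<phi>' and leaves the linear
      equation for sinh \<tau>.\<close>
    also have "sinh (\<tau> t) * (deriv \<tau> t)\<^sup>2 + cosh (\<tau> t) * deriv (deriv \<tau>) t = E * sinh (\<tau> t)"
      unfolding eq[OF t] E[OF t, symmetric] by (simp add: algebra_simps power2_eq_square)
    finally show "((\<lambda>t. cosh (\<tau> t) * deriv \<tau> t) has_real_derivative E * sinh (\<tau> t)) (at t)" .
    show "(cosh (\<tau> t) * deriv \<tau> t)\<^sup>2 = P\<^sup>2 / 4 + E * (1 + (sinh (\<tau> t))\<^sup>2)"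
      unfolding cosh_sq[symmetric] E[OF t, symmetric] P[OF t, symmetric] by (simp add: algebra_simps power2_eq_square)
    show "deriv \<phi> t = P / (1 + (sinh (\<tau> t))\<^sup>2)"
      unfolding cosh_sq[symmetric] P[OF t, symmetric] using c by simp
    show "g_at dS dS_chart (\<gamma> t) (velocity dS_chart \<gamma> t) (velocity dS_chart \<gamma> t) = - E"
      unfolding g_velocity[OF t] E[OF t, symmetric] by simp
  qed
qed

text \<open>The converse of \<open>geodesic_conserved\<close>. The linear equation for
  \<open>S\<close> does not know the angular momentum; the quadratic first integral couples
  \<open>S\<close> to the \<open>P\<close> that governs \<phi>.\<close>

lemma geodesicI:
  fixes S S' :: "real \<Rightarrow> real"
  assumes \<tau>: "\<And>t. t \<in> I \<Longrightarrow> \<tau> t = arsinh (S t)"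
    and S: "\<And>t. t \<in> I \<Longrightarrow> (S has_real_derivative S' t) (at t)"
           "\<And>t. t \<in> I \<Longrightarrow> (S' has_real_derivative E * S t) (at t)"
           "\<And>t. t \<in> I \<Longrightarrow> (S' t)\<^sup>2 = P\<^sup>2 / 4 + E * (1 + (S t)\<^sup>2)"
    and \<phi>: "\<And>t. t \<in> I \<Longrightarrow> (\<phi> has_real_derivative P / (1 + (S t)\<^sup>2)) (at t)"
  shows "geodesic dS I \<gamma>"
  unfolding geodesic_iff
proof
  fix t assume t: "t \<in> I"
  define C where "C t = sqrt ((S t)\<^sup>2 + 1)" for t
  have C: "C t > 0" "(C t)\<^sup>2 = 1 + (S t)\<^sup>2" for t by (auto simp: C_def add_nonneg_pos)
  have s: "sinh (\<tau> t) = S t" "cosh (\<tau> t) = C t" if "t \<in> I" for t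
    using that C(1)[of t] by (auto simp: \<tau> C_def cosh_arsinh_real)
  have d\<tau>: "(\<tau> has_real_derivative S' t / C t) (at t)" if "t \<in> I" for t
  proof -
    have "((\<lambda>t. arsinh (S t)) has_real_derivative S' t / C t) (at t)"
      using DERIV_chain2[OF arsinh_real_has_field_derivative S(1)[OF that]] by (simp add: C_def)
    then show ?thesis
      by (rule has_field_derivative_transform_within_open[OF _ open_I that]) (simp add: \<tau>)
  qed
  have dC: "(C has_real_derivative S t * S' t / C t) (at t)" if "t \<in> I" for t
  proof -
    have pos: "(S t)\<^sup>2 + 1 > 0" by (simp add: add_nonneg_pos)
    have "((\<lambda>t. (S t)\<^sup>2 + 1) has_real_derivative 2 * (S t * S' t)) (at t)"
      by (auto intro!: derivative_eq_intros S(1)[OF that])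
    note d = DERIV_chain2[OF DERIV_real_sqrt[OF pos] this]
    have half: "inverse q / 2 * (2 * z) = z / q" for q z :: real
      by (cases "q = 0") (simp_all add: field_simps)
    show ?thesis
      unfolding C_def by (rule DERIV_cong[OF d half])
  qed
  have d: "deriv \<tau> t = S' t / C t" "deriv \<phi> t = P / (1 + (S t)\<^sup>2)" if "t \<in> I" for t
    using d\<tau>[OF that] \<phi>[OF that] by (auto intro: DERIV_imp_deriv)
  have C0: "C t \<noteq> 0" using C(1)[of t] by simp
  have "((\<lambda>t. S' t / C t) has_real_derivative E * S t / C t - S' t * (S t * S' t / C t) / (C t)\<^sup>2) (at t)"
    using C0 by (auto intro!: derivative_eq_intros S(2)[OF t] dC[OF t] simp: divide_simps power2_eq_square)
  then have "(deriv \<tau> has_real_derivative E * S t / C t - S' t * (S t * S' t / C t) / (C t)\<^sup>2) (at t)"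
    by (rule has_field_derivative_transform_within_open[OF _ open_I t]) (simp add: d)
  then have dd\<tau>: "deriv (deriv \<tau>) t = E * S t / C t - S' t * (S t * S' t / C t) / (C t)\<^sup>2"
    by (rule DERIV_imp_deriv)
  have "((\<lambda>t. P / (C t)\<^sup>2) has_real_derivative - 2 * P * S t * S' t / (C t)\<^sup>2 / (C t)\<^sup>2) (at t)"
    using C0 by (auto intro!: derivative_eq_intros dC[OF t] simp: divide_simps power2_eq_square)
  then have "((\<lambda>t. P / (1 + (S t)\<^sup>2)) has_real_derivative - 2 * P * S t * S' t / (C t)\<^sup>2 / (C t)\<^sup>2) (at t)"
    unfolding C(2) .
  then have "(deriv \<phi> has_real_derivative - 2 * P * S t * S' t / (C t)\<^sup>2 / (C t)\<^sup>2) (at t)"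
    by (rule has_field_derivative_transform_within_open[OF _ open_I t]) (simp add: d)
  then have dd\<phi>: "deriv (deriv \<phi>) t = - 2 * P * S t * S' t / (C t)\<^sup>2 / (C t)\<^sup>2"
    by (rule DERIV_imp_deriv)
  have SS: "S' t * S' t = P * P / 4 + E * (C t * C t)"
    using S(3)[OF t] C(2)[of t] by (simp add: power2_eq_square)
  have 1: "deriv (deriv \<tau>) t + S t * C t / 4 * (deriv \<phi> t)\<^sup>2 = S t / (C t * C t * C t) * (E * (C t * C t) - S' t * S' t + P * P / 4)"
    unfolding dd\<tau> d[OF t] C(2)[symmetric] using C0 by (simp add: divide_simps power2_eq_square) (simp add: algebra_simps)
  show "deriv (deriv \<tau>) t + sinh (\<tau> t) * cosh (\<tau> t) / 4 * (deriv \<phi> t)\<^sup>2 = 0 \<and>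
     cosh (\<tau> t) * deriv (deriv \<phi>) t + 2 * sinh (\<tau> t) * deriv \<tau> t * deriv \<phi> t = 0"
    unfolding s[OF t] 1 SS unfolding dd\<phi> d[OF t] C(2)[symmetric] using C0
    by (simp add: divide_simps power2_eq_square)
qed

end

section \<open>Completeness of causal geodesics\<close>

lemma open_interval_UNIV: "open_interval UNIV"
  by (simp add: open_interval_def)

text \<open>Up to constant factors, s' + m s and s' - m s are exponentials, so s is given by a
  formula valid on the whole line. The coefficient is written as a square because E is nonnegative
  for causal geodesics; m = 0 is the null case, where the formula would divide by zero and s is
  affine instead.\<close>

lemma linear_ode_extension:
  fixes s s' :: "real \<Rightarrow> real"
  assumes I: "open_interval I"
    and s: "\<And>t. t \<in> I \<Longrightarrow> (s has_real_derivative s' t) (at t)"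
           "\<And>t. t \<in> I \<Longrightarrow> (s' has_real_derivative m\<^sup>2 * s t) (at t)"
  obtains S S' where "\<And>t. (S has_real_derivative S' t) (at t)"
    "\<And>t. (S' has_real_derivative m\<^sup>2 * S t) (at t)"
    "\<And>t. t \<in> I \<Longrightarrow> S t = s t" "\<And>t. t \<in> I \<Longrightarrow> S' t = s' t"
proof (cases "m = 0")
  case True
  obtain a where a: "\<And>t. t \<in> I \<Longrightarrow> s' t = a"
    using interval_constant[OF I, of s'] s(2) True by auto
  have "((\<lambda>t. s t - a * t) has_real_derivative 0) (at t)" if "t \<in> I" for t
    using s(1)[OF that] a[OF that] by (auto intro!: derivative_eq_intros)
  then obtain b where b: "\<And>t. t \<in> I \<Longrightarrow> s t - a * t = b"
    using interval_constant[OF I, of "\<lambda>t. s t - a * t"] by blast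
  show thesis
  proof (rule that[of "\<lambda>t. a * t + b" "\<lambda>_. a"])
    show "a * t + b = s t" if "t \<in> I" for t using b[OF that] by simp
  qed (auto intro!: derivative_eq_intros simp: True a)
next
  case False
  have d: "((\<lambda>t. (s' t + m * s t) * exp (- m * t)) has_real_derivative 0) (at t)"
       "((\<lambda>t. (s' t - m * s t) * exp (m * t)) has_real_derivative 0) (at t)" if "t \<in> I" for t
    by ((rule derivative_eq_intros refl s[OF that])+, simp add: algebra_simps power2_eq_square)+
  obtain a where a: "\<And>t. t \<in> I \<Longrightarrow> (s' t + m * s t) * exp (- m * t) = a"
    by (rule interval_constant[OF I d(1)], assumption) (rule that)
  obtain b where b: "\<And>t. t \<in> I \<Longrightarrow> (s' t - m * s t) * exp (m * t) = b"
    by (rule interval_constant[OF I d(2)], assumption) (rule that)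
  have ab: "s' t + m * s t = a * exp (m * t)" "s' t - m * s t = b * exp (- m * t)" if "t \<in> I" for t
    unfolding a[OF that, symmetric] b[OF that, symmetric] by (simp_all add: exp_minus)
  show thesis
  proof (rule that[of "\<lambda>t. (a * exp (m * t) - b * exp (- m * t)) / (2 * m)"
                      "\<lambda>t. (a * exp (m * t) + b * exp (- m * t)) / 2"])
    show "(a * exp (m * t) - b * exp (- m * t)) / (2 * m) = s t"
      "(a * exp (m * t) + b * exp (- m * t)) / 2 = s' t" if "t \<in> I" for t
      unfolding ab[OF that, symmetric] using False by (simp_all add: field_simps)
  qed (use False in \<open>auto intro!: derivative_eq_intros simp: field_simps power2_eq_square\<close>)
qed

text \<open>The induction carries \<open>S\<close> and \<open>S'\<close> together, each being, up to
  a factor, the derivative of the other.\<close>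

lemma smooth_fn_linear_ode:
  fixes S S' :: "real \<Rightarrow> real"
  assumes "\<And>t. (S has_real_derivative S' t) (at t)" "\<And>t. (S' has_real_derivative k * S t) (at t)"
  shows "smooth_fn UNIV S"
proof -
  have "diff_times n UNIV S \<and> diff_times n UNIV S'" for n
  proof (induction n)
    case (Suc n)
    then have "diff_times n UNIV (\<lambda>t. k * S t)"
      by (intro diff_times_mult diff_times_const open_UNIV) simp
    then show ?case
      using Suc by (simp add: diff_times_SucI[OF open_UNIV assms(1)] diff_times_SucI[OF open_UNIV assms(2)])
  qed simp
  then show ?thesis by (simp add: smooth_fn_iff)
qed

text \<open>The quadratic first integral is known only on the domain of the given geodesic; this
  propagates it from one parameter to the extended solution.\<close>

lemma energy_conserved:
  fixes S S' :: "real \<Rightarrow> real"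
  assumes S: "\<And>t. (S has_real_derivative S' t) (at t)" "\<And>t. (S' has_real_derivative E * S t) (at t)"
    and t0: "(S' t0)\<^sup>2 = c + E * (1 + (S t0)\<^sup>2)"
  shows "(S' t)\<^sup>2 = c + E * (1 + (S t)\<^sup>2)"
proof -
  have "((\<lambda>t. (S' t)\<^sup>2 - E * (1 + (S t)\<^sup>2)) has_real_derivative 0) (at t)" for t
    by (auto intro!: derivative_eq_intros S simp: algebra_simps power2_eq_square)
  then have "(S' t)\<^sup>2 - E * (1 + (S t)\<^sup>2) = (S' t0)\<^sup>2 - E * (1 + (S t0)\<^sup>2)"
    by (intro DERIV_isconst_all) simp
  then show ?thesis using t0 by simp
qed

lemma polar_geodesic:
  fixes S S' :: "real \<Rightarrow> real"
  assumes S: "\<And>t. (S has_real_derivative S' t) (at t)" "\<And>t. (S' has_real_derivative E * S t) (at t)"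
             "(S' t0)\<^sup>2 = P\<^sup>2 / 4 + E * (1 + (S t0)\<^sup>2)"
    and \<phi>: "\<And>t. (\<phi> has_real_derivative P / (1 + (S t)\<^sup>2)) (at t)"
  shows "polar_curve UNIV (\<lambda>t. arsinh (S t)) \<phi> (\<lambda>t. polar (arsinh (S t)) (\<phi> t))"
    and "geodesic dS UNIV (\<lambda>t. polar (arsinh (S t)) (\<phi> t))"
proof -
  have sm: "smooth_fn UNIV S"
    by (rule smooth_fn_linear_ode[OF S(1,2)])
  have nz: "1 + (S t)\<^sup>2 \<noteq> 0" for t
    by (metis add_pos_nonneg less_numeral_extra(1,3) zero_le_power2)
  have "smooth_fn UNIV (\<lambda>t. P / (1 + (S t)\<^sup>2))"
    by (intro smooth_fn_divide smooth_fn_add smooth_fn_power2 smooth_fn_const sm open_UNIV nz)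
  then have "smooth_fn UNIV \<phi>"
    by (rule smooth_fn_antiderivative[OF open_UNIV \<phi>])
  then show pc: "polar_curve UNIV (\<lambda>t. arsinh (S t)) \<phi> (\<lambda>t. polar (arsinh (S t)) (\<phi> t))"
    by unfold_locales (auto intro!: open_interval_UNIV smooth_fn_arsinh sm)
  show "geodesic dS UNIV (\<lambda>t. polar (arsinh (S t)) (\<phi> t))"
    by (rule polar_curve.geodesicI[OF pc refl S(1,2) energy_conserved[OF S] \<phi>])
qed

text \<open>The extension is assembled from the two polar functions: sinh \<tau> continues as a
  solution of the linear equation, and \<phi>' = P / (1 + S^2) is then continuous on the whole line
  and can be integrated.\<close>

lemma geodesic_extension:
  assumes g: "geodesic dS I \<gamma>" and t0: "t0 \<in> I"
    and causal: "g_at dS dS_chart (\<gamma> t0) (velocity dS_chart \<gamma> t0) (velocity dS_chart \<gamma> t0) \<le> 0"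
  obtains \<delta> where "geodesic dS UNIV \<delta>" "\<And>t. t \<in> I \<Longrightarrow> \<delta> t = \<gamma> t"
proof -
  obtain \<tau> \<phi> where pc: "polar_curve I \<tau> \<phi> \<gamma>"
    using polar_lift g unfolding geodesic_def by blast
  interpret polar_curve I \<tau> \<phi> \<gamma> by fact
  from geodesic_conserved[OF g] obtain E P where
    s: "\<And>t. t \<in> I \<Longrightarrow> ((\<lambda>t. sinh (\<tau> t)) has_real_derivative cosh (\<tau> t) * deriv \<tau> t) (at t)"
       "\<And>t. t \<in> I \<Longrightarrow> ((\<lambda>t. cosh (\<tau> t) * deriv \<tau> t) has_real_derivative E * sinh (\<tau> t)) (at t)"
    and en: "\<And>t. t \<in> I \<Longrightarrow> (cosh (\<tau> t) * deriv \<tau> t)\<^sup>2 = P\<^sup>2 / 4 + E * (1 + (sinh (\<tau> t))\<^sup>2)"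
    and \<phi>: "\<And>t. t \<in> I \<Longrightarrow> deriv \<phi> t = P / (1 + (sinh (\<tau> t))\<^sup>2)"
    and E: "\<And>t. t \<in> I \<Longrightarrow> g_at dS dS_chart (\<gamma> t) (velocity dS_chart \<gamma> t) (velocity dS_chart \<gamma> t) = - E"
    by blast
  \<comment> \<open>Here causality enters: it makes E nonnegative. As E is constant along the
    geodesic, the one parameter \<open>t0\<close> suffices.\<close>
  have m: "(sqrt E)\<^sup>2 = E" using E[OF t0] causal by simp
  obtain S S' where S: "\<And>t. (S has_real_derivative S' t) (at t)"
      "\<And>t. (S' has_real_derivative E * S t) (at t)"
      "\<And>t. t \<in> I \<Longrightarrow> S t = sinh (\<tau> t)" "\<And>t. t \<in> I \<Longrightarrow> S' t = cosh (\<tau> t) * deriv \<tau> t"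
    by (rule linear_ode_extension[OF I s(1), of "sqrt E", unfolded m, OF _ s(2)], assumption, assumption) (rule that)
  have nz: "1 + (S t)\<^sup>2 \<noteq> 0" for t
    by (metis add_pos_nonneg less_numeral_extra(1,3) zero_le_power2)
  have "continuous_on UNIV (\<lambda>t. P / (1 + (S t)\<^sup>2))"
    using S(1) nz by (intro continuous_intros) (auto intro: DERIV_isCont continuous_at_imp_continuous_on)
  then obtain \<Phi> where \<Phi>: "\<And>t. (\<Phi> has_real_derivative P / (1 + (S t)\<^sup>2)) (at t)"
    using antiderivative_exists[OF open_UNIV, of "\<lambda>t. P / (1 + (S t)\<^sup>2)"] by auto
  have "((\<lambda>t. \<phi> t - \<Phi> t) has_real_derivative 0) (at t)" if "t \<in> I" for t
    using DERIV_diff[OF smooth_fn_D[OF smooth(2) that] \<Phi>[of t]] by (simp add: \<phi> S that)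
  then obtain c where c: "\<And>t. t \<in> I \<Longrightarrow> \<phi> t - \<Phi> t = c"
    using interval_constant[OF I, of "\<lambda>t. \<phi> t - \<Phi> t"] by blast
  have \<Phi>c: "((\<lambda>t. \<Phi> t + c) has_real_derivative P / (1 + (S t)\<^sup>2)) (at t)" for t
    using DERIV_add[OF \<Phi> DERIV_const] by simp
  have en0: "(S' t0)\<^sup>2 = P\<^sup>2 / 4 + E * (1 + (S t0)\<^sup>2)"
    using en[OF t0] by (simp add: S(3,4) t0)
  show thesis
  proof (rule that)
    show "geodesic dS UNIV (\<lambda>t. polar (arsinh (S t)) (\<Phi> t + c))"
      by (rule polar_geodesic(2)[OF S(1,2) en0 \<Phi>c])
    show "polar (arsinh (S t)) (\<Phi> t + c) = \<gamma> t" if "t \<in> I" for t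
      using c[OF that] by (simp add: S(3)[OF that] \<gamma>[OF that] arsinh_sinh_real flip: c[OF that])
  qed
qed

lemma inextendible_causal_geodesic_UNIV:
  assumes "inextendible_geodesic dS I \<gamma>" "t \<in> I"
    and "g_at dS dS_chart (\<gamma> t) (velocity dS_chart \<gamma> t) (velocity dS_chart \<gamma> t) \<le> 0"
  shows "I = UNIV"
proof (rule ccontr)
  assume "I \<noteq> UNIV"
  then have "I \<subset> UNIV" by blast
  moreover obtain \<delta> where "geodesic dS UNIV \<delta>" "\<And>t. t \<in> I \<Longrightarrow> \<delta> t = \<gamma> t"
    using geodesic_extension assms unfolding inextendible_geodesic_def by metis
  ultimately show False
    using assms(1) unfolding inextendible_geodesic_def by blast
qed

lemma geodesic_domain:
  assumes "geodesic dS I \<gamma>"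
  shows "\<exists>t. t \<in> I" "t \<in> I \<Longrightarrow> \<gamma> t \<in> plane0"
  using assms by (auto simp: geodesic_def smooth_curve_dS open_interval_def)

lemma null_complete_dS: "null_complete dS"
  unfolding null_complete_def
proof (intro allI impI)
  fix I \<gamma> assume n: "null_geodesic dS I \<gamma>"
  then obtain t where "t \<in> I" "\<gamma> t \<in> plane0"
    using geodesic_domain by (meson inextendible_geodesic_def null_geodesic_def)
  then show "I = UNIV"
    using n by (intro inextendible_causal_geodesic_UNIV[of I \<gamma> t]) (auto simp: null_geodesic_def null_at_def)
qed

lemma timelike_complete_dS: "timelike_complete dS"
  unfolding timelike_complete_def
proof (intro allI impI)
  fix I \<gamma> assume n: "timelike_geodesic dS I \<gamma>"
  then obtain t where "t \<in> I" "\<gamma> t \<in> plane0"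
    using geodesic_domain by (meson inextendible_geodesic_def timelike_geodesic_def)
  then show "I = UNIV"
    using n by (intro inextendible_causal_geodesic_UNIV[of I \<gamma> t])
      (auto simp: timelike_geodesic_def timelike_at_def intro: less_imp_le)
qed

section \<open>Null geodesics\<close>

text \<open>The case E = 0 with sinh \<tau> itself as affine parameter; S' = 1 then forces P = 2
  \<kappa>, where \<kappa> is the sense of rotation. Inextendibility is immediate because the domain
  is the whole line.\<close>

lemma null_geodesic_polar:
  fixes \<kappa> :: real
  assumes "\<kappa>\<^sup>2 = 1"
  shows "null_geodesic dS UNIV (\<lambda>t. polar (arsinh t) (c + 2 * \<kappa> * arctan t))"
proof -
  define \<gamma> where "\<gamma> t = polar (arsinh t) (c + 2 * \<kappa> * arctan t)" for t
  have d\<phi>: "((\<lambda>t. c + 2 * \<kappa> * arctan t) has_real_derivative 2 * \<kappa> / (1 + t\<^sup>2)) (at t)" for t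
    by (auto intro!: derivative_eq_intros simp: divide_inverse)
  have S: "((\<lambda>t. t) has_real_derivative 1) (at t)" "((\<lambda>_. 1) has_real_derivative 0 * t) (at t)"
    "1\<^sup>2 = (2 * \<kappa>)\<^sup>2 / 4 + 0 * (1 + t\<^sup>2)" for t :: real
    using assms by (auto simp: power_mult_distrib)
  have pc: "polar_curve UNIV (\<lambda>t. arsinh t) (\<lambda>t. c + 2 * \<kappa> * arctan t) \<gamma>" and g: "geodesic dS UNIV \<gamma>"
    unfolding \<gamma>_def[abs_def]
    by (rule polar_geodesic[where S = "\<lambda>t. t" and S' = "\<lambda>_. 1" and E = 0 and P = "2 * \<kappa>"], rule S, rule S, rule S, rule d\<phi>)+
  interpret polar_curve UNIV "\<lambda>t. arsinh t" "\<lambda>t. c + 2 * \<kappa> * arctan t" \<gamma> by (rule pc)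
  have "null_at dS \<gamma> t" for t
  proof -
    have d: "deriv arsinh t = 1 / sqrt (t\<^sup>2 + 1)" "deriv (\<lambda>t. c + 2 * \<kappa> * arctan t) t = 2 * \<kappa> / (1 + t\<^sup>2)"
      by (rule DERIV_imp_deriv arsinh_real_has_field_derivative d\<phi>)+
    have pos: "1 + t\<^sup>2 > 0" by (simp add: add_pos_nonneg)
    define q where "q = 1 + t\<^sup>2"
    have q: "q > 0" "t\<^sup>2 + 1 = q" "1 + t\<^sup>2 = q" "(cosh (arsinh t))\<^sup>2 = q"
      using pos by (simp_all add: q_def cosh_sq)
    have "q / 4 * (2 * \<kappa> / q)\<^sup>2 - (1 / sqrt q)\<^sup>2 = \<kappa>\<^sup>2 / q - 1 / q"
      using q(1) by (simp add: power_divide power_mult_distrib power2_eq_square[of q])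
    then have "g_at dS dS_chart (\<gamma> t) (velocity dS_chart \<gamma> t) (velocity dS_chart \<gamma> t) = 0"
      unfolding g_velocity[OF UNIV_I] d q(2-4) assms by simp
    moreover have "\<exists>i<2. velocity dS_chart \<gamma> t i \<noteq> 0"
      unfolding velocity_nonzero[OF UNIV_I] d using pos assms by auto
    ultimately show ?thesis by (simp add: null_at_def)
  qed
  then have "null_geodesic dS UNIV \<gamma>"
    using g by (auto simp: null_geodesic_def inextendible_geodesic_def)
  then show ?thesis by (simp add: \<gamma>_def[abs_def])
qed

text \<open>With E = 0, sinh \<tau> is affine in the parameter and the quadratic first integral
  becomes a^2 = (P / 2)^2. Hence P = 2 \<kappa> a, and \<phi>' integrates to an arctangent.\<close>

lemma null_geodesic_form:
  assumes n: "null_geodesic dS I \<gamma>"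
  obtains a b c \<kappa> where "I = UNIV" "a \<noteq> 0" "\<kappa> = 1 \<or> \<kappa> = -1"
    "\<And>t. \<gamma> t = polar (arsinh (a * t + b)) (c + 2 * \<kappa> * arctan (a * t + b))"
proof -
  have UNIV: "I = UNIV" using n null_complete_dS unfolding null_complete_def by blast
  have g: "geodesic dS UNIV \<gamma>" and na: "null_at dS \<gamma> t" for t
    using n by (auto simp: null_geodesic_def inextendible_geodesic_def UNIV)
  obtain \<tau> \<phi> where pc: "polar_curve UNIV \<tau> \<phi> \<gamma>"
    using polar_lift g unfolding geodesic_def by blast
  interpret polar_curve UNIV \<tau> \<phi> \<gamma> by fact
  obtain E P where conserved:
    "\<And>t. t \<in> UNIV \<Longrightarrow> ((\<lambda>t. sinh (\<tau> t)) has_real_derivative cosh (\<tau> t) * deriv \<tau> t) (at t)"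
    "\<And>t. t \<in> UNIV \<Longrightarrow> ((\<lambda>t. cosh (\<tau> t) * deriv \<tau> t) has_real_derivative E * sinh (\<tau> t)) (at t)"
    "\<And>t. t \<in> UNIV \<Longrightarrow> (cosh (\<tau> t) * deriv \<tau> t)\<^sup>2 = P\<^sup>2 / 4 + E * (1 + (sinh (\<tau> t))\<^sup>2)"
    "\<And>t. t \<in> UNIV \<Longrightarrow> deriv \<phi> t = P / (1 + (sinh (\<tau> t))\<^sup>2)"
    "\<And>t. t \<in> UNIV \<Longrightarrow> g_at dS dS_chart (\<gamma> t) (velocity dS_chart \<gamma> t) (velocity dS_chart \<gamma> t) = - E"
    by (rule geodesic_conserved[OF g]) (rule that)
  note s = conserved(1,2)[OF UNIV_I] and en = conserved(3)[OF UNIV_I] and \<phi> = conserved(4)[OF UNIV_I]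
    and E = conserved(5)[OF UNIV_I]
  have E0: "E = 0" using E[of 0] na[of 0] by (simp add: null_at_def)
  obtain a where a: "\<And>t. cosh (\<tau> t) * deriv \<tau> t = a"
    using interval_constant[OF open_interval_UNIV, of "\<lambda>t. cosh (\<tau> t) * deriv \<tau> t"] s(2) E0 by auto
  have "((\<lambda>t. sinh (\<tau> t) - a * t) has_real_derivative 0) (at t)" for t
    using DERIV_diff[OF s(1)[of t, unfolded a] DERIV_cmult_Id[of a]] by simp
  then have "sinh (\<tau> t) - a * t = sinh (\<tau> 0) - a * 0" for t
    by (intro DERIV_isconst_all[of "\<lambda>t. sinh (\<tau> t) - a * t"]) simp
  then obtain b where sinh: "\<And>t. sinh (\<tau> t) = a * t + b"
    by (metis add.commute diff_add_cancel)
  have "a\<^sup>2 = (P / 2)\<^sup>2" using en[of 0] by (simp add: a E0 power_divide)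
  then have "P = 2 * a \<or> P = -2 * a" by (auto simp: power2_eq_iff)
  then obtain \<kappa> :: real where \<kappa>: "\<kappa> = 1 \<or> \<kappa> = -1" "P = 2 * \<kappa> * a" by force
  have a0: "a \<noteq> 0"
  proof
    assume "a = 0"
    then have "deriv \<tau> 0 = 0" "deriv \<phi> 0 = 0"
      using a[of 0] \<phi>[of 0] \<kappa>(2) by auto
    then show False
      using velocity_nonzero[OF UNIV_I, of 0] na[of 0] by (auto simp: null_at_def)
  qed
  have "((\<lambda>t. \<phi> t - 2 * \<kappa> * arctan (a * t + b)) has_real_derivative 0) (at t)" for t
    using smooth_fn_D[OF smooth(2) UNIV_I, of t] unfolding \<phi> sinh \<kappa>(2)
    by (auto intro!: derivative_eq_intros simp: divide_inverse)
  then have "\<phi> t - 2 * \<kappa> * arctan (a * t + b) = \<phi> 0 - 2 * \<kappa> * arctan (a * 0 + b)" for t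
    by (intro DERIV_isconst_all[of "\<lambda>t. \<phi> t - 2 * \<kappa> * arctan (a * t + b)"]) simp
  then obtain c where "\<And>t. \<phi> t = c + 2 * \<kappa> * arctan (a * t + b)"
    by (metis diff_add_cancel)
  moreover have "\<tau> t = arsinh (a * t + b)" for t
    by (simp add: arsinh_sinh_real flip: sinh)
  ultimately show thesis
    using \<gamma> UNIV a0 \<kappa>(1) that by (metis UNIV_I)
qed

section \<open>Causality\<close>

text \<open>
  Conformal time \<open>\<eta>\<close>: the metric is \<open>(cosh \<tau>)\<^sup>2 / 4 (d\<phi>\<^sup>2 - d\<eta>\<^sup>2)\<close>.
\<close>

definition ctime :: "real \<Rightarrow> real" where
  "ctime \<tau> = 4 * arctan (exp \<tau>)"

text \<open>\<open>ctime\<close> is twice the Gudermannian function, shifted by pi: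
  \<open>ctime \<tau>\<close> = 2 arctan (sinh \<tau>) + pi. This matches the angle in
  \<open>null_geodesic_polar\<close>, which changes at the same rate as conformal time.\<close>

lemma ctime_deriv: "(ctime has_real_derivative 2 / cosh \<tau>) (at \<tau>)"
proof -
  have "exp \<tau> > 0" by simp
  define e where "e = exp \<tau>"
  have e: "e > 0" "cosh \<tau> = (e + inverse e) / 2"
    by (simp_all add: e_def cosh_def exp_minus)
  have "(ctime has_real_derivative 4 * (inverse (1 + (exp \<tau>)\<^sup>2) * exp \<tau>)) (at \<tau>)"
    unfolding ctime_def by (auto intro!: derivative_eq_intros)
  also have "4 * (inverse (1 + (exp \<tau>)\<^sup>2) * exp \<tau>) = 2 / cosh \<tau>"
    unfolding e(2) e_def[symmetric] using e(1)
    by (simp add: divide_simps power2_eq_square add_pos_pos pos_add_strict)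
  finally show ?thesis .
qed

lemma ctime_less_iff [simp]: "ctime a < ctime b \<longleftrightarrow> a < b"
  and ctime_le_iff [simp]: "ctime a \<le> ctime b \<longleftrightarrow> a \<le> b"
  and ctime_eq_iff [simp]: "ctime a = ctime b \<longleftrightarrow> a = b"
  by (simp_all add: ctime_def arctan_less_iff arctan_le_iff arctan_eq_iff)

lemma ctime_bounds: "0 < ctime \<tau>" "ctime \<tau> < 2 * pi"
  using arctan_bounded[of "exp \<tau>"] by (auto simp: ctime_def)

lemma continuous_on_ctime [continuous_intros]:
  "continuous_on S f \<Longrightarrow> continuous_on S (\<lambda>x. ctime (f x))"
  unfolding ctime_def by (intro continuous_intros)

text \<open>The causal order of the flat strip with coordinates \<phi> and \<eta>, pushed down to
  the cylinder: some lifts of the two events have to be related.\<close>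

definition reach :: "(nat \<Rightarrow> real) \<Rightarrow> (nat \<Rightarrow> real) \<Rightarrow> bool" where
  "reach p q \<longleftrightarrow> (\<exists>\<tau>\<^sub>1 \<phi>\<^sub>1 \<tau>\<^sub>2 \<phi>\<^sub>2. p = polar \<tau>\<^sub>1 \<phi>\<^sub>1 \<and> q = polar \<tau>\<^sub>2 \<phi>\<^sub>2 \<and>
     \<bar>\<phi>\<^sub>2 - \<phi>\<^sub>1\<bar> \<le> ctime \<tau>\<^sub>2 - ctime \<tau>\<^sub>1)"

text \<open>Shifting both angles by the same multiple of 2 pi preserves the inequality, so the lift
  of one end may be prescribed. Transitivity is thereby reduced to the triangle inequality.\<close>

lemma reach_from_polar:
  "reach (polar \<tau> \<phi>) q \<longleftrightarrow> (\<exists>\<tau>' \<phi>'. q = polar \<tau>' \<phi>' \<and> \<bar>\<phi>' - \<phi>\<bar> \<le> ctime \<tau>' - ctime \<tau>)"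
proof
  assume "reach (polar \<tau> \<phi>) q"
  then obtain \<tau>1 \<phi>1 \<tau>2 \<phi>2 where *: "polar \<tau> \<phi> = polar \<tau>1 \<phi>1" "q = polar \<tau>2 \<phi>2"
    "\<bar>\<phi>2 - \<phi>1\<bar> \<le> ctime \<tau>2 - ctime \<tau>1"
    unfolding reach_def by blast
  then obtain n :: int where n: "\<tau> = \<tau>1" "\<phi> = \<phi>1 + 2 * pi * n"
    by (auto simp: polar_eq_iff)
  have "q = polar \<tau>2 (\<phi>2 + 2 * pi * n)"
    unfolding *(2) polar_eq_iff by (auto intro!: exI[of _ "-n"])
  then show "\<exists>\<tau>' \<phi>'. q = polar \<tau>' \<phi>' \<and> \<bar>\<phi>' - \<phi>\<bar> \<le> ctime \<tau>' - ctime \<tau>"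
    using *(3) n by force
qed (auto simp: reach_def)

lemma reach_to_polar:
  "reach p (polar \<tau> \<phi>) \<longleftrightarrow> (\<exists>\<tau>' \<phi>'. p = polar \<tau>' \<phi>' \<and> \<bar>\<phi> - \<phi>'\<bar> \<le> ctime \<tau> - ctime \<tau>')"
proof
  assume "reach p (polar \<tau> \<phi>)"
  then obtain \<tau>1 \<phi>1 \<tau>2 \<phi>2 where *: "p = polar \<tau>1 \<phi>1" "polar \<tau> \<phi> = polar \<tau>2 \<phi>2"
    "\<bar>\<phi>2 - \<phi>1\<bar> \<le> ctime \<tau>2 - ctime \<tau>1"
    unfolding reach_def by blast
  then obtain n :: int where n: "\<tau> = \<tau>2" "\<phi> = \<phi>2 + 2 * pi * n"
    by (auto simp: polar_eq_iff)
  have "p = polar \<tau>1 (\<phi>1 + 2 * pi * n)"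
    unfolding *(1) polar_eq_iff by (auto intro!: exI[of _ "-n"])
  then show "\<exists>\<tau>' \<phi>'. p = polar \<tau>' \<phi>' \<and> \<bar>\<phi> - \<phi>'\<bar> \<le> ctime \<tau> - ctime \<tau>'"
    using *(3) n by force
qed (auto simp: reach_def)

lemma reach_refl: "p \<in> plane0 \<Longrightarrow> reach p p"
  by (erule plane0_polar) (force simp: reach_def)

lemma reach_trans: "reach p q \<Longrightarrow> reach q r \<Longrightarrow> reach p r"
proof -
  assume "reach p q" and qr: "reach q r"
  then obtain \<tau>1 \<phi>1 \<tau>2 \<phi>2 where *: "p = polar \<tau>1 \<phi>1" "q = polar \<tau>2 \<phi>2"
    "\<bar>\<phi>2 - \<phi>1\<bar> \<le> ctime \<tau>2 - ctime \<tau>1"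
    unfolding reach_def by blast
  obtain \<tau>3 \<phi>3 where "r = polar \<tau>3 \<phi>3" "\<bar>\<phi>3 - \<phi>2\<bar> \<le> ctime \<tau>3 - ctime \<tau>2"
    using qr unfolding *(2) reach_from_polar by blast
  then show ?thesis
    unfolding *(1) reach_from_polar using *(3) by (intro exI[of _ \<tau>3] exI[of _ \<phi>3]) auto
qed

context polar_curve begin

lemma causal_velocity_bound:
  assumes "t \<in> I" "nonspacelike_at dS \<gamma> t"
  shows "\<bar>deriv \<phi> t\<bar> \<le> \<bar>2 / cosh (\<tau> t) * deriv \<tau> t\<bar>"
proof -
  have c: "cosh (\<tau> t) > 0" by simp
  have "(cosh (\<tau> t))\<^sup>2 / 4 * (deriv \<phi> t)\<^sup>2 \<le> (deriv \<tau> t)\<^sup>2"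
    using assms g_velocity[OF assms(1)] by (simp add: nonspacelike_at_def)
  then have "(cosh (\<tau> t) / 2 * deriv \<phi> t)\<^sup>2 \<le> (deriv \<tau> t)\<^sup>2"
    by (simp add: power_mult_distrib power_divide)
  then have "\<bar>cosh (\<tau> t) / 2 * deriv \<phi> t\<bar> \<le> \<bar>deriv \<tau> t\<bar>"
    by (simp only: abs_le_square_iff)
  then show ?thesis
    using c by (simp add: abs_mult field_simps)
qed

text \<open>The bound on the velocities says that both \<epsilon> \<eta> - \<phi> and \<epsilon>
  \<eta> + \<phi> are nondecreasing. The sign \<epsilon> is 1 for future-directed and -1 for
  past-directed curves.\<close>

lemma causal_monotone:
  assumes sub: "{s..t} \<subseteq> I" and st: "s \<le> t"
    and b: "\<And>r. r \<in> {s..t} \<Longrightarrow> \<bar>deriv \<phi> r\<bar> \<le> \<epsilon> * (2 / cosh (\<tau> r) * deriv \<tau> r)"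
  shows "\<bar>\<phi> t - \<phi> s\<bar> \<le> \<epsilon> * (ctime (\<tau> t) - ctime (\<tau> s))"
proof -
  have d: "((\<lambda>r. ctime (\<tau> r)) has_real_derivative 2 / cosh (\<tau> r) * deriv \<tau> r) (at r)"
    "(\<phi> has_real_derivative deriv \<phi> r) (at r)"
    if "r \<in> {s..t}" for r
    using that sub DERIV_chain2[OF ctime_deriv smooth_fn_D[OF smooth(1), of r]] smooth_fn_D[OF smooth(2), of r]
    by blast+
  have "\<epsilon> * ctime (\<tau> s) - \<phi> s \<le> \<epsilon> * ctime (\<tau> t) - \<phi> t"
  proof (rule DERIV_nonneg_imp_nondecreasing[OF st])
    fix r assume "s \<le> r" "r \<le> t"
    then have r: "r \<in> {s..t}" by simp
    show "\<exists>y. ((\<lambda>r. \<epsilon> * ctime (\<tau> r) - \<phi> r) has_real_derivative y) (at r) \<and> 0 \<le> y"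
      using DERIV_diff[OF DERIV_cmult[OF d(1)[OF r]] d(2)[OF r], of \<epsilon>] b[OF r]
      by (intro exI conjI) auto
  qed
  moreover have "\<epsilon> * ctime (\<tau> s) + \<phi> s \<le> \<epsilon> * ctime (\<tau> t) + \<phi> t"
  proof (rule DERIV_nonneg_imp_nondecreasing[OF st])
    fix r assume "s \<le> r" "r \<le> t"
    then have r: "r \<in> {s..t}" by simp
    show "\<exists>y. ((\<lambda>r. \<epsilon> * ctime (\<tau> r) + \<phi> r) has_real_derivative y) (at r) \<and> 0 \<le> y"
      using DERIV_add[OF DERIV_cmult[OF d(1)[OF r]] d(2)[OF r], of \<epsilon>] b[OF r]
      by (intro exI conjI) auto
  qed
  ultimately show ?thesis by (auto simp: abs_le_iff algebra_simps)
qed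

lemma future_reach:
  assumes "{s..t} \<subseteq> I" "s \<le> t"
    and "\<And>r. r \<in> {s..t} \<Longrightarrow> nonspacelike_at dS \<gamma> r \<and> future_directed_at dS \<gamma> r"
  shows "reach (\<gamma> s) (\<gamma> t)"
proof -
  have "\<bar>\<phi> t - \<phi> s\<bar> \<le> 1 * (ctime (\<tau> t) - ctime (\<tau> s))"
  proof (rule causal_monotone[OF assms(1,2)])
    fix r assume r: "r \<in> {s..t}"
    then have rI: "r \<in> I" and c: "nonspacelike_at dS \<gamma> r" "future_directed_at dS \<gamma> r"
      using assms(1,3) by auto
    have "deriv \<tau> r > 0"
      using c(2) g_time[OF rI, of dS_chart] rI by (simp add: future_directed_at_def)
    then show "\<bar>deriv \<phi> r\<bar> \<le> 1 * (2 / cosh (\<tau> r) * deriv \<tau> r)"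
      using causal_velocity_bound[OF rI c(1)] by auto
  qed
  moreover have "s \<in> I" "t \<in> I" using assms by auto
  ultimately show ?thesis unfolding reach_def mult_1 using \<gamma> by blast
qed

lemma past_reach:
  assumes "{s..t} \<subseteq> I" "s \<le> t"
    and "\<And>r. r \<in> {s..t} \<Longrightarrow> nonspacelike_at dS \<gamma> r \<and> past_directed_at dS \<gamma> r"
  shows "reach (\<gamma> t) (\<gamma> s)"
proof -
  have "\<bar>\<phi> t - \<phi> s\<bar> \<le> (-1) * (ctime (\<tau> t) - ctime (\<tau> s))"
  proof (rule causal_monotone[OF assms(1,2)])
    fix r assume r: "r \<in> {s..t}"
    then have rI: "r \<in> I" and c: "nonspacelike_at dS \<gamma> r" "past_directed_at dS \<gamma> r"
      using assms(1,3) by auto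
    have "deriv \<tau> r < 0"
      using c(2) g_time[OF rI, of dS_chart] rI by (simp add: past_directed_at_def)
    then have "2 / cosh (\<tau> r) * deriv \<tau> r < 0"
      by (simp add: mult_pos_neg divide_neg_pos)
    then show "\<bar>deriv \<phi> r\<bar> \<le> (-1) * (2 / cosh (\<tau> r) * deriv \<tau> r)"
      using causal_velocity_bound[OF rI c(1)] by auto
  qed
  then have "\<bar>\<phi> s - \<phi> t\<bar> \<le> ctime (\<tau> s) - ctime (\<tau> t)"
    by (simp add: abs_minus_commute)
  moreover have "s \<in> I" "t \<in> I" using assms by auto
  ultimately show ?thesis unfolding reach_def using \<gamma> by blast
qed

end

text \<open>A reflexive and transitive relation that holds along smooth pieces holds along the whole
  curve, by induction on the number of pieces. It is applied to \<open>reach\<close> and to its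
  converse, for future- and past-directed curves.\<close>

lemma piecewise_smooth_relation:
  assumes pw: "piecewise_smooth_with M P a b \<gamma>"
    and refl: "\<And>p. p \<in> topspace (events M) \<Longrightarrow> R p p"
    and trans: "\<And>p q r. R p q \<Longrightarrow> R q r \<Longrightarrow> R p r"
    and piece: "\<And>J \<sigma> s t. smooth_curve M J \<sigma> \<Longrightarrow> {s..t} \<subseteq> J \<Longrightarrow> s \<le> t \<Longrightarrow>
        (\<And>r. r \<in> {s..t} \<Longrightarrow> P \<sigma> r) \<Longrightarrow> R (\<sigma> s) (\<sigma> t)"
    and st: "a \<le> s" "s \<le> t" "t \<le> b"
  shows "R (\<gamma> s) (\<gamma> t)"
proof -
  obtain m :: nat and \<tau> :: "nat \<Rightarrow> real" where \<tau>: "\<tau> 0 = a" "\<tau> m = b" "\<And>k. k < m \<Longrightarrow> \<tau> k < \<tau> (Suc k)"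
    and pc: "\<And>k. k < m \<Longrightarrow> \<exists>J \<sigma>. smooth_curve M J \<sigma> \<and> {\<tau> k..\<tau> (Suc k)} \<subseteq> J \<and>
           (\<forall>t\<in>{\<tau> k..\<tau> (Suc k)}. \<sigma> t = \<gamma> t \<and> P \<sigma> t)"
    using pw unfolding piecewise_smooth_with_def by blast
  have ab: "a < b" and cont: "continuous_map (top_of_set {a..b}) (events M) \<gamma>"
    using pw by (auto simp: piecewise_smooth_with_def)
  have step: "R (\<gamma> s) (\<gamma> t)" if k: "k < m" and st: "\<tau> k \<le> s" "s \<le> t" "t \<le> \<tau> (Suc k)" for k s t
  proof -
    obtain J \<sigma> where J: "smooth_curve M J \<sigma>" "{\<tau> k..\<tau> (Suc k)} \<subseteq> J"
      "\<And>t. t \<in> {\<tau> k..\<tau> (Suc k)} \<Longrightarrow> \<sigma> t = \<gamma> t \<and> P \<sigma> t"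
      using pc[OF k] by blast
    have "{s..t} \<subseteq> {\<tau> k..\<tau> (Suc k)}" using st by auto
    then have "R (\<sigma> s) (\<sigma> t)"
      using J st by (intro piece[OF J(1)]) auto
    then show ?thesis using J(3)[of s] J(3)[of t] st by auto
  qed
  have "k \<le> m \<Longrightarrow> a \<le> s \<Longrightarrow> s \<le> t \<Longrightarrow> t \<le> \<tau> k \<Longrightarrow> R (\<gamma> s) (\<gamma> t)" for k s t
  proof (induction k arbitrary: s t)
    case 0
    then have "s = a" "t = a" using \<tau>(1) by auto
    moreover have "\<gamma> a \<in> topspace (events M)"
      using continuous_map_image_subset_topspace[OF cont] ab by auto
    ultimately show ?case using refl by simp
  next
    case (Suc k)
    then have k: "k < m" by simp
    consider "t \<le> \<tau> k" | "\<tau> k \<le> s" | "s \<le> \<tau> k" "\<tau> k \<le> t" by linarith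
    then show ?case
    proof cases
      case 1
      then show ?thesis using Suc by auto
    next
      case 2
      then show ?thesis using step[OF k] Suc.prems by auto
    next
      case 3
      then have "R (\<gamma> s) (\<gamma> (\<tau> k))" "R (\<gamma> (\<tau> k)) (\<gamma> t)"
        using step[OF k, of "\<tau> k" t] Suc by auto
      then show ?thesis by (rule trans)
    qed
  qed
  from this[of m s t] show ?thesis using st \<tau>(2) by simp
qed

lemma future_curve_reach:
  assumes "future_nonspacelike_curve dS a b \<gamma>" "a \<le> s" "s \<le> t" "t \<le> b"
  shows "reach (\<gamma> s) (\<gamma> t)"
proof (rule piecewise_smooth_relation[OF assms(1)[unfolded future_nonspacelike_curve_def] _ _ _ assms(2-4)])
  fix J \<sigma> and s t :: real assume "smooth_curve dS J \<sigma>" and *: "{s..t} \<subseteq> J" "s \<le> t"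
    "\<And>r. r \<in> {s..t} \<Longrightarrow> nonspacelike_at dS \<sigma> r \<and> future_directed_at dS \<sigma> r"
  then obtain \<tau> \<phi> where "polar_curve J \<tau> \<phi> \<sigma>" using polar_lift by blast
  then show "reach (\<sigma> s) (\<sigma> t)" by (rule polar_curve.future_reach[OF _ *])
qed (auto intro: reach_refl reach_trans)

lemma past_curve_reach:
  assumes "past_nonspacelike_curve dS a b \<gamma>" "a \<le> s" "s \<le> t" "t \<le> b"
  shows "reach (\<gamma> t) (\<gamma> s)"
proof (rule piecewise_smooth_relation[OF assms(1)[unfolded past_nonspacelike_curve_def],
      where R = "\<lambda>p q. reach q p", OF _ _ _ assms(2-4)])
  fix J \<sigma> and s t :: real assume "smooth_curve dS J \<sigma>" and *: "{s..t} \<subseteq> J" "s \<le> t"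
    "\<And>r. r \<in> {s..t} \<Longrightarrow> nonspacelike_at dS \<sigma> r \<and> past_directed_at dS \<sigma> r"
  then obtain \<tau> \<phi> where "polar_curve J \<tau> \<phi> \<sigma>" using polar_lift by blast
  then show "reach (\<sigma> t) (\<sigma> s)" by (rule polar_curve.past_reach[OF _ *])
qed (auto intro: reach_refl reach_trans)

text \<open>Two related lifts are joined by a straight segment in the strip, which is causal because
  its slope is at most one in absolute value.\<close>

lemma reach_imp_causal_le:
  assumes "reach p q" shows "causal_le dS p q"
proof -
  obtain \<tau>1 \<phi>1 \<tau>2 \<phi>2 where pq: "p = polar \<tau>1 \<phi>1" "q = polar \<tau>2 \<phi>2"
    "\<bar>\<phi>2 - \<phi>1\<bar> \<le> ctime \<tau>2 - ctime \<tau>1"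
    using assms unfolding reach_def by blast
  have top: "p \<in> plane0" "q \<in> plane0" by (simp_all add: pq)
  show ?thesis
  proof (cases "\<tau>1 = \<tau>2")
    case True
    then have "p = q" using pq by simp
    then show ?thesis using top by (simp add: causal_le_def)
  next
    case False
    moreover have "ctime \<tau>1 \<le> ctime \<tau>2" using pq(3) by linarith
    ultimately have less: "\<tau>1 < \<tau>2" by simp
    then have D: "ctime \<tau>2 - ctime \<tau>1 > 0" by simp
    define k where "k = (\<phi>2 - \<phi>1) / (ctime \<tau>2 - ctime \<tau>1)"
    have k: "\<bar>k\<bar> \<le> 1" "k * (ctime \<tau>2 - ctime \<tau>1) = \<phi>2 - \<phi>1"
      using pq(3) D by (auto simp: k_def abs_divide)
    \<comment> \<open>The angle is affine in conformal time with slope \<open>k\<close>. The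
      parameter is t = sinh \<tau>, so the segment belongs to a smooth curve on the whole line and
      forms a single piece.\<close>
    define \<phi> where "\<phi> t = \<phi>1 + k * (ctime (arsinh t) - ctime \<tau>1)" for t
    define \<gamma> where "\<gamma> t = polar (arsinh t) (\<phi> t)" for t
    have sm: "smooth_fn UNIV arsinh"
      by (intro smooth_fn_arsinh smooth_fn_ident open_UNIV)
    have "smooth_fn UNIV \<phi>"
      unfolding \<phi>_def[abs_def] ctime_def
      by (intro smooth_fn_add smooth_fn_mult smooth_fn_diff smooth_fn_const smooth_fn_arctan smooth_fn_exp
          sm open_UNIV)
    then interpret polar_curve UNIV arsinh \<phi> \<gamma>
      using sm by unfold_locales (auto simp: open_interval_UNIV \<gamma>_def)
    have causal: "nonspacelike_at dS \<gamma> t \<and> future_directed_at dS \<gamma> t" for t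
    proof -
      have d: "(arsinh has_real_derivative 1 / sqrt (t\<^sup>2 + 1)) (at t)"
        by (rule arsinh_real_has_field_derivative)
      define w where "w = deriv arsinh t"
      have w: "w > 0" "(arsinh has_real_derivative w) (at t)"
        using d DERIV_imp_deriv[OF d] by (auto simp: w_def add_nonneg_pos)
      have "(\<phi> has_real_derivative k * (2 / cosh (arsinh t) * w)) (at t)"
        unfolding \<phi>_def[abs_def]
        using DERIV_chain2[OF ctime_deriv w(2)] by (auto intro!: derivative_eq_intros)
      then have d\<phi>: "deriv \<phi> t = k * (2 / cosh (arsinh t) * w)" by (rule DERIV_imp_deriv)
      have "(cosh (arsinh t))\<^sup>2 / 4 * (deriv \<phi> t)\<^sup>2 = k\<^sup>2 * w\<^sup>2"
        unfolding d\<phi> by (simp add: power_mult_distrib power_divide)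
      also have "\<dots> \<le> 1 * w\<^sup>2"
        using k(1) by (intro mult_right_mono) (auto simp: abs_square_le_1)
      finally have "g_at dS dS_chart (\<gamma> t) (velocity dS_chart \<gamma> t) (velocity dS_chart \<gamma> t) \<le> 0"
        unfolding g_velocity[OF UNIV_I] w_def by simp
      moreover have "\<exists>i<2. velocity dS_chart \<gamma> t i \<noteq> 0"
        unfolding velocity_nonzero[OF UNIV_I] using w(1) by (simp add: w_def)
      moreover have "g_at dS dS_chart (\<gamma> t) (\<gamma> t) (velocity dS_chart \<gamma> t) < 0"
        unfolding g_time[OF UNIV_I] using w(1) by (simp add: w_def)
      ultimately show ?thesis by (simp add: nonspacelike_at_def future_directed_at_def)
    qed
    have lt: "sinh \<tau>1 < sinh \<tau>2" using less by simp
    have cm: "continuous_map (top_of_set UNIV) (events dS) \<gamma>"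
      using smooth_curve unfolding smooth_curve_def by blast
    have "future_nonspacelike_curve dS (sinh \<tau>1) (sinh \<tau>2) \<gamma>"
      unfolding future_nonspacelike_curve_def piecewise_smooth_with_def
    proof (intro conjI exI[of _ "1::nat"] exI[of _ "\<lambda>k::nat. if k = 0 then sinh \<tau>1 else sinh \<tau>2"])
      show "continuous_map (top_of_set {sinh \<tau>1..sinh \<tau>2}) (events dS) \<gamma>"
        using cm continuous_map_from_subtopology by force
      show "\<forall>k<1. \<exists>J \<sigma>. smooth_curve dS J \<sigma> \<and>
         {(if k = 0 then sinh \<tau>1 else sinh \<tau>2)..(if Suc k = 0 then sinh \<tau>1 else sinh \<tau>2)} \<subseteq> J \<and>
         (\<forall>t\<in>{(if k = 0 then sinh \<tau>1 else sinh \<tau>2)..(if Suc k = 0 then sinh \<tau>1 else sinh \<tau>2)}.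
            \<sigma> t = \<gamma> t \<and> nonspacelike_at dS \<sigma> t \<and> future_directed_at dS \<sigma> t)"
        using smooth_curve causal by (intro allI impI exI[of _ UNIV] exI[of _ \<gamma>]) auto
    qed (use lt in auto)
    moreover have "\<gamma> (sinh \<tau>1) = p" "\<gamma> (sinh \<tau>2) = q"
      using k(2) by (simp_all add: \<gamma>_def \<phi>_def pq arsinh_sinh_real)
    ultimately show ?thesis
      unfolding causal_le_def using top by auto
  qed
qed

lemma causal_le_dS: "causal_le dS p q \<longleftrightarrow> reach p q"
proof
  assume c: "causal_le dS p q"
  show "reach p q"
  proof (cases "p = q")
    case True
    then show ?thesis using c by (simp add: causal_le_def reach_refl)
  next
    case False
    then obtain a b \<gamma> where *: "future_nonspacelike_curve dS a b \<gamma>" "\<gamma> a = p" "\<gamma> b = q"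
      using c by (auto simp: causal_le_def)
    then have "a < b" by (simp add: future_nonspacelike_curve_def piecewise_smooth_with_def)
    then show ?thesis using future_curve_reach[OF *(1), of a b] * by simp
  qed
qed (rule reach_imp_causal_le)

section \<open>Strong causality and global hyperbolicity\<close>

text \<open>Under the identification with the complex plane, \<open>polar\<close> is the exponential
  function, a covering of the punctured plane and therefore an open map.\<close>

lemma openin_polar_image:
  assumes "open N"
  shows "openin (top_of_set plane0) ((\<lambda>z. polar (fst z) (snd z)) ` N)"
proof -
  define N' where "N' = (\<lambda>z. (Re z, Im z)) -` N"
  have "open N'"
    unfolding N'_def by (intro open_vimage assms continuous_intros)
  then have "openin (top_of_set (- {0})) (exp ` N')"
    using covering_space_open_map[OF covering_space_exp_punctured_plane, of N'] by simp
  then have op: "open (exp ` N')"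
    using openin_open_trans[of "- {0}" "exp ` N'"] by (simp add: open_Compl)
  define C where "C p = Complex (p 0) (p 1)" for p :: "nat \<Rightarrow> real"
  have "continuous_on UNIV C"
    unfolding C_def Complex_eq by (intro continuous_intros)
  then have "open (C -` exp ` N')"
    using op by (intro open_vimage)
  moreover have "(\<lambda>z. polar (fst z) (snd z)) ` N = plane0 \<inter> C -` exp ` N'"
  proof -
    have C: "C (polar \<tau> \<phi>) = exp (Complex \<tau> \<phi>)" for \<tau> \<phi>
      by (simp add: C_def complex_eq_iff Re_exp Im_exp)
    have "p \<in> (\<lambda>z. polar (fst z) (snd z)) ` N" if "p \<in> plane0" "C p = exp z" "z \<in> N'" for p z
    proof -
      have "C (polar (Re z) (Im z)) = C p" by (simp add: C that)
      then have "p = polar (Re z) (Im z)"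
        using that(1) by (intro plane0_eqI) (auto simp: C_def)
      moreover have "(Re z, Im z) \<in> N" using that(3) by (simp add: N'_def)
      ultimately show ?thesis by force
    qed
    moreover have "C (polar \<tau> \<phi>) \<in> exp ` N'" if "(\<tau>, \<phi>) \<in> N" for \<tau> \<phi>
      using that C[of \<tau> \<phi>] by (auto simp: N'_def)
    ultimately show ?thesis by fastforce
  qed
  ultimately show ?thesis by (auto simp: openin_open)
qed

text \<open>
  The intersection of the chronological future of one event with the past of another.
\<close>

definition diamond :: "real \<Rightarrow> real \<Rightarrow> real \<Rightarrow> (nat \<Rightarrow> real) set" where
  "diamond \<tau> \<phi> \<epsilon> = (\<lambda>z. polar (fst z) (snd z)) ` {z. \<bar>snd z - \<phi>\<bar> + \<bar>ctime (fst z) - ctime \<tau>\<bar> < \<epsilon>}"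

lemma diamondI:
  "\<bar>f - \<phi>\<bar> + \<bar>ctime t - ctime \<tau>\<bar> < \<epsilon> \<Longrightarrow> polar t f \<in> diamond \<tau> \<phi> \<epsilon>"
  unfolding diamond_def by (rule image_eqI[of _ _ "(t, f)"]) simp_all

lemma openin_diamond: "openin (top_of_set plane0) (diamond \<tau> \<phi> \<epsilon>)"
  unfolding diamond_def
  by (intro openin_polar_image open_Collect_less continuous_intros)

lemma polar_in_diamond: "\<epsilon> > 0 \<Longrightarrow> polar \<tau> \<phi> \<in> diamond \<tau> \<phi> \<epsilon>"
  by (rule diamondI) simp

lemma diamond_basis:
  assumes "openin (top_of_set plane0) W" "polar \<tau> \<phi> \<in> W"
  obtains \<epsilon> where "\<epsilon> > 0" "diamond \<tau> \<phi> \<epsilon> \<subseteq> W"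
proof -
  obtain T where T: "open T" "W = plane0 \<inter> T"
    using assms(1) by (auto simp: openin_open)
  have "open ((\<lambda>z. polar (fst z) (snd z)) -` T)"
    by (intro open_vimage T continuous_on_polar continuous_intros)
  moreover have "(\<tau>, \<phi>) \<in> (\<lambda>z. polar (fst z) (snd z)) -` T"
    using assms(2) T by simp
  ultimately obtain A B where AB: "open A" "open B" "\<tau> \<in> A" "\<phi> \<in> B" "A \<times> B \<subseteq> (\<lambda>z. polar (fst z) (snd z)) -` T"
    by (rule open_prod_elim) auto
  obtain d where d: "d > 0" "\<And>t. \<bar>t - \<tau>\<bar> < d \<Longrightarrow> t \<in> A"
    using AB(1,3) by (auto simp: open_dist dist_real_def)
  obtain e where e: "e > 0" and B: "\<And>t. \<bar>t - \<phi>\<bar> < e \<Longrightarrow> t \<in> B"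
    using AB(2,4) by (auto simp: open_dist dist_real_def)
  \<comment> \<open>\<open>ctime\<close> is strictly increasing, so closeness of conformal times
    within these two differences forces \<open>t\<close> into the interval of radius
    \<open>d\<close> around \<tau>.\<close>
  define \<epsilon> where "\<epsilon> = min e (min (ctime (\<tau> + d) - ctime \<tau>) (ctime \<tau> - ctime (\<tau> - d)))"
  have "\<epsilon> > 0" using d e by (simp add: \<epsilon>_def)
  moreover have "polar t f \<in> W" if *: "\<bar>f - \<phi>\<bar> + \<bar>ctime t - ctime \<tau>\<bar> < \<epsilon>" for t f
  proof -
    have e: "\<bar>f - \<phi>\<bar> + \<bar>ctime t - ctime \<tau>\<bar> < e"
      "\<bar>f - \<phi>\<bar> + \<bar>ctime t - ctime \<tau>\<bar> < ctime (\<tau> + d) - ctime \<tau>"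
      "\<bar>f - \<phi>\<bar> + \<bar>ctime t - ctime \<tau>\<bar> < ctime \<tau> - ctime (\<tau> - d)"
      using * by (simp_all add: \<epsilon>_def)
    have "\<bar>f - \<phi>\<bar> < e" using e(1) by linarith
    moreover have "ctime t < ctime (\<tau> + d)" "ctime (\<tau> - d) < ctime t"
      using e(2,3) by linarith+
    then have "\<bar>t - \<tau>\<bar> < d" by simp
    ultimately have "(t, f) \<in> A \<times> B" using d(2) B by blast
    then show ?thesis using AB(5) T(2) by auto
  qed
  ultimately show thesis
    by (intro that[of \<epsilon>]) (auto simp: diamond_def)
qed

text \<open>The lifts of \<open>q\<close> obtained from \<open>p\<close> and from \<open>r\<close>
  may differ by a multiple of 2 pi, but they have the same time. If \<open>q\<close> is not later
  than the centre, the lift coming from \<open>p\<close> lies in the diamond, otherwise the one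
  coming from \<open>r\<close>; the two angles never have to be compared.\<close>

lemma diamond_convex:
  assumes "reach p q" "reach q r" "p \<in> diamond \<tau> \<phi> \<epsilon>" "r \<in> diamond \<tau> \<phi> \<epsilon>"
  shows "q \<in> diamond \<tau> \<phi> \<epsilon>"
proof -
  obtain \<tau>p \<phi>p where p: "p = polar \<tau>p \<phi>p" "\<bar>\<phi>p - \<phi>\<bar> + \<bar>ctime \<tau>p - ctime \<tau>\<bar> < \<epsilon>"
    using assms(3) by (auto simp: diamond_def)
  obtain \<tau>r \<phi>r where r: "r = polar \<tau>r \<phi>r" "\<bar>\<phi>r - \<phi>\<bar> + \<bar>ctime \<tau>r - ctime \<tau>\<bar> < \<epsilon>"
    using assms(4) by (auto simp: diamond_def)
  obtain \<tau>q \<phi>q where q: "q = polar \<tau>q \<phi>q" "\<bar>\<phi>q - \<phi>p\<bar> \<le> ctime \<tau>q - ctime \<tau>p"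
    using assms(1) unfolding p(1) reach_from_polar by blast
  obtain \<tau>q' \<phi>q' where q': "q = polar \<tau>q' \<phi>q'" "\<bar>\<phi>r - \<phi>q'\<bar> \<le> ctime \<tau>r - ctime \<tau>q'"
    using assms(2) unfolding r(1) reach_to_polar by blast
  have eq: "\<tau>q' = \<tau>q" using q(1) q'(1) by (simp add: polar_eq_iff)
  have "\<bar>\<phi>q - \<phi>\<bar> + \<bar>ctime \<tau>q - ctime \<tau>\<bar> < \<epsilon> \<or> \<bar>\<phi>q' - \<phi>\<bar> + \<bar>ctime \<tau>q - ctime \<tau>\<bar> < \<epsilon>"
    using p(2) r(2) q(2) q'(2) unfolding eq by linarith
  then show ?thesis
    using diamondI q(1) q'(1) eq by metis
qed

lemma causally_convex_diamond: "causally_convex dS (diamond \<tau> \<phi> \<epsilon>)"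
  unfolding causally_convex_def
proof (intro conjI allI impI)
  show "openin (events dS) (diamond \<tau> \<phi> \<epsilon>)"
    using openin_diamond by simp
  fix a b \<gamma> assume c: "nonspacelike_curve dS a b \<gamma>"
  \<comment> \<open>By \<open>diamond_convex\<close> the parameters at which the curve is in the
    diamond form an interval, and the intersection in question is its continuous image.\<close>
  define K where "K = {t \<in> {a..b}. \<gamma> t \<in> diamond \<tau> \<phi> \<epsilon>}"
  have cont: "continuous_map (top_of_set {a..b}) (top_of_set plane0) \<gamma>"
    using c by (auto simp: nonspacelike_curve_def future_nonspacelike_curve_def past_nonspacelike_curve_def
        piecewise_smooth_with_def)
  have "is_interval K"
    unfolding is_interval_1
  proof (intro ballI allI impI, elim conjE)
    fix s t r assume st: "s \<in> K" "t \<in> K" "s \<le> r" "r \<le> t"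
    then have ab: "a \<le> s" "t \<le> b" and U: "\<gamma> s \<in> diamond \<tau> \<phi> \<epsilon>" "\<gamma> t \<in> diamond \<tau> \<phi> \<epsilon>"
      by (auto simp: K_def)
    have "\<gamma> r \<in> diamond \<tau> \<phi> \<epsilon>"
      using c unfolding nonspacelike_curve_def
    proof
      assume f: "future_nonspacelike_curve dS a b \<gamma>"
      show ?thesis
        by (rule diamond_convex[OF future_curve_reach[OF f] future_curve_reach[OF f] U]) (use st ab in auto)
    next
      assume f: "past_nonspacelike_curve dS a b \<gamma>"
      show ?thesis
        by (rule diamond_convex[OF past_curve_reach[OF f] past_curve_reach[OF f] U(2,1)]) (use st ab in auto)
    qed
    then show "r \<in> K" using st by (auto simp: K_def)
  qed
  then have "connected K" by (simp add: is_interval_connected)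
  moreover have "continuous_on K \<gamma>"
    using cont by (auto simp: K_def intro: continuous_on_subset)
  ultimately have "connected (\<gamma> ` K)" by (rule connected_continuous_image[rotated])
  moreover have "\<gamma> ` {a..b} \<inter> diamond \<tau> \<phi> \<epsilon> = \<gamma> ` K" by (auto simp: K_def)
  moreover have "diamond \<tau> \<phi> \<epsilon> \<subseteq> plane0" by (auto simp: diamond_def)
  ultimately show "connectedin (events dS) (\<gamma> ` {a..b} \<inter> diamond \<tau> \<phi> \<epsilon>)"
    by (auto simp: connectedin_subtopology)
qed

lemma strongly_causal_dS: "strongly_causal dS"
  unfolding strongly_causal_def
proof (intro ballI allI impI, elim conjE)
  fix p W assume p: "p \<in> topspace (events dS)" and W: "openin (events dS) W" "p \<in> W"
  then obtain \<tau> \<phi> where pol: "p = polar \<tau> \<phi>" using plane0_polar by auto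
  obtain \<epsilon> where "\<epsilon> > 0" "diamond \<tau> \<phi> \<epsilon> \<subseteq> W"
    by (rule diamond_basis[of W \<tau> \<phi>]) (use W pol in auto)
  then show "\<exists>U. causally_convex dS U \<and> p \<in> U \<and> U \<subseteq> W"
    using causally_convex_diamond polar_in_diamond pol by blast
qed

lemma compact_polar_image:
  assumes "closed S" "S \<subseteq> {a..b} \<times> {c..d}"
  shows "compact ((\<lambda>z. polar (fst z) (snd z)) ` S)"
proof (rule compact_continuous_image)
  show "continuous_on S (\<lambda>z. polar (fst z) (snd z))"
    by (intro continuous_on_polar continuous_intros)
  have "compact ({a..b} \<times> {c..d} \<inter> S)"
    by (intro compact_Int_closed compact_Times compact_Icc assms)
  then show "compact S" using assms(2) by (simp add: Int_absorb1)
qed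

lemma globally_hyperbolic_dS: "globally_hyperbolic dS"
  unfolding globally_hyperbolic_def
proof (intro conjI strongly_causal_dS ballI)
  fix p q assume pq: "p \<in> topspace (events dS)" "q \<in> topspace (events dS)"
  then obtain \<tau>1 \<phi>1 where p: "p = polar \<tau>1 \<phi>1" using plane0_polar by auto
  obtain \<tau>2 \<phi>2 where q: "q = polar \<tau>2 \<phi>2" using pq plane0_polar by auto
  \<comment> \<open>\<open>A\<close> and \<open>B\<close> are the future of \<open>p\<close> and the
    past of \<open>q\<close> in the strip, cut off at the times of both. Their images are
    intersected, not the sets themselves: an event in between may need one lift for \<open>p\<close>
    and another for \<open>q\<close>. Boundedness of \<open>ctime\<close> confines the angles, hence
    compactness.\<close>
  define A where "A = {z. \<tau>1 \<le> fst z} \<inter> {z. fst z \<le> \<tau>2} \<inter> {z. \<bar>snd z - \<phi>1\<bar> \<le> ctime (fst z) - ctime \<tau>1}"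
  define B where "B = {z. \<tau>1 \<le> fst z} \<inter> {z. fst z \<le> \<tau>2} \<inter> {z. \<bar>\<phi>2 - snd z\<bar> \<le> ctime \<tau>2 - ctime (fst z)}"
  have cl: "closed A" "closed B"
    unfolding A_def B_def by (intro closed_Int closed_Collect_le continuous_intros)+
  have "A \<subseteq> {\<tau>1..\<tau>2} \<times> {\<phi>1 - 2 * pi..\<phi>1 + 2 * pi}" "B \<subseteq> {\<tau>1..\<tau>2} \<times> {\<phi>2 - 2 * pi..\<phi>2 + 2 * pi}"
  proof -
    have c: "ctime s - ctime t < 2 * pi" for s t
      using ctime_bounds(2)[of s] ctime_bounds(1)[of t] by linarith
    have "\<phi>1 - 2 * pi \<le> snd z \<and> snd z \<le> \<phi>1 + 2 * pi" if "\<bar>snd z - \<phi>1\<bar> \<le> ctime (fst z) - ctime \<tau>1"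
      for z using that c[of "fst z" \<tau>1] by linarith
    then show "A \<subseteq> {\<tau>1..\<tau>2} \<times> {\<phi>1 - 2 * pi..\<phi>1 + 2 * pi}" by (auto simp: A_def)
    have "\<phi>2 - 2 * pi \<le> snd z \<and> snd z \<le> \<phi>2 + 2 * pi" if "\<bar>\<phi>2 - snd z\<bar> \<le> ctime \<tau>2 - ctime (fst z)"
      for z using that c[of \<tau>2 "fst z"] by linarith
    then show "B \<subseteq> {\<tau>1..\<tau>2} \<times> {\<phi>2 - 2 * pi..\<phi>2 + 2 * pi}" by (auto simp: B_def)
  qed
  with cl have "compact ((\<lambda>z. polar (fst z) (snd z)) ` A \<inter> (\<lambda>z. polar (fst z) (snd z)) ` B)"
    by (intro compact_Int compact_polar_image)
  moreover have "J_plus dS p \<inter> J_minus dS q = (\<lambda>z. polar (fst z) (snd z)) ` A \<inter> (\<lambda>z. polar (fst z) (snd z)) ` B"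
  proof (intro equalityI subsetI)
    fix r assume "r \<in> J_plus dS p \<inter> J_minus dS q"
    then have "reach p r" "reach r q" by (auto simp: J_plus_def J_minus_def causal_le_dS)
    then obtain \<tau> \<phi> \<tau>' \<phi>' where r: "r = polar \<tau> \<phi>" "\<bar>\<phi> - \<phi>1\<bar> \<le> ctime \<tau> - ctime \<tau>1"
      "r = polar \<tau>' \<phi>'" "\<bar>\<phi>2 - \<phi>'\<bar> \<le> ctime \<tau>2 - ctime \<tau>'"
      unfolding p q reach_from_polar reach_to_polar by blast
    have eq: "\<tau>' = \<tau>" using r(1,3) by (simp add: polar_eq_iff)
    have "ctime \<tau>1 \<le> ctime \<tau>" "ctime \<tau> \<le> ctime \<tau>2"
      using r(2,4) unfolding eq by linarith+
    then have "(\<tau>, \<phi>) \<in> A" "(\<tau>, \<phi>') \<in> B" using r eq by (auto simp: A_def B_def)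
    then show "r \<in> (\<lambda>z. polar (fst z) (snd z)) ` A \<inter> (\<lambda>z. polar (fst z) (snd z)) ` B"
      using r(1,3) eq by force
  next
    fix r assume "r \<in> (\<lambda>z. polar (fst z) (snd z)) ` A \<inter> (\<lambda>z. polar (fst z) (snd z)) ` B"
    then have "reach p r" "reach r q"
      unfolding p q reach_from_polar reach_to_polar by (auto simp: A_def B_def)
    then show "r \<in> J_plus dS p \<inter> J_minus dS q"
      by (auto simp: J_plus_def J_minus_def causal_le_dS)
  qed
  moreover have "(\<lambda>z. polar (fst z) (snd z)) ` A \<subseteq> plane0" by auto
  ultimately show "compactin (events dS) (J_plus dS p \<inter> J_minus dS q)"
    by (auto simp: compactin_subtopology)
qed

section \<open>Refocusing on the middle circle\<close>

lemma refocusing_at_dS: "refocusing_at dS (polar 0 \<phi>\<^sub>0)"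
proof -
  \<comment> \<open>The open half-plane around the given event. The events \<open>y\<close> chosen
    below lie on the opposite side, hence outside \<open>V\<close> and so outside every
    \<open>U\<close>.\<close>
  define V where "V = plane0 \<inter> {q. 0 < q 0 * cos \<phi>\<^sub>0 + q 1 * sin \<phi>\<^sub>0}"
  have V: "openin (top_of_set plane0) V"
    unfolding V_def by (intro openin_open_Int open_Collect_less continuous_intros)
  have V0: "polar 0 \<phi>\<^sub>0 \<in> V"
    by (simp add: V_def flip: power2_eq_square)
  have "\<exists>y\<in>plane0. y \<notin> U \<and> all_null_geodesics_enter dS y U"
    if U: "openin (top_of_set plane0) U" "polar 0 \<phi>\<^sub>0 \<in> U" "U \<subseteq> V" for U
  proof -
    obtain \<epsilon> where \<epsilon>: "\<epsilon> > 0" "diamond 0 \<phi>\<^sub>0 \<epsilon> \<subseteq> U"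
      using diamond_basis[OF U(1,2)] .
    have "((\<lambda>s. arsinh (- s)) has_real_derivative - 1) (at 0)"
      by (auto intro!: derivative_eq_intros)
    then have "isCont (\<lambda>s. ctime (arsinh (- s))) 0"
      by (intro DERIV_isCont[OF DERIV_chain2[OF ctime_deriv]])
    then have "((\<lambda>s. ctime (arsinh (- s))) \<longlongrightarrow> ctime 0) (at 0)"
      by (simp add: isCont_def)
    then have "eventually (\<lambda>s. dist (ctime (arsinh (- s))) (ctime 0) < \<epsilon>) (at 0)"
      using \<epsilon>(1) by (rule tendstoD)
    then obtain d where d: "d > 0" "\<And>s. s \<noteq> 0 \<Longrightarrow> dist s 0 < d \<Longrightarrow> dist (ctime (arsinh (- s))) (ctime 0) < \<epsilon>"
      unfolding eventually_at by blast
    define s where "s = d / 2"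
    have s: "s > 0" "\<bar>ctime (arsinh (- s)) - ctime 0\<bar> < \<epsilon>"
      using d(1) d(2)[of s] by (auto simp: s_def dist_real_def)
    have sU: "polar (arsinh (- s)) \<phi>\<^sub>0 \<in> U"
      by (rule subsetD[OF \<epsilon>(2) diamondI]) (use s(2) in simp)
    \<comment> \<open>Since arctan (1/n) = pi/2 - arctan n, going from the affine value n to -1/n =
      -s turns the angle by exactly pi, in either sense. Both null geodesics through
      \<open>y\<close> thus meet at the angle of the given event, at time arsinh (-s), which is in
      \<open>U\<close> for small s.\<close>
    define n where "n = 1 / s"
    have n: "n > 0" "- (1 / n) = - s" using s(1) by (auto simp: n_def)
    define y where "y = polar (arsinh n) (\<phi>\<^sub>0 + pi)"
    have "y 0 * cos \<phi>\<^sub>0 + y 1 * sin \<phi>\<^sub>0 = - exp (arsinh n) * ((cos \<phi>\<^sub>0)\<^sup>2 + (sin \<phi>\<^sub>0)\<^sup>2)"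
    proof -
      have "y 0 = - exp (arsinh n) * cos \<phi>\<^sub>0" "y 1 = - exp (arsinh n) * sin \<phi>\<^sub>0"
        by (simp_all add: y_def)
      then show ?thesis by algebra
    qed
    then have "y \<notin> V" by (simp add: V_def)
    moreover have "all_null_geodesics_enter dS y U"
      unfolding all_null_geodesics_enter_def
    proof (intro allI impI, elim conjE)
      fix I \<gamma> assume "null_geodesic dS I \<gamma>" and y: "y \<in> \<gamma> ` I"
      then obtain a b c \<kappa> where g: "I = UNIV" "a \<noteq> 0" "\<kappa> = 1 \<or> \<kappa> = -1"
        "\<And>t. \<gamma> t = polar (arsinh (a * t + b)) (c + 2 * \<kappa> * arctan (a * t + b))"
        using null_geodesic_form by metis
      obtain t where t: "y = \<gamma> t" using y by blast
      then have "polar (arsinh (a * t + b)) (c + 2 * \<kappa> * arctan (a * t + b)) = polar (arsinh n) (\<phi>\<^sub>0 + pi)"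
        unfolding y_def g(4) by simp
      then obtain k :: int where "arsinh (a * t + b) = arsinh n"
        and k': "c + 2 * \<kappa> * arctan (a * t + b) = \<phi>\<^sub>0 + pi + 2 * pi * k"
        unfolding polar_eq_iff by blast
      then have "a * t + b = n" by (metis sinh_arsinh_real)
      then have k: "c + 2 * \<kappa> * arctan n = \<phi>\<^sub>0 + pi + 2 * pi * k"
        using k' by simp
      define t' where "t' = (- s - b) / a"
      have t': "a * t' + b = - s" using g(2) by (simp add: t'_def)
      have "arctan (1 / n) = pi / 2 - arctan n" using n(1) arctan_inverse[of n] by (simp add: inverse_eq_divide)
      then have A: "arctan (- s) = arctan n - pi / 2" using n(2) by (simp add: arctan_minus)
      have "c + 2 * \<kappa> * arctan (- s) = \<phi>\<^sub>0 + pi - \<kappa> * pi + 2 * pi * k"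
        unfolding A using k by (simp add: algebra_simps)
      \<comment> \<open>The two senses of rotation arrive with angles that differ by one full turn,
        which accounts for k and k + 1.\<close>
      then have "c + 2 * \<kappa> * arctan (- s) = \<phi>\<^sub>0 + 2 * pi * of_int (if \<kappa> = 1 then k else k + 1)"
        using g(3) by (auto simp: algebra_simps)
      then have "\<exists>m::int. c + 2 * \<kappa> * arctan (- s) = \<phi>\<^sub>0 + 2 * pi * m" by blast
      then have "\<gamma> t' = polar (arsinh (- s)) \<phi>\<^sub>0"
        unfolding g(4) t' polar_eq_iff by simp
      then show "\<gamma> ` I \<inter> U \<noteq> {}" using sU g(1) by (metis IntI UNIV_I empty_iff image_eqI)
    qed
    ultimately show ?thesis
      using U(3) by (intro bexI[of _ y]) (auto simp: y_def)
  qed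
  then show ?thesis
    unfolding refocusing_at_def using V V0 by (intro exI[of _ V]) auto
qed

text \<open>The null geodesics through (\<tau>, \<phi>) cross the middle circle at the angles \<phi>
  - 2 A and \<phi> + 2 A with A = arctan (sinh \<tau>). If both crossings are the given event, 4 A
  is a multiple of 2 pi; but it is strictly between -2 pi and 2 pi, so A = 0 and the event is the
  given one.\<close>

lemma not_strongly_refocusing_dS: "\<not> strongly_refocusing_at dS (polar 0 \<phi>\<^sub>0)"
proof
  assume "strongly_refocusing_at dS (polar 0 \<phi>\<^sub>0)"
  then obtain y where y: "y \<in> plane0" "y \<noteq> polar 0 \<phi>\<^sub>0" and all: "all_null_geodesics_enter dS y {polar 0 \<phi>\<^sub>0}"
    by (auto simp: strongly_refocusing_at_def)
  obtain \<tau> \<phi> where pol: "y = polar \<tau> \<phi>" using plane0_polar[OF y(1)] .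
  define A where "A = arctan (sinh \<tau>)"
  have *: "\<exists>k::int. \<phi> - 2 * \<kappa> * A = \<phi>\<^sub>0 + 2 * pi * k" if "\<kappa>\<^sup>2 = 1" for \<kappa>
  proof -
    define c where "c = \<phi> - 2 * \<kappa> * A"
    have "y = polar (arsinh (sinh \<tau>)) (c + 2 * \<kappa> * arctan (sinh \<tau>))"
      by (simp add: pol c_def A_def arsinh_sinh_real)
    then have "y \<in> range (\<lambda>t. polar (arsinh t) (c + 2 * \<kappa> * arctan t))" by blast
    then have "polar 0 \<phi>\<^sub>0 \<in> range (\<lambda>t. polar (arsinh t) (c + 2 * \<kappa> * arctan t))"
      using all[unfolded all_null_geodesics_enter_def, rule_format, OF conjI[OF null_geodesic_polar[OF that, of c]]]
      by simp
    then obtain t where "polar (arsinh t) (c + 2 * \<kappa> * arctan t) = polar 0 \<phi>\<^sub>0" by auto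
    then show ?thesis by (auto simp: polar_eq_iff c_def)
  qed
  obtain k :: int where k: "\<phi> - 2 * A = \<phi>\<^sub>0 + 2 * pi * k" using *[of 1] by auto
  obtain l :: int where l: "\<phi> + 2 * A = \<phi>\<^sub>0 + 2 * pi * l" using *[of "-1"] by auto
  have A: "4 * A = 2 * pi * (of_int (l - k))" using k l by (simp add: algebra_simps)
  have "- (pi / 2) < A" "A < pi / 2" using arctan_bounded[of "sinh \<tau>"] by (auto simp: A_def)
  then have "2 * pi * (-1) < 2 * pi * of_int (l - k)" "2 * pi * of_int (l - k) < 2 * pi * 1"
    unfolding A[symmetric] by auto
  then have "(-1::real) < of_int (l - k)" "of_int (l - k) < (1::real)"
    by (simp_all only: mult_less_cancel_left_pos pi_gt_zero mult_pos_pos zero_less_numeral)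
  then have "l = k" by linarith
  then have A0: "A = 0" using A by simp
  then have "\<tau> = 0" by (simp add: A_def)
  moreover have "\<phi> = \<phi>\<^sub>0 + 2 * pi * k" using k A0 by simp
  ultimately have "y = polar 0 \<phi>\<^sub>0" unfolding pol polar_eq_iff by blast
  then show False using y(2) by simp
qed

section \<open>The hypersurface\<close>

definition unit_circle :: "(nat \<Rightarrow> real) set" where
  "unit_circle = {q \<in> plane0. nsq q = 1}"

lemma unit_circle_polar: "q \<in> unit_circle \<Longrightarrow> \<exists>\<phi>. q = polar 0 \<phi>"
proof -
  assume q: "q \<in> unit_circle"
  then obtain \<tau> \<phi> where p: "q = polar \<tau> \<phi>"
    using plane0_polar by (auto simp: unit_circle_def)
  then have "(exp \<tau>)\<^sup>2 = 1" using q by (simp add: unit_circle_def nsq_polar)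
  then have "exp \<tau> = 1" by (smt (verit) exp_gt_zero power2_eq_1_iff)
  then show ?thesis using p by auto
qed

text \<open>Each chart omits the point of the circle opposite to the angle \<alpha>, so a family is
  used, with \<alpha> the angle of the point to be covered.\<close>

locale slice_chart =
  fixes \<alpha> :: real
begin

definition X :: "(nat \<Rightarrow> real) \<Rightarrow> real" where "X q = cos \<alpha> * q 0 + sin \<alpha> * q 1"
definition Y :: "(nat \<Rightarrow> real) \<Rightarrow> real" where "Y q = cos \<alpha> * q 1 - sin \<alpha> * q 0"

definition U :: "(nat \<Rightarrow> real) set" where "U = {q \<in> plane0. X q + 1 > 0}"

text \<open>
  Stereographic projection in the coordinates rotated by \<open>\<alpha>\<close>: \<open>to_slice q 0\<close> is the slope of the
  line from \<open>(- 1, 0)\<close> to \<open>(X q, Y q)\<close>. This makes the chart and its inverse rational.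
\<close>

definition to_slice :: "(nat \<Rightarrow> real) \<Rightarrow> nat \<Rightarrow> real" where
  "to_slice q i = (if i = 0 then Y q / (X q + 1) else if i = 1 then (nsq q - 1) / (X q + 1) else 0)"

text \<open>The value of X + 1 recovered from the slice coordinates. Inserting Y = (X + 1) x0 into
  x1 = (X^2 + Y^2 - 1) / (X + 1) gives x1 = (X + 1) (1 + x0^2) - 2, which is linear in X + 1;
  dividing by X + 1 in \<open>to_slice\<close> is what achieves this.\<close>

definition m :: "(nat \<Rightarrow> real) \<Rightarrow> real" where "m x = (x 1 + 2) / (1 + (x 0)\<^sup>2)"

definition of_slice :: "(nat \<Rightarrow> real) \<Rightarrow> nat \<Rightarrow> real" where
  "of_slice x i = (if i = 0 then cos \<alpha> * (m x - 1) - sin \<alpha> * (m x * x 0)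
     else if i = 1 then sin \<alpha> * (m x - 1) + cos \<alpha> * (m x * x 0) else 0)"

text \<open>The image of the chart: \<open>x 1 + 2 > 0\<close> expresses X + 1 > 0, and the last
  condition removes the point that corresponds to the origin.\<close>

definition V :: "(nat \<Rightarrow> real) set" where
  "V = {x. (\<forall>i\<ge>2. x i = 0) \<and> x 1 + 2 > 0 \<and> nsq (of_slice x) > 0}"

lemma nsq_XY: "nsq q = (X q)\<^sup>2 + (Y q)\<^sup>2"
proof -
  have "(X q)\<^sup>2 + (Y q)\<^sup>2 = ((cos \<alpha>)\<^sup>2 + (sin \<alpha>)\<^sup>2) * nsq q"
    unfolding X_def Y_def nsq_def by algebra
  then show ?thesis by simp
qed

lemma XY_of_slice: "X (of_slice x) = m x - 1" "Y (of_slice x) = m x * x 0"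
proof -
  have "X (of_slice x) = ((cos \<alpha>)\<^sup>2 + (sin \<alpha>)\<^sup>2) * (m x - 1)"
    "Y (of_slice x) = ((cos \<alpha>)\<^sup>2 + (sin \<alpha>)\<^sup>2) * (m x * x 0)"
    unfolding X_def Y_def of_slice_def by (simp_all only: zero_neq_one one_neq_zero if_True if_False simp_thms) algebra+
  then show "X (of_slice x) = m x - 1" "Y (of_slice x) = m x * x 0" by simp_all
qed

lemma coordinates_from_XY:
  "q 0 = cos \<alpha> * X q - sin \<alpha> * Y q" "q 1 = sin \<alpha> * X q + cos \<alpha> * Y q"
proof -
  have "cos \<alpha> * X q - sin \<alpha> * Y q = ((cos \<alpha>)\<^sup>2 + (sin \<alpha>)\<^sup>2) * q 0"
    "sin \<alpha> * X q + cos \<alpha> * Y q = ((cos \<alpha>)\<^sup>2 + (sin \<alpha>)\<^sup>2) * q 1"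
    unfolding X_def Y_def by algebra+
  then show "q 0 = cos \<alpha> * X q - sin \<alpha> * Y q" "q 1 = sin \<alpha> * X q + cos \<alpha> * Y q" by simp_all
qed

lemma square_pos: "1 + (a::real)\<^sup>2 > 0"
  by (simp add: add_pos_nonneg)

lemma of_slice_to_slice:
  assumes "q \<in> U" shows "of_slice (to_slice q) = q"
proof -
  have pos: "X q + 1 > 0" and q: "q \<in> plane0" using assms by (auto simp: U_def)
  define x y where "x = X q" and "y = Y q"
  have "m (to_slice q) = ((x\<^sup>2 + y\<^sup>2 - 1) / (x + 1) + 2) / (1 + (y / (x + 1))\<^sup>2)"
    by (simp add: m_def to_slice_def nsq_XY x_def y_def)
  also have "\<dots> = x + 1"
  proof -
    have p: "x + 1 \<noteq> 0" "(x + 1)\<^sup>2 + y\<^sup>2 \<noteq> 0" using pos by (auto simp: x_def sum_power2_eq_zero_iff)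
    have "(x\<^sup>2 + y\<^sup>2 - 1) / (x + 1) + 2 = ((x + 1)\<^sup>2 + y\<^sup>2) / (x + 1)"
      using p(1) by (simp add: field_simps power2_eq_square)
    moreover have "1 + (y / (x + 1))\<^sup>2 = ((x + 1)\<^sup>2 + y\<^sup>2) / (x + 1)\<^sup>2"
      using p(1) by (simp add: field_simps)
    ultimately show ?thesis using p by (simp add: power2_eq_square)
  qed
  finally have m: "m (to_slice q) = X q + 1" by (simp add: x_def)
  have t: "m (to_slice q) * to_slice q 0 = Y q"
    unfolding m using pos by (simp add: to_slice_def)
  have "of_slice (to_slice q) i = q i" for i
  proof (cases "i < 2")
    case True
    then show ?thesis
      unfolding of_slice_def t unfolding m
      using coordinates_from_XY[of q] by (auto simp: less_2_cases_iff)
  next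
    case False
    then show ?thesis using q by (simp add: of_slice_def plane0_def)
  qed
  then show ?thesis by blast
qed

lemma to_slice_of_slice:
  assumes "x \<in> V" shows "to_slice (of_slice x) = x"
proof -
  have pos: "x 1 + 2 > 0" and x: "\<And>i. i \<ge> 2 \<Longrightarrow> x i = 0" using assms by (auto simp: V_def)
  have m: "m x > 0" "m x * (1 + (x 0)\<^sup>2) = x 1 + 2"
    using pos square_pos[of "x 0"] by (simp_all add: m_def)
  have "(nsq (of_slice x) - 1) / m x = x 1"
  proof -
    have "nsq (of_slice x) - 1 = m x * (m x * (1 + (x 0)\<^sup>2) - 2)"
      unfolding nsq_XY XY_of_slice by algebra
    then show ?thesis unfolding m(2) using m(1) by simp
  qed
  then have "to_slice (of_slice x) i = x i" for i
    using m(1) x[of i] less_2_cases_iff[of i] by (auto simp: to_slice_def XY_of_slice not_less)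
  then show ?thesis by blast
qed

lemma U_subset: "U \<subseteq> plane0"
  by (auto simp: U_def)

lemma to_slice_in_V: "q \<in> U \<Longrightarrow> to_slice q \<in> V"
proof -
  assume q: "q \<in> U"
  then have pos: "X q + 1 > 0" "nsq q > 0" by (auto simp: U_def plane0_def)
  have "(nsq q - 1) / (X q + 1) + 2 = ((X q + 1)\<^sup>2 + (Y q)\<^sup>2) / (X q + 1)"
    unfolding nsq_XY using pos(1) by (simp add: field_simps power2_eq_square)
  also have "\<dots> > 0" 
    by (rule divide_pos_pos[OF add_pos_nonneg[OF zero_less_power[OF pos(1)] zero_le_power2] pos(1)])
  finally show ?thesis
    using pos(2) of_slice_to_slice[OF q] by (simp add: V_def to_slice_def)
qed

lemma of_slice_in_U: "x \<in> V \<Longrightarrow> of_slice x \<in> U"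
proof -
  assume x: "x \<in> V"
  then have "m x > 0" using square_pos[of "x 0"] by (simp add: m_def V_def)
  then show ?thesis using x by (simp add: U_def XY_of_slice plane0_def V_def of_slice_def)
qed

lemma image_U: "to_slice ` U = V"
  using to_slice_in_V of_slice_in_U to_slice_of_slice by (metis image_eqI image_subset_iff subsetI subset_antisym)

lemma continuous_m: "continuous_on S m"
  unfolding m_def by (intro continuous_intros) (metis square_pos less_irrefl)

lemma continuous_of_slice: "continuous_on S of_slice"
proof (rule continuous_on_coordinatewise_then_product)
  fix i show "continuous_on S (\<lambda>x. of_slice x i)"
    unfolding of_slice_def
    by (cases "i = 0"; cases "i = 1") (auto intro!: continuous_intros continuous_m)
qed

lemma continuous_to_slice: "continuous_on U to_slice"
proof (rule continuous_on_coordinatewise_then_product)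
  fix i show "continuous_on U (\<lambda>x. to_slice x i)"
    unfolding to_slice_def X_def Y_def nsq_def
    by (cases "i = 0"; cases "i = 1") (auto intro!: continuous_intros simp: U_def X_def)
qed

lemma openin_U: "openin (top_of_set plane0) U"
proof -
  have "open {q. X q + 1 > 0}"
    unfolding X_def by (intro open_Collect_less continuous_intros)
  moreover have "U = plane0 \<inter> {q. X q + 1 > 0}" by (auto simp: U_def)
  ultimately show ?thesis by (auto simp: openin_open)
qed

lemma openin_U': "openin (Euclidean_space 2) U"
  using openin_U openin_plane0 openin_trans_full subtopology_plane0[OF order_refl] by metis

lemma openin_V: "openin (Euclidean_space 2) V"
proof -
  have "continuous_on UNIV (\<lambda>x. nsq (of_slice x))"
    unfolding nsq_def using continuous_on_product_then_coordinatewise[OF continuous_of_slice, of UNIV]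
    by (intro continuous_intros)
  then have "open {x. nsq (of_slice x) > 0}" by (intro open_Collect_less continuous_intros)
  moreover have "open {x :: nat \<Rightarrow> real. x 1 + 2 > 0}" by (intro open_Collect_less continuous_intros)
  ultimately have "open ({x. x 1 + 2 > 0} \<inter> {x. nsq (of_slice x) > 0})" by (rule open_Int[rotated])
  moreover have "V = {x. \<forall>i\<ge>2. x i = 0} \<inter> ({x. x 1 + 2 > 0} \<inter> {x. nsq (of_slice x) > 0})"
    by (auto simp: V_def)
  ultimately show ?thesis unfolding Euclidean_space_top_of_set by (auto simp: openin_open)
qed

definition chart :: "(nat \<Rightarrow> real) chart" where "chart = (U, to_slice)"

lemma chart_simps [simp]: "fst chart = U" "snd chart = to_slice"
  by (simp_all add: chart_def)

lemma chart_inv_chart: "x \<in> V \<Longrightarrow> chart_inv chart x = of_slice x"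
proof -
  assume x: "x \<in> V"
  have "inj_on to_slice U" using of_slice_to_slice by (metis inj_onI)
  then have "inv_into U to_slice (to_slice (of_slice x)) = of_slice x"
    by (rule inv_into_f_f[OF _ of_slice_in_U[OF x]])
  then show ?thesis by (simp add: chart_inv_def to_slice_of_slice[OF x])
qed

lemma is_chart_chart: "is_chart (top_of_set plane0) 2 chart"
proof -
  have sub: "subtopology (Euclidean_space 2) V = top_of_set V"
    by (auto simp: Euclidean_space_top_of_set subtopology_subtopology V_def intro!: arg_cong[where f = top_of_set])
  have "homeomorphic_maps (top_of_set U) (top_of_set V) to_slice of_slice"
    unfolding homeomorphic_maps_def
    using to_slice_in_V of_slice_in_U to_slice_of_slice of_slice_to_slice
    by (auto simp: continuous_to_slice continuous_of_slice)
  then have "homeomorphic_map (top_of_set U) (top_of_set V) to_slice"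
    using homeomorphic_map_maps by blast
  moreover have "subtopology (top_of_set plane0) U = top_of_set U"
    using U_subset by (simp add: subtopology_subtopology Int_absorb1)
  ultimately show ?thesis
    unfolding is_chart_def chart_simps image_U sub using openin_U openin_V by simp
qed

lemma smooth_on_linear:
  assumes "openin (Euclidean_space n) S"
  shows "smooth_on n S X" "smooth_on n S Y" "smooth_on n S nsq"
  unfolding X_def Y_def nsq_def
  by (intro smooth_on_add smooth_on_diff smooth_on_mult smooth_on_power smooth_on_const smooth_on_coordinate assms)+

lemma smooth_on_to_slice: "smooth_on 2 U (\<lambda>x. to_slice x k)"
proof -
  have "smooth_on 2 U (\<lambda>x. Y x / (X x + 1))" "smooth_on 2 U (\<lambda>x. (nsq x - 1) / (X x + 1))"
    by (intro smooth_on_divide smooth_on_add smooth_on_diff smooth_on_const smooth_on_linear openin_U';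
        force simp: U_def)+
  then show ?thesis
    unfolding to_slice_def using smooth_on_const[OF openin_U'] by (cases "k = 0"; cases "k = 1") simp_all
qed

lemma smooth_on_of_slice: "smooth_on 2 V (\<lambda>x. of_slice x k)"
proof -
  have "1 + (x 0)\<^sup>2 \<noteq> 0" for x :: "nat \<Rightarrow> real" by (metis square_pos less_irrefl)
  then have "smooth_on 2 V m"
    unfolding m_def
    by (intro smooth_on_divide smooth_on_add smooth_on_power smooth_on_const smooth_on_coordinate openin_V)
  then have "smooth_on 2 V (\<lambda>x. cos \<alpha> * (m x - 1) - sin \<alpha> * (m x * x 0))"
    "smooth_on 2 V (\<lambda>x. sin \<alpha> * (m x - 1) + cos \<alpha> * (m x * x 0))"
    by (intro smooth_on_mult smooth_on_add smooth_on_diff smooth_on_const smooth_on_coordinate openin_V; assumption)+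
  then show ?thesis
    unfolding of_slice_def using smooth_on_const[OF openin_V] by (cases "k = 0"; cases "k = 1") simp_all
qed

lemma compatible_chart_chart: "compatible_chart (top_of_set plane0) 2 {dS_chart} chart"
proof -
  have "smooth_on 2 V (\<lambda>x. transition chart dS_chart x k)" for k
    by (rule smooth_on_cong[OF openin_V _ smooth_on_of_slice[of k]]) (simp add: transition_def chart_inv_chart)
  moreover have "smooth_on 2 U (\<lambda>x. transition dS_chart chart x k)" for k
    by (rule smooth_on_cong[OF openin_U' _ smooth_on_to_slice[of k]])
       (use U_subset in \<open>auto simp: transition_def\<close>)
  moreover have "U \<inter> plane0 = U" "plane0 \<inter> U = U" using U_subset by blast+
  ultimately show ?thesis
    unfolding compatible_chart_def using is_chart_chart by (simp add: smooth_transition_def image_U)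
qed

text \<open>The coordinate with index 1 = \<open>ndim\<close> - 1 is \<open>nsq q - 1\<close>
  divided by a function that is positive on \<open>U\<close>.\<close>

lemma slice: "to_slice ` (U \<inter> unit_circle) = {x \<in> V. x 1 = 0}"
proof -
  have *: "to_slice q 1 = 0 \<longleftrightarrow> q \<in> unit_circle" if "q \<in> U" for q
    using that by (auto simp: to_slice_def unit_circle_def U_def)
  show ?thesis unfolding image_U[symmetric] using * by auto
qed

end

lemma hypersurface_unit_circle: "hypersurface (top_of_set plane0) 2 {dS_chart} unit_circle"
proof -
  have "polar 0 0 \<in> unit_circle" by (simp add: unit_circle_def nsq_polar)
  moreover have "\<exists>c. compatible_chart (top_of_set plane0) 2 {dS_chart} c \<and> p \<in> fst c \<and>
        snd c ` (fst c \<inter> unit_circle) = {x \<in> snd c ` fst c. x (2 - 1) = 0}" if p: "p \<in> unit_circle" for p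
  proof -
    obtain \<alpha> where \<alpha>: "p = polar 0 \<alpha>" using unit_circle_polar[OF p] by blast
    interpret slice_chart \<alpha> .
    have "X p = 1" by (simp add: X_def \<alpha> flip: power2_eq_square)
    then have "p \<in> U" by (simp add: U_def \<alpha>)
    then show ?thesis
      using compatible_chart_chart slice by (intro exI[of _ chart]) (simp add: image_U)
  qed
  moreover have "unit_circle \<subseteq> topspace (top_of_set plane0)" by (auto simp: unit_circle_def)
  ultimately show ?thesis
    unfolding hypersurface_def by blast
qed

theorem proposition5p6:
  shows "(\<exists>(M :: (nat \<Rightarrow> real) lorentz) x.
            spacetime M \<and> globally_hyperbolic M \<and> null_complete M \<and> timelike_complete M \<and>
            x \<in> topspace (events M) \<and>
            refocusing_at M x \<and> \<not> strongly_refocusing_at M x) \<and>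
         (\<exists>(M :: (nat \<Rightarrow> real) lorentz) H.
            spacetime M \<and> globally_hyperbolic M \<and> null_complete M \<and> timelike_complete M \<and>
            hypersurface (events M) (ndim M) (atlas M) H \<and>
            (\<forall>x\<in>H. refocusing_at M x \<and> \<not> strongly_refocusing_at M x))"
proof -
  note M = spacetime_dS globally_hyperbolic_dS null_complete_dS timelike_complete_dS
  have "polar 0 0 \<in> topspace (events dS)" by simp
  moreover have "hypersurface (events dS) (ndim dS) (atlas dS) unit_circle"
    using hypersurface_unit_circle by simp
  moreover have "\<forall>x\<in>unit_circle. refocusing_at dS x \<and> \<not> strongly_refocusing_at dS x"
    using unit_circle_polar refocusing_at_dS not_strongly_refocusing_dS by metis
  ultimately show ?thesis
    using M refocusing_at_dS not_strongly_refocusing_dS by blast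
qed

end
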